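(* Let $\Lambda=kQ/(\rho)$ be a string algebra. String modules, finite-dimensional band modules and primitive injective band modules are indecomposable $\Lambda$-modules. Moreover, isomorphisms between such modules exist only when the corresponding words are equivalent; precisely: (1) no string module is isomorphic to a module of the form $M(C,V)$ with $C$ a periodic word and $V$ a $k[T,T^{-1}]$-module; (2) for non-periodic words $C$ and $D$, the string modules $M(C)$ and $M(D)$ are isomorphic if and only if $C\sim D$; (3) for periodic words $C,D$ and non-zero $k[T,T^{-1}]$-modules $V,W$, one has $M(C,V)\cong M(D,W)$ if and only if for some $m\in\mathbb{Z}$ either $D=C[m]$ and $W\cong V$, or $D=(C^{-1})[m]$ and $W\cong \mathrm{res}_\iota V$.
   Context: String algebras. Let $k$ be a field, $Q$ a quiver (not necessarily finite), $kQ$ its path algebra; a product $xy$ of arrows is a path when the tail of $x$ equals the head of $y$ (first $y$, then $x$). Let $\rho$ be a set of paths of length $\ge 2$ ("zero relations"). $\Lambda=kQ/(\rho)$ is a string algebra if (a) every vertex of $Q$ is the head of at most two arrows and the tail of at most two arrows, and (b) for any arrow $y$ there is at most one path $xy$ of length 2 with $xy\notin\rho$ and at most one path $yz$ of length 2 with $yz\notin\rho$. $e_v$ is the trivial path at the vertex $v$. A $\Lambda$-module is a left module $M$ with $\Lambda M=M$ (equivalently $M=\bigoplus_v e_vM$). Words. A letter is an arrow $x$ (direct letter) or its formal inverse $x^{-1}$ (inverse letter); the head of $x^{-1}$ is the tail of $x$ and vice versa; $(x^{-1})^{-1}=x$. Let $I$ be $\{0,1,\dots,n\}$ ($n\ge0$),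 $\mathbb N=\{0,1,2,\dots\}$, $-\mathbb N=\{0,-1,-2,\dots\}$ or $\mathbb Z$. If $I\ne\{0\}$, an $I$-word $C$ is a sequence of letters $C_i$, one for each $i\in I$ with $i-1\in I$, such that for consecutive letters $C_i,C_{i+1}$ the tail of $C_i$ is the head of $C_{i+1}$ and $C_i^{-1}\neq C_{i+1}$, and no zero relation $x_1\dots x_m\in\rho$ nor its inverse $x_m^{-1}\dots x_1^{-1}$ occurs as a sequence of consecutive letters. For $I=\{0\}$ there are trivial words $1_{v,\epsilon}$ for each vertex $v$ and $\epsilon=\pm1$. For $i\in I$, $v_i(C)$ is the tail of $C_i$ or the head of $C_{i+1}$ (and $v$ for $1_{v,\epsilon}$). A word is direct (inverse) if all its letters are. The inverse $C^{-1}$ is obtained by inverting the letters and reversing their order, with $(1_{v,\epsilon})^{-1}=1_{v,-\epsilon}$; a $\mathbb Z$-word is written $\dots C_0|C_1\dots$ and its inverse is indexed as $\dots C_1^{-1}|C_0^{-1}\dots$. For a $\mathbb Z$-word, the shift is $C[n]=\dots C_n|C_{n+1}\dots$; for $I\ne\mathbb Z$ put $C[n]=C$. $C$ is periodic if it is a $\mathbb Z$-word with $C=C[n]$ for some $n>0$; the minimal such $n$ is the period. $C\sim D$ (equivalent) means $D=C[m]$ or $D=(C^{-1})[m]$ for some $m$. Modules. For an $I$-word $C$, $M(C)$ has $k$-basis $b_i$ ($i\in I$), with $e_vb_i=b_i$ if $v_i(C)=v$ and $0$ otherwise, and for an arrow $x$: $xb_i=b_{i-1}$ if $i-1\in I$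 and $C_i=x$; $xb_i=b_{i+1}$ if $i+1\in I$ and $C_{i+1}=x^{-1}$; $xb_i=0$ otherwise. If $C$ is periodic of period $n$, $M(C)$ is a $\Lambda$-$k[T,T^{-1}]$-bimodule with $T$ acting by $b_i\mapsto b_{i-n}$, and $M(C,V)=M(C)\otimes_{k[T,T^{-1}]}V$ for a $k[T,T^{-1}]$-module $V$. $\iota$ is the automorphism of $k[T,T^{-1}]$ exchanging $T$ and $T^{-1}$, and $\mathrm{res}_\iota$ is restriction along $\iota$. A string module is $M(C)$ with $C$ non-periodic. A band module is $M(C,V)$ with $C$ periodic and $V$ an indecomposable $k[T,T^{-1}]$-module. A primitive injective band module is $M(C,V)$ with $C$ a direct or inverse periodic word and $V$ the injective envelope of a simple $k[T,T^{-1}]$-module. *)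

theory Defs
  imports
    "HOL-Algebra.Module"
    "HOL-Algebra.QuotRing"
    "HOL-Algebra.Generated_Groups"
    "HOL-Algebra.Free_Abelian_Groups"
    "Graph_Theory.Arc_Walk"
begin

section \<open>Path algebras and string algebras\<close>

text \<open>
  A quiver is a \<^locale>\<open>wf_digraph\<close>; loops and multiple arrows are allowed and no finiteness is
  assumed. A path is a triple \<open>(h, [x\<^sub>1, \<dots>, x\<^sub>m], t)\<close> consisting of its head, its arrows and its
  tail. Paths compose as functions (\<open>x y\<close> means first \<open>y\<close>, then \<open>x\<close>), whereas walks in
  \<^theory>\<open>Graph_Theory.Arc_Walk\<close> list their arcs in order of traversal; hence the \<^const>\<open>rev\<close>.
\<close>

type_synonym ('v, 'e) path = "'v \<times> 'e list \<times> 'v"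

definition paths :: "('v, 'e) pre_digraph \<Rightarrow> ('v, 'e) path set" where
  "paths Q = {(h, xs, t). pre_digraph.awalk Q t (rev xs) h}"

definition trivial_path :: "'v \<Rightarrow> ('v, 'e) path" where
  "trivial_path v = (v, [], v)"

definition path_length :: "('v, 'e) path \<Rightarrow> nat" where
  "path_length p = length (fst (snd p))"

fun path_mult :: "('v, 'e) path \<Rightarrow> ('v, 'e) path \<Rightarrow> (('v, 'e) path \<Rightarrow>\<^sub>0 'k::field)" where
  "path_mult (h, xs, t) (h', ys, t') =
     (if t = h' then Poly_Mapping.single (h, xs @ ys, t') 1 else 0)"

definition kscale :: "'k::field \<Rightarrow> ('i \<Rightarrow>\<^sub>0 'k) \<Rightarrow> ('i \<Rightarrow>\<^sub>0 'k)" where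
  "kscale c f = Poly_Mapping.map (\<lambda>a. c * a) f"

definition klinear_extend :: "('i \<Rightarrow> ('j \<Rightarrow>\<^sub>0 'k::field)) \<Rightarrow> ('i \<Rightarrow>\<^sub>0 'k) \<Rightarrow> ('j \<Rightarrow>\<^sub>0 'k)" where
  "klinear_extend b f =
     (\<Sum>i\<in>Poly_Mapping.keys f. kscale (Poly_Mapping.lookup f i) (b i))"

text \<open>
  \<open>kQ\<close> has a unit only if \<open>Q\<close> has finitely many vertices. In the other case the field
  \<open>one\<close> below is \<open>0\<close> (an infinite sum); no definition about modules refers to it.
\<close>

definition path_algebra :: "('v, 'e) pre_digraph \<Rightarrow> (('v, 'e) path \<Rightarrow>\<^sub>0 'k::field) ring" where
  "path_algebra Q =
     \<lparr>carrier = {f. Poly_Mapping.keys f \<subseteq> paths Q},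
      monoid.mult = (\<lambda>f g. klinear_extend (\<lambda>p. klinear_extend (path_mult p) g) f),
      one = (\<Sum>v\<in>verts Q. Poly_Mapping.single (trivial_path v) 1),
      ring.zero = 0,
      ring.add = (+)\<rparr>"

text \<open>
  The library's \<^const>\<open>genideal\<close> presupposes a ring with unit, so ideals are defined here
  without using the field \<open>one\<close>.
\<close>

definition two_sided_ideal :: "('r, 'm) ring_scheme \<Rightarrow> 'r set \<Rightarrow> bool" where
  "two_sided_ideal A J \<longleftrightarrow> additive_subgroup J A \<and>
     (\<forall>a\<in>carrier A. \<forall>x\<in>J. a \<otimes>\<^bsub>A\<^esub> x \<in> J \<and> x \<otimes>\<^bsub>A\<^esub> a \<in> J)"

definition ideal_generated :: "('r, 'm) ring_scheme \<Rightarrow> 'r set \<Rightarrow> 'r set" where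
  "ideal_generated A S = \<Inter>{J. two_sided_ideal A J \<and> S \<subseteq> J}"

definition zero_relation_ideal ::
  "('v, 'e) pre_digraph \<Rightarrow> ('v, 'e) path set \<Rightarrow> (('v, 'e) path \<Rightarrow>\<^sub>0 'k::field) set" where
  "zero_relation_ideal Q \<rho> =
     ideal_generated (path_algebra Q) ((\<lambda>p. Poly_Mapping.single p 1) ` \<rho>)"

definition bound_path_algebra ::
  "('v, 'e) pre_digraph \<Rightarrow> ('v, 'e) path set \<Rightarrow> (('v, 'e) path \<Rightarrow>\<^sub>0 'k::field) set ring" where
  "bound_path_algebra Q \<rho> = path_algebra Q Quot zero_relation_ideal Q \<rho>"

locale string_algebra = wf_digraph Q
  for Q :: "('v, 'e) pre_digraph" and \<rho> :: "('v, 'e) path set" +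
  assumes relations_paths: "\<rho> \<subseteq> paths Q"
    and relations_length: "\<And>p. p \<in> \<rho> \<Longrightarrow> 2 \<le> path_length p"
    and heads_at_most_two: "\<And>v. v \<in> verts Q \<Longrightarrow>
      finite {x \<in> arcs Q. head Q x = v} \<and> card {x \<in> arcs Q. head Q x = v} \<le> 2"
    and tails_at_most_two: "\<And>v. v \<in> verts Q \<Longrightarrow>
      finite {x \<in> arcs Q. tail Q x = v} \<and> card {x \<in> arcs Q. tail Q x = v} \<le> 2"
    and left_continuation_unique: "\<And>x x' y. \<lbrakk>x \<in> arcs Q; x' \<in> arcs Q; y \<in> arcs Q;
      tail Q x = head Q y; (head Q x, [x, y], tail Q y) \<notin> \<rho>;
      tail Q x' = head Q y; (head Q x', [x', y], tail Q y) \<notin> \<rho>\<rbrakk> \<Longrightarrow> x = x'"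
    and right_continuation_unique: "\<And>y z z'. \<lbrakk>y \<in> arcs Q; z \<in> arcs Q; z' \<in> arcs Q;
      tail Q y = head Q z; (head Q y, [y, z], tail Q z) \<notin> \<rho>;
      tail Q y = head Q z'; (head Q y, [y, z'], tail Q z') \<notin> \<rho>\<rbrakk> \<Longrightarrow> z = z'"

section \<open>Modules\<close>

text \<open>
  Modules are \<^typ>\<open>('r, 'x) module\<close> records whose fields \<open>mult\<close> and \<open>one\<close> are irrelevant.
  The locale \<^locale>\<open>module\<close> of the library is for commutative rings with unit. For a ring that
  need not have a unit, the unit law is replaced by \<open>A M = M\<close>, where \<open>A M\<close> consists of the
  finite sums of elements \<open>a m\<close>.
\<close>

locale left_module = abelian_group M
  for A :: "('r, 'a) ring_scheme" and M :: "('r, 'x, 'b) module_scheme" (structure) +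
  assumes smult_closed: "\<lbrakk>a \<in> carrier A; x \<in> carrier M\<rbrakk> \<Longrightarrow> a \<odot> x \<in> carrier M"
    and smult_l_distr: "\<lbrakk>a \<in> carrier A; b \<in> carrier A; x \<in> carrier M\<rbrakk> \<Longrightarrow>
      (a \<oplus>\<^bsub>A\<^esub> b) \<odot> x = a \<odot> x \<oplus> b \<odot> x"
    and smult_r_distr: "\<lbrakk>a \<in> carrier A; x \<in> carrier M; y \<in> carrier M\<rbrakk> \<Longrightarrow>
      a \<odot> (x \<oplus> y) = a \<odot> x \<oplus> a \<odot> y"
    and smult_assoc: "\<lbrakk>a \<in> carrier A; b \<in> carrier A; x \<in> carrier M\<rbrakk> \<Longrightarrow>
      (a \<otimes>\<^bsub>A\<^esub> b) \<odot> x = a \<odot> (b \<odot> x)"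
    and smult_generates:
      "generate (add_monoid M) {a \<odot> x | a x. a \<in> carrier A \<and> x \<in> carrier M} = carrier M"

definition linear_maps ::
  "('r, 'a) ring_scheme \<Rightarrow> ('r, 'x, 'b) module_scheme \<Rightarrow> ('r, 'y, 'c) module_scheme \<Rightarrow> ('x \<Rightarrow> 'y) set"
where
  "linear_maps A M N = {h \<in> hom (add_monoid M) (add_monoid N).
     \<forall>a\<in>carrier A. \<forall>x\<in>carrier M. h (a \<odot>\<^bsub>M\<^esub> x) = a \<odot>\<^bsub>N\<^esub> h x}"

definition module_isomorphic ::
  "('r, 'a) ring_scheme \<Rightarrow> ('r, 'x, 'b) module_scheme \<Rightarrow> ('r, 'y, 'c) module_scheme \<Rightarrow> bool"
where
  "module_isomorphic A M N \<longleftrightarrow> (\<exists>h\<in>linear_maps A M N. bij_betw h (carrier M) (carrier N))"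

definition indecomposable :: "('r, 'a) ring_scheme \<Rightarrow> ('r, 'x) module \<Rightarrow> bool" where
  "indecomposable A M \<longleftrightarrow> carrier M \<noteq> {\<zero>\<^bsub>M\<^esub>} \<and>
     (\<forall>X Y. submodule X A M \<and> submodule Y A M \<and> X \<inter> Y = {\<zero>\<^bsub>M\<^esub>} \<and> X <+>\<^bsub>M\<^esub> Y = carrier M
        \<longrightarrow> X = {\<zero>\<^bsub>M\<^esub>} \<or> Y = {\<zero>\<^bsub>M\<^esub>})"

definition simple_module :: "('r, 'a) ring_scheme \<Rightarrow> ('r, 'x) module \<Rightarrow> bool" where
  "simple_module R S \<longleftrightarrow> Module.module R S \<and> carrier S \<noteq> {\<zero>\<^bsub>S\<^esub>} \<and>
     (\<forall>X. submodule X R S \<longrightarrow> X = {\<zero>\<^bsub>S\<^esub>} \<or> X = carrier S)"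

text \<open>
  Injectivity is the usual extension property for homomorphisms \<open>X \<rightarrow> E\<close> along inclusions \<open>X \<subseteq> B\<close>.
  One cannot quantify over all types inside a definition, so \<open>B\<close> ranges over the modules with
  elements in the type \<open>'r\<close> of scalars. When \<open>R\<close> is a ring with unit these include
  the regular module, so by Baer's criterion this is injectivity with respect to all modules.
\<close>

definition injective_module :: "('r, 'a) ring_scheme \<Rightarrow> ('r, 'x) module \<Rightarrow> bool" where
  "injective_module R E \<longleftrightarrow> Module.module R E \<and>
     (\<forall>(B :: ('r, 'r) module) X g.
        Module.module R B \<and> submodule X R B \<and> g \<in> linear_maps R (B\<lparr>carrier := X\<rparr>) E
        \<longrightarrow> (\<exists>h\<in>linear_maps R B E. \<forall>x\<in>X. h x = g x))"

definition essential_submodule :: "('r, 'a) ring_scheme \<Rightarrow> ('r, 'x) module \<Rightarrow> 'x set \<Rightarrow> bool" where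
  "essential_submodule R E S \<longleftrightarrow> submodule S R E \<and>
     (\<forall>X. submodule X R E \<and> X \<noteq> {\<zero>\<^bsub>E\<^esub>} \<longrightarrow> S \<inter> X \<noteq> {\<zero>\<^bsub>E\<^esub>})"

definition injective_envelope ::
  "('r, 'a) ring_scheme \<Rightarrow> ('r, 'x) module \<Rightarrow> ('r, 'y) module \<Rightarrow> bool" where
  "injective_envelope R S E \<longleftrightarrow> injective_module R E \<and>
     (\<exists>j\<in>linear_maps R S E. inj_on j (carrier S) \<and> essential_submodule R E (j ` carrier S))"

text \<open>
  A left module \<open>M\<close> over \<open>\<Lambda> = kQ/(\<rho>)\<close> with \<open>\<Lambda> M = M\<close> is a vector space over \<open>k\<close>: given \<open>m\<close> there
  is a finite set \<open>F\<close> of vertices with \<open>(\<Sum>v\<in>F. e\<^sub>v) m = m\<close>, and \<open>c m = (\<Sum>v\<in>F. c e\<^sub>v) m\<close>.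
\<close>

definition scaled_vertex_sum ::
  "('v, 'e) pre_digraph \<Rightarrow> ('v, 'e) path set \<Rightarrow> 'k::field \<Rightarrow> 'v set \<Rightarrow> (('v, 'e) path \<Rightarrow>\<^sub>0 'k) set"
where
  "scaled_vertex_sum Q \<rho> c F =
     zero_relation_ideal Q \<rho> +>\<^bsub>path_algebra Q\<^esub>
       (\<Sum>v\<in>F. Poly_Mapping.single (trivial_path v) c)"

definition field_smult ::
  "('v, 'e) pre_digraph \<Rightarrow> ('v, 'e) path set \<Rightarrow> ((('v, 'e) path \<Rightarrow>\<^sub>0 'k::field) set, 'x) module
   \<Rightarrow> 'k \<Rightarrow> 'x \<Rightarrow> 'x" where
  "field_smult Q \<rho> M c m = (THE y. \<exists>F. finite F \<and> F \<subseteq> verts Q \<and>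
     scaled_vertex_sum Q \<rho> 1 F \<odot>\<^bsub>M\<^esub> m = m \<and> y = scaled_vertex_sum Q \<rho> c F \<odot>\<^bsub>M\<^esub> m)"

definition finite_dimensional ::
  "('v, 'e) pre_digraph \<Rightarrow> ('v, 'e) path set \<Rightarrow> ((('v, 'e) path \<Rightarrow>\<^sub>0 'k::field) set, 'x) module \<Rightarrow> bool"
where
  "finite_dimensional Q \<rho> M \<longleftrightarrow> (\<exists>B. finite B \<and> B \<subseteq> carrier M \<and>
     (\<forall>m\<in>carrier M. \<exists>c. m = (\<Oplus>\<^bsub>M\<^esub>b\<in>B. field_smult Q \<rho> M (c b) b)))"

section \<open>Words\<close>

datatype 'e letter = Direct 'e | Inverse 'e

fun letter_arrow :: "'e letter \<Rightarrow> 'e" where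
  "letter_arrow (Direct x) = x"
| "letter_arrow (Inverse x) = x"

fun letter_inv :: "'e letter \<Rightarrow> 'e letter" where
  "letter_inv (Direct x) = Inverse x"
| "letter_inv (Inverse x) = Direct x"

fun letter_head :: "('v, 'e) pre_digraph \<Rightarrow> 'e letter \<Rightarrow> 'v" where
  "letter_head Q (Direct x) = head Q x"
| "letter_head Q (Inverse x) = tail Q x"

fun letter_tail :: "('v, 'e) pre_digraph \<Rightarrow> 'e letter \<Rightarrow> 'v" where
  "letter_tail Q (Direct x) = tail Q x"
| "letter_tail Q (Inverse x) = head Q x"

text \<open>
  \<open>Trivial v \<epsilon>\<close> is \<open>1\<^bsub>v,\<epsilon>\<^esub>\<close>. In \<open>Letters c\<close> the partial map \<open>c\<close> sends \<open>i\<close> to the letter \<open>C\<^sub>i\<close>.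
  Its domain is \<open>{i \<in> I. i - 1 \<in> I}\<close>, which for \<open>I \<noteq> {0}\<close> determines \<open>I\<close>.
\<close>

datatype ('v, 'e) word = Trivial 'v int | Letters "int \<Rightarrow> 'e letter option"

definition index_sets :: "int set set" where
  "index_sets = {{0..n} | n. 0 \<le> n} \<union> {{0..}, {..0}, UNIV}"

fun letter_at :: "('v, 'e) word \<Rightarrow> int \<Rightarrow> 'e letter option" where
  "letter_at (Trivial v \<epsilon>) i = None"
| "letter_at (Letters c) i = c i"

fun word_index :: "('v, 'e) word \<Rightarrow> int set" where
  "word_index (Trivial v \<epsilon>) = {0}"
| "word_index (Letters c) = {i. c i \<noteq> None \<or> c (i + 1) \<noteq> None}"

fun is_word :: "('v, 'e) pre_digraph \<Rightarrow> ('v, 'e) path set \<Rightarrow> ('v, 'e) word \<Rightarrow> bool" where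
  "is_word Q \<rho> (Trivial v \<epsilon>) \<longleftrightarrow> v \<in> verts Q \<and> (\<epsilon> = 1 \<or> \<epsilon> = -1)"
| "is_word Q \<rho> (Letters c) \<longleftrightarrow>
     (\<exists>I\<in>index_sets. I \<noteq> {0} \<and> dom c = {i \<in> I. i - 1 \<in> I}) \<and>
     (\<forall>i l. c i = Some l \<longrightarrow> letter_arrow l \<in> arcs Q) \<and>
     (\<forall>i l l'. c i = Some l \<and> c (i + 1) = Some l' \<longrightarrow>
        letter_tail Q l = letter_head Q l' \<and> letter_inv l \<noteq> l') \<and>
     (\<forall>(h, xs, t)\<in>\<rho>. \<forall>i.
        \<not> (\<forall>j<length xs. c (i + int j) = Some (Direct (xs ! j))) \<and>
        \<not> (\<forall>j<length xs. c (i + int j) = Some (Inverse (rev xs ! j))))"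

fun word_vertex :: "('v, 'e) pre_digraph \<Rightarrow> ('v, 'e) word \<Rightarrow> int \<Rightarrow> 'v" where
  "word_vertex Q (Trivial v \<epsilon>) i = v"
| "word_vertex Q (Letters c) i =
     (case c i of Some l \<Rightarrow> letter_tail Q l | None \<Rightarrow> letter_head Q (the (c (i + 1))))"

definition direct_word :: "('v, 'e) word \<Rightarrow> bool" where
  "direct_word C \<longleftrightarrow> (\<forall>i l. letter_at C i = Some l \<longrightarrow> (\<exists>x. l = Direct x))"

definition inverse_word :: "('v, 'e) word \<Rightarrow> bool" where
  "inverse_word C \<longleftrightarrow> (\<forall>i l. letter_at C i = Some l \<longrightarrow> (\<exists>x. l = Inverse x))"

text \<open>
  The inverse of \<open>C\<^sub>1 \<dots> C\<^sub>n\<close> has the letters \<open>C\<^sub>n\<^sup>-\<^sup>1 \<dots> C\<^sub>1\<^sup>-\<^sup>1\<close> in positions \<open>1, \<dots>, n\<close>. For infinite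
  words position \<open>i\<close> of the inverse holds the inverse of the letter in position \<open>1 - i\<close>, which
  exchanges the index sets \<open>{0..}\<close> and \<open>{..0}\<close>, and turns \<open>\<dots> C\<^sub>0 | C\<^sub>1 \<dots>\<close> into
  \<open>\<dots> C\<^sub>1\<^sup>-\<^sup>1 | C\<^sub>0\<^sup>-\<^sup>1 \<dots>\<close>. Both are covered by \<open>n + 1 - i\<close>, as \<^const>\<open>card\<close> is \<open>0\<close> on
  infinite sets.
\<close>

fun word_inv :: "('v, 'e) word \<Rightarrow> ('v, 'e) word" where
  "word_inv (Trivial v \<epsilon>) = Trivial v (- \<epsilon>)"
| "word_inv (Letters c) =
     Letters (\<lambda>i. map_option letter_inv (c (int (card (dom c)) + 1 - i)))"

fun word_shift :: "('v, 'e) word \<Rightarrow> int \<Rightarrow> ('v, 'e) word" where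
  "word_shift (Trivial v \<epsilon>) n = Trivial v \<epsilon>"
| "word_shift (Letters c) n =
     (if word_index (Letters c :: ('v, 'e) word) = UNIV then Letters (\<lambda>i. c (i + n)) else Letters c)"

definition periodic :: "('v, 'e) word \<Rightarrow> bool" where
  "periodic C \<longleftrightarrow> word_index C = UNIV \<and> (\<exists>n>0. C = word_shift C n)"

definition period :: "('v, 'e) word \<Rightarrow> nat" where
  "period C = (LEAST n. 0 < n \<and> C = word_shift C (int n))"

definition word_equiv :: "('v, 'e) word \<Rightarrow> ('v, 'e) word \<Rightarrow> bool" where
  "word_equiv C D \<longleftrightarrow> (\<exists>m. D = word_shift C m \<or> D = word_shift (word_inv C) m)"

section \<open>The modules M(C)\<close>

text \<open>The basis vector \<open>b\<^sub>i\<close> is \<^term>\<open>Poly_Mapping.single i 1\<close>.\<close>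

definition vertex_act ::
  "('v, 'e) pre_digraph \<Rightarrow> ('v, 'e) word \<Rightarrow> 'v \<Rightarrow> int \<Rightarrow> (int \<Rightarrow>\<^sub>0 'k::field)" where
  "vertex_act Q C v i = (if word_vertex Q C i = v then Poly_Mapping.single i 1 else 0)"

definition arrow_act :: "('v, 'e) word \<Rightarrow> 'e \<Rightarrow> int \<Rightarrow> (int \<Rightarrow>\<^sub>0 'k::field)" where
  "arrow_act C x i =
     (if letter_at C i = Some (Direct x) then Poly_Mapping.single (i - 1) 1
      else if letter_at C (i + 1) = Some (Inverse x) then Poly_Mapping.single (i + 1) 1
      else 0)"

fun path_act ::
  "('v, 'e) pre_digraph \<Rightarrow> ('v, 'e) word \<Rightarrow> ('v, 'e) path \<Rightarrow> (int \<Rightarrow>\<^sub>0 'k::field) \<Rightarrow> (int \<Rightarrow>\<^sub>0 'k)"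
where
  "path_act Q C (h, xs, t) m =
     foldr (\<lambda>x. klinear_extend (arrow_act C x)) xs (klinear_extend (vertex_act Q C t) m)"

definition path_algebra_act ::
  "('v, 'e) pre_digraph \<Rightarrow> ('v, 'e) word \<Rightarrow> (('v, 'e) path \<Rightarrow>\<^sub>0 'k::field)
   \<Rightarrow> (int \<Rightarrow>\<^sub>0 'k) \<Rightarrow> (int \<Rightarrow>\<^sub>0 'k)" where
  "path_algebra_act Q C f m = klinear_extend (\<lambda>p. path_act Q C p m) f"

text \<open>
  An element of \<open>kQ/(\<rho>)\<close> is a coset \<open>L\<close>. It acts through any of its representatives, as \<open>(\<rho>)\<close>
  annihilates the \<open>kQ\<close>-module in question.
\<close>

definition string_module ::
  "('v, 'e) pre_digraph \<Rightarrow> ('v, 'e) word \<Rightarrow> ((('v, 'e) path \<Rightarrow>\<^sub>0 'k::field) set, int \<Rightarrow>\<^sub>0 'k) module"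
where
  "string_module Q C =
     \<lparr>carrier = {m. Poly_Mapping.keys m \<subseteq> word_index C},
      monoid.mult = undefined, one = undefined, ring.zero = 0, ring.add = (+),
      smult = (\<lambda>L m. the_elem ((\<lambda>f. path_algebra_act Q C f m) ` L))\<rparr>"

section \<open>The modules M(C,V)\<close>

text \<open>
  \<^typ>\<open>int \<Rightarrow>\<^sub>0 'k\<close> with convolution as multiplication is \<open>k[T,T\<^sup>-\<^sup>1]\<close>; here \<open>T\<^sup>j\<close> is
  \<^term>\<open>Poly_Mapping.single (j::int) 1\<close>.
\<close>

definition laurent_ring :: "(int \<Rightarrow>\<^sub>0 'k::field) ring" where
  "laurent_ring = \<lparr>carrier = UNIV, monoid.mult = (*), one = 1, ring.zero = 0, ring.add = (+)\<rparr>"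

definition laurent_iota :: "(int \<Rightarrow>\<^sub>0 'k::field) \<Rightarrow> (int \<Rightarrow>\<^sub>0 'k)" where
  "laurent_iota f = Poly_Mapping.map_key uminus f"

definition res_iota :: "(int \<Rightarrow>\<^sub>0 'k::field, 'x) module \<Rightarrow> (int \<Rightarrow>\<^sub>0 'k, 'x) module" where
  "res_iota V = V\<lparr>smult := (\<lambda>f v. laurent_iota f \<odot>\<^bsub>V\<^esub> v)\<rparr>"

definition periodic_laurent_module ::
  "('v, 'e) word \<Rightarrow> (int \<Rightarrow>\<^sub>0 'k::field, int \<Rightarrow>\<^sub>0 'k) module" where
  "periodic_laurent_module C =
     \<lparr>carrier = {m. Poly_Mapping.keys m \<subseteq> word_index C},
      monoid.mult = undefined, one = undefined, ring.zero = 0, ring.add = (+),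
      smult = (\<lambda>f m. klinear_extend
        (\<lambda>j. klinear_extend (\<lambda>i. Poly_Mapping.single (i - j * int (period C)) 1) m) f)\<rparr>"

text \<open>
  The tensor product over a commutative ring \<open>R\<close> is the free abelian group on pairs modulo
  the bilinearity and balancing relations. If \<open>M\<close> and \<open>M'\<close> are the same abelian group,
  viewed as a left \<open>A\<close>-module and as an \<open>R\<close>-module with commuting actions, then
  \<open>tensor_module R M M' V\<close> is the left \<open>A\<close>-module \<open>M \<otimes>\<^sub>R V\<close>.
\<close>

definition tensor_relations ::
  "('r, 'a) ring_scheme \<Rightarrow> ('r, 'x) module \<Rightarrow> ('r, 'y) module \<Rightarrow> ('x \<times> 'y \<Rightarrow>\<^sub>0 int) set" where
  "tensor_relations R M V =
     {frag_of (x \<oplus>\<^bsub>M\<^esub> x', v) - frag_of (x, v) - frag_of (x', v) | x x' v.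
        x \<in> carrier M \<and> x' \<in> carrier M \<and> v \<in> carrier V} \<union>
     {frag_of (x, v \<oplus>\<^bsub>V\<^esub> v') - frag_of (x, v) - frag_of (x, v') | x v v'.
        x \<in> carrier M \<and> v \<in> carrier V \<and> v' \<in> carrier V} \<union>
     {frag_of (r \<odot>\<^bsub>M\<^esub> x, v) - frag_of (x, r \<odot>\<^bsub>V\<^esub> v) | r x v.
        r \<in> carrier R \<and> x \<in> carrier M \<and> v \<in> carrier V}"

definition tensor_group ::
  "('r, 'a) ring_scheme \<Rightarrow> ('r, 'x) module \<Rightarrow> ('r, 'y) module \<Rightarrow> ('x \<times> 'y \<Rightarrow>\<^sub>0 int) set monoid" where
  "tensor_group R M V =
     free_Abelian_group (carrier M \<times> carrier V) Mod
       generate (free_Abelian_group (carrier M \<times> carrier V)) (tensor_relations R M V)"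

definition tensor_module ::
  "('r, 'a) ring_scheme \<Rightarrow> ('l, 'x) module \<Rightarrow> ('r, 'x) module \<Rightarrow> ('r, 'y) module
   \<Rightarrow> ('l, ('x \<times> 'y \<Rightarrow>\<^sub>0 int) set) module" where
  "tensor_module R M M' V =
     \<lparr>carrier = carrier (tensor_group R M' V),
      monoid.mult = undefined, one = undefined,
      ring.zero = \<one>\<^bsub>tensor_group R M' V\<^esub>,
      ring.add = monoid.mult (tensor_group R M' V),
      smult = (\<lambda>a Z. the_elem ((\<lambda>z.
        \<one>\<^bsub>tensor_group R M' V\<^esub> #>\<^bsub>free_Abelian_group (carrier M' \<times> carrier V)\<^esub>
          frag_extend (\<lambda>(x, v). frag_of (a \<odot>\<^bsub>M\<^esub> x, v)) z) ` Z))\<rparr>"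

definition band_module ::
  "('v, 'e) pre_digraph \<Rightarrow> ('v, 'e) word \<Rightarrow> (int \<Rightarrow>\<^sub>0 'k::field, 'x) module
   \<Rightarrow> ((('v, 'e) path \<Rightarrow>\<^sub>0 'k) set, ((int \<Rightarrow>\<^sub>0 'k) \<times> 'x \<Rightarrow>\<^sub>0 int) set) module" where
  "band_module Q C V =
     tensor_module laurent_ring (string_module Q C) (periodic_laurent_module C) V"

end

theory Submission
  imports Defs
begin

text \<open>
  For the basis vectors \<open>b\<^sub>i\<close> of \<open>M(C)\<close> and \<open>b\<^sub>j\<close> of \<open>M(D)\<close> consider the coefficient of \<open>b\<^sub>j\<close> in the image
  of \<open>b\<^sub>i\<close> under a homomorphism. It does not change when an arrow moves \<open>i\<close> and \<open>j\<close> simultaneously, and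
  it vanishes when an arrow leads to \<open>b\<^sub>i\<close> but not to \<open>b\<^sub>j\<close>, or out of \<open>b\<^sub>j\<close> but not out of \<open>b\<^sub>i\<close>. A nonzero
  coefficient is therefore a one-sided simulation between the positions \<open>i\<close> and \<open>j\<close>, and positions
  that simulate each other have the same surroundings up to the direction of reading. If
  \<open>g h = 1\<close>, then some \<open>i\<close> and \<open>j\<close> simulate each other, so the two words are equivalent.

  For endomorphisms, mutual simulation of \<open>i\<close> and \<open>j\<close> means \<open>i = j\<close>, or \<open>i \<equiv> j\<close> modulo the period for a
  periodic word. Simulation is thus a partial order on the positions up to this identification, and
  taking the diagonal coefficient is multiplicative; it has values in \<open>k\<close>, or in the endomorphisms
  of the \<open>k[T,T\<^sup>-\<^sup>1]\<close>-module \<open>V\<close>. An idempotent endomorphism with zero diagonal vanishes, because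
  elements have finite support and hence a minimal position in their support. So the decompositions of
  \<open>M(C,V)\<close> come from those of \<open>V\<close>, and isomorphisms \<open>M(C,V) \<cong> M(C,W)\<close> come from isomorphisms \<open>V \<cong> W\<close>.
  Neither finite dimension nor injectivity matters: an injective envelope of a simple module is
  indecomposable because its socle is contained in every nonzero submodule.
\<close>

section \<open>Simulations between words\<close>

text \<open>Endomorphism rings of string modules need not be local: for one loop and no relations
  the polynomial ring itself is the string module of an infinite inverse word. Decompositions are
  therefore tested on idempotents alone, and the support of a single element does the work of finite
  dimension. The one-sidedness of a simulation has a module meaning. The positions of
  \<open>C\<close> that it meets are closed under predecessors along arrows, so they index a
  quotient of \<open>M(C)\<close>; those of \<open>D\<close> are closed under successors and index a
  submodule of \<open>M(D)\<close>. A simulation is the pattern of a map from such a quotient to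
  such a submodule. Mutual simulation forgets the direction of reading: at a position only the
  unordered pair of letters leaving it is visible. Once a direction is fixed at one position,
  reducedness forces every further letter. Band modules keep coordinates at all integers and not at
  residues. An arrow then always moves a position by one, without wrapping around, and
  \<open>T\<close> enters only as a relation between congruent coordinates.\<close>

definition step :: "(int \<Rightarrow> 'e letter option) \<Rightarrow> 'e \<Rightarrow> int \<Rightarrow> int \<Rightarrow> bool" where
  "step c x i i' \<longleftrightarrow> c i = Some (Direct x) \<and> i' = i - 1 \<or> c (i + 1) = Some (Inverse x) \<and> i' = i + 1"

definition simulation ::
  "(int \<Rightarrow> 'e letter option) \<Rightarrow> (int \<Rightarrow> 'e letter option) \<Rightarrow> (int \<Rightarrow> int \<Rightarrow> bool) \<Rightarrow> bool" where
  "simulation c d R \<longleftrightarrow> (\<forall>i j. R i j \<longrightarrow>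
     (\<forall>x i'. step c x i' i \<longrightarrow> (\<exists>j'. step d x j' j)) \<and>
     (\<forall>x j'. step d x j j' \<longrightarrow> (\<exists>i'. step c x i i')) \<and>
     (\<forall>x i' j'. step c x i i' \<longrightarrow> step d x j j' \<longrightarrow> R i' j') \<and>
     (\<forall>x i' j'. step c x i' i \<longrightarrow> step d x j' j \<longrightarrow> R i' j'))"

text \<open>The four conditions speak of one pair at a time and conclude with membership, so they
  survive unions: this is the largest simulation. To prove \<open>sim\<close> it is enough to
  exhibit any relation closed under the conditions.\<close>

definition sim ::
  "(int \<Rightarrow> 'e letter option) \<Rightarrow> (int \<Rightarrow> 'e letter option) \<Rightarrow> int \<Rightarrow> int \<Rightarrow> bool" where
  "sim c d i j \<longleftrightarrow> (\<exists>R. simulation c d R \<and> R i j)"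

lemma simI: "simulation c d R \<Longrightarrow> R i j \<Longrightarrow> sim c d i j"
  unfolding sim_def by (rule exI[of _ R]) simp

lemma sim_incoming: "sim c d i j \<Longrightarrow> step c x i' i \<Longrightarrow> \<exists>j'. step d x j' j"
  and sim_outgoing: "sim c d i j \<Longrightarrow> step d x j j' \<Longrightarrow> \<exists>i'. step c x i i'"
  unfolding sim_def simulation_def by metis+

lemma sim_forward:
  assumes "sim c d i j" "step c x i i'" "step d x j j'"
  shows "sim c d i' j'"
proof -
  obtain R where R: "simulation c d R" "R i j"
    using assms(1) unfolding sim_def by blast
  then have "R i' j'"
    using assms(2,3) unfolding simulation_def by metis
  with R(1) show ?thesis
    by (rule simI)
qed

lemma sim_backward:
  assumes "sim c d i j" "step c x i' i" "step d x j' j"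
  shows "sim c d i' j'"
proof -
  obtain R where R: "simulation c d R" "R i j"
    using assms(1) unfolding sim_def by blast
  then have "R i' j'"
    using assms(2,3) unfolding simulation_def by metis
  with R(1) show ?thesis
    by (rule simI)
qed

text \<open>Incoming steps are passed from \<open>c\<close> through \<open>d\<close> to
  \<open>e\<close>, outgoing ones back from \<open>e\<close> through \<open>d\<close> to
  \<open>c\<close>. A step common to \<open>c\<close> and \<open>e\<close> is followed by
  \<open>d\<close> for the same reason: the outgoing condition supplies it forwards, the incoming
  condition backwards.\<close>

lemma sim_trans:
  assumes "sim c d i j" "sim d e j k"
  shows "sim c e i k"
proof (rule simI[where R = "\<lambda>i k. \<exists>j. sim c d i j \<and> sim d e j k"])
  show "simulation c e (\<lambda>i k. \<exists>j. sim c d i j \<and> sim d e j k)"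
    unfolding simulation_def
  proof (intro allI impI conjI; elim exE conjE)
    fix i k j x i' assume "sim c d i j" "sim d e j k" "step c x i' i"
    then show "\<exists>k'. step e x k' k"
      by (meson sim_incoming)
  next
    fix i k j x k' assume "sim c d i j" "sim d e j k" "step e x k k'"
    then show "\<exists>i'. step c x i i'"
      by (meson sim_outgoing)
  next
    fix i k x i' k' j assume "step c x i i'" "step e x k k'" "sim c d i j" "sim d e j k"
    then show "\<exists>j. sim c d i' j \<and> sim d e j k'"
      by (meson sim_outgoing sim_forward)
  next
    fix i k x i' k' j assume "step c x i' i" "step e x k' k" "sim c d i j" "sim d e j k"
    then show "\<exists>j. sim c d i' j \<and> sim d e j k'"
      by (meson sim_incoming sim_backward)
  qed
qed (use assms in blast)

text \<open>Periods of the two words act on simulations by translation. This allows a position to be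
  replaced by a congruent one, on each side separately.\<close>

lemma sim_shift:
  assumes "sim c d i j" "\<And>t. c (t + a) = c t" "\<And>t. d (t + b) = d t"
  shows "sim c d (i + a) (j + b)"
proof (rule simI[where R = "\<lambda>i j. sim c d (i - a) (j - b)"])
  have c: "step c x (p + a) (q + a) \<longleftrightarrow> step c x p q" for x p q
    using assms(2)[of p] assms(2)[of "p + 1"] by (auto simp: step_def algebra_simps)
  have d: "step d x (p + b) (q + b) \<longleftrightarrow> step d x p q" for x p q
    using assms(3)[of p] assms(3)[of "p + 1"] by (auto simp: step_def algebra_simps)
  have c': "step c x p q \<Longrightarrow> step c x (p - a) (q - a)" for x p q
    using c[of x "p - a" "q - a"] by simp
  have d': "step d x p q \<Longrightarrow> step d x (p - b) (q - b)" for x p q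
    using d[of x "p - b" "q - b"] by simp
  show "simulation c d (\<lambda>i j. sim c d (i - a) (j - b))"
    unfolding simulation_def
  proof (intro allI impI conjI)
    fix i j x i' assume "sim c d (i - a) (j - b)" "step c x i' i"
    then obtain k where "step d x k (j - b)"
      by (meson sim_incoming c')
    then show "\<exists>j'. step d x j' j"
      using d[of x k "j - b"] by (intro exI[of _ "k + b"]) simp
  next
    fix i j x j' assume "sim c d (i - a) (j - b)" "step d x j j'"
    then obtain k where "step c x (i - a) k"
      by (meson sim_outgoing d')
    then show "\<exists>i'. step c x i i'"
      using c[of x "i - a" k] by (intro exI[of _ "k + a"]) simp
  next
    fix i j x i' j' assume "sim c d (i - a) (j - b)" "step c x i i'" "step d x j j'"
    then show "sim c d (i' - a) (j' - b)"
      by (meson sim_forward c' d')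
  next
    fix i j x i' j' assume "sim c d (i - a) (j - b)" "step c x i' i" "step d x j' j"
    then show "sim c d (i' - a) (j' - b)"
      by (meson sim_backward c' d')
  qed
  show "sim c d (i + a - a) (j + b - b)"
    using assms(1) by simp
qed

section \<open>Reduced letter maps and their reflection\<close>

lemma letter_inv_inv [simp]: "letter_inv (letter_inv l) = l"
  by (cases l) auto

lemma letter_inv_neq [simp]: "letter_inv l \<noteq> l" "l \<noteq> letter_inv l"
  by (cases l; simp)+

lemma map_option_letter_inv_fixed: "map_option letter_inv l = l \<Longrightarrow> l = None"
  by (cases l) auto

lemma inj_map_option_letter_inv: "inj (map_option letter_inv)"
  by (intro option.inj_map injI) (metis letter_inv_inv)

definition reduced :: "(int \<Rightarrow> 'e letter option) \<Rightarrow> bool" where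
  "reduced c \<longleftrightarrow> (\<forall>i l. c i = Some l \<longrightarrow> c (i + 1) \<noteq> Some (letter_inv l))"

definition convex_dom :: "(int \<Rightarrow> 'e letter option) \<Rightarrow> bool" where
  "convex_dom c \<longleftrightarrow> (\<forall>i j k. c i \<noteq> None \<longrightarrow> c k \<noteq> None \<longrightarrow> i \<le> j \<longrightarrow> j \<le> k \<longrightarrow> c j \<noteq> None)"

text \<open>The index set recovered from the letters alone. In the absence of letters every integer
  counts, which keeps the notion invariant under reflection.\<close>

definition letter_positions :: "(int \<Rightarrow> 'e letter option) \<Rightarrow> int set" where
  "letter_positions c = {i. c i \<noteq> None \<or> c (i + 1) \<noteq> None \<or> (\<forall>j. c j = None)}"

text \<open>
  The letter \<open>c i\<close> joins the positions \<open>i - 1\<close> and \<open>i\<close>, so reflecting the positions at \<open>0\<close> means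
  \<open>i \<mapsto> 1 - i\<close> on letters.
\<close>

definition reflect :: "(int \<Rightarrow> 'e letter option) \<Rightarrow> int \<Rightarrow> 'e letter option" where
  "reflect c = (\<lambda>i. map_option letter_inv (c (1 - i)))"

lemma step_reflect: "step (reflect c) x i i' \<longleftrightarrow> step c x (- i) (- i')"
proof -
  have inv: "letter_inv l = Direct x \<longleftrightarrow> l = Inverse x" "letter_inv l = Inverse x \<longleftrightarrow> l = Direct x" for l
    by (cases l; simp)+
  show ?thesis
    by (auto simp: step_def reflect_def inv algebra_simps)
qed

lemma sim_reflect:
  assumes "sim c d i j"
  shows "sim (reflect c) (reflect d) (- i) (- j)"
proof (rule simI[where R = "\<lambda>i j. sim c d (- i) (- j)"])
  show "simulation (reflect c) (reflect d) (\<lambda>i j. sim c d (- i) (- j))"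
    unfolding simulation_def step_reflect
  proof (intro allI impI conjI)
    fix i j x i' assume "sim c d (- i) (- j)" "step c x (- i') (- i)"
    then show "\<exists>j'. step d x (- j') (- j)"
      by (metis minus_minus sim_incoming)
  next
    fix i j x j' assume "sim c d (- i) (- j)" "step d x (- j) (- j')"
    then show "\<exists>i'. step c x (- i) (- i')"
      by (metis minus_minus sim_outgoing)
  qed (auto intro: sim_forward sim_backward)
qed (use assms in simp)

lemma reduced_reflect: "reduced c \<Longrightarrow> reduced (reflect c)"
  unfolding reduced_def reflect_def
proof (intro allI impI notI)
  fix i l
  assume red: "\<forall>i l. c i = Some l \<longrightarrow> c (i + 1) \<noteq> Some (letter_inv l)"
    and "map_option letter_inv (c (1 - i)) = Some l"
      "map_option letter_inv (c (1 - (i + 1))) = Some (letter_inv l)"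
  then obtain k k' where "c (1 - i) = Some k" "letter_inv k = l" "c (- i) = Some k'" "letter_inv k' = letter_inv l"
    by auto
  then show False
    using red[rule_format, of "- i" k'] by (metis add.commute letter_inv_inv uminus_add_conv_diff)
qed

lemma convex_reflect: "convex_dom c \<Longrightarrow> convex_dom (reflect c)"
  unfolding convex_dom_def reflect_def
proof (intro allI impI)
  fix i j k
  assume conv: "\<forall>i j k. c i \<noteq> None \<longrightarrow> c k \<noteq> None \<longrightarrow> i \<le> j \<longrightarrow> j \<le> k \<longrightarrow> c j \<noteq> None"
    and "map_option letter_inv (c (1 - i)) \<noteq> None" "map_option letter_inv (c (1 - k)) \<noteq> None"
    and le: "i \<le> j" "j \<le> k"
  then have "c (1 - k) \<noteq> None" "c (1 - i) \<noteq> None"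
    by (metis option.map_disc_iff)+
  moreover have "1 - k \<le> 1 - j" "1 - j \<le> 1 - i"
    using le by simp_all
  ultimately have "c (1 - j) \<noteq> None"
    using conv by blast
  then show "map_option letter_inv (c (1 - j)) \<noteq> None"
    by simp
qed

lemma positions_reflect: "i \<in> letter_positions c \<Longrightarrow> - i \<in> letter_positions (reflect c)"
  unfolding letter_positions_def reflect_def by (auto simp: algebra_simps)

text \<open>Two targets of one position need \<open>Direct x\<close> at \<open>i\<close> and
  \<open>Inverse x\<close> at \<open>i + 1\<close>, an adjacent pair of mutually inverse
  letters.\<close>

lemma step_unique:
  assumes "reduced c" "step c x i i'" "step c x i i''"
  shows "i' = i''"
  using assms unfolding step_def reduced_def by (metis letter.distinct(1) letter_inv.simps option.inject)

text \<open>Two sources would require \<open>Inverse x\<close> followed by \<open>Direct x\<close>.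
  Together with the uniqueness of targets, an arrow acts on positions as a partial injection; this
  is why each coefficient of \<open>x m\<close> is a single coefficient of \<open>m\<close> or
  zero.\<close>

lemma step_unique':
  assumes "reduced c" "step c x i' i" "step c x i'' i"
  shows "i' = i''"
proof -
  have "\<not> (c (i + 1) = Some (Direct x) \<and> c i = Some (Inverse x))"
    using assms(1) unfolding reduced_def by (metis letter_inv.simps(2))
  moreover have "c (i + 1) = Some (Direct x) \<and> k = i + 1 \<or> c i = Some (Inverse x) \<and> k = i - 1"
    if "step c x k i" for k
    using that unfolding step_def by auto
  ultimately show ?thesis
    using assms(2,3) by metis
qed

text \<open>The graph of \<open>i \<mapsto> - i\<close> is a simulation both ways; uniqueness of
  steps keeps parallel steps inside the graph. Composition with it turns a reversed comparison of
  two words into a parallel one.\<close>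

lemma sim_reflect_self:
  assumes "reduced c"
  shows "sim c (reflect c) i (- i)" "sim (reflect c) c (- i) i"
proof -
  have "simulation c (reflect c) (\<lambda>i j. j = - i)"
    unfolding simulation_def step_reflect
  proof (intro allI impI conjI)
    fix i j x i' assume "j = - i" "step c x i' i"
    then show "\<exists>j'. step c x (- j') (- j)"
      by (intro exI[of _ "- i'"]) simp
  next
    fix i j x j' assume "j = - i" "step c x (- j) (- j')"
    then show "\<exists>i'. step c x i i'"
      by (intro exI[of _ "- j'"]) simp
  next
    fix i j x i' j' assume "j = - i" "step c x i i'" "step c x (- j) (- j')"
    then show "j' = - i'"
      using step_unique[OF assms, of x i i' "- j'"] by simp
  next
    fix i j x i' j' assume "j = - i" "step c x i' i" "step c x (- j') (- j)"
    then show "j' = - i'"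
      using step_unique'[OF assms, of x i' i "- j'"] by simp
  qed
  from simI[OF this] show "sim c (reflect c) i (- i)"
    by blast
  have "simulation (reflect c) c (\<lambda>i j. i = - j)"
    unfolding simulation_def step_reflect
  proof (intro allI impI conjI)
    fix i j x i' assume "i = - j" "step c x (- i') (- i)"
    then show "\<exists>j'. step c x j' j"
      by (intro exI[of _ "- i'"]) simp
  next
    fix i j x j' assume "i = - j" "step c x j j'"
    then show "\<exists>i'. step c x (- i) (- i')"
      by (intro exI[of _ "- j'"]) simp
  next
    fix i j x i' j' assume "i = - j" "step c x (- i) (- i')" "step c x j j'"
    then show "i' = - j'"
      using step_unique[OF assms, of x j j' "- i'"] by simp
  next
    fix i j x i' j' assume "i = - j" "step c x (- i') (- i)" "step c x j' j"
    then show "i' = - j'"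
      using step_unique'[OF assms, of x j' j "- i'"] by simp
  qed
  from simI[OF this] show "sim (reflect c) c (- i) i"
    by blast
qed

text \<open>The letter to the right of \<open>i\<close> is an arrow into or out of \<open>i\<close>,
  so the simulations give the same arrow at \<open>j\<close>. It cannot sit on the left of
  \<open>j\<close>, since \<open>d j = c i\<close> and reducedness of \<open>c\<close> forbids
  \<open>c i\<close> to be inverse to \<open>c (i + 1)\<close>.\<close>

lemma right_letter_transfer:
  assumes "sim c d i j" "sim d c j i" "reduced c" "c i = d j" "c i \<noteq> None" "c (i + 1) = Some l"
  shows "d (j + 1) = Some l"
proof (cases l)
  case (Direct y)
  with assms obtain j' where "step d y j' j"
    using sim_incoming[of c d i j y "i + 1"] by (auto simp: step_def)
  then show ?thesis
    using assms Direct unfolding step_def reduced_def by (metis add_diff_cancel diff_add_cancel letter_inv.simps(2))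
next
  case (Inverse y)
  with assms obtain j' where "step d y j j'"
    using sim_outgoing[of d c j i y "i + 1"] by (auto simp: step_def)
  then show ?thesis
    using assms Inverse unfolding step_def reduced_def by (metis letter_inv.simps(1))
qed

lemma sim_right:
  assumes "sim c d i j" "c (i + 1) = Some l" "d (j + 1) = Some l"
  shows "sim c d (i + 1) (j + 1)"
proof (cases l)
  case (Direct x)
  with assms(2,3) have "step c x (i + 1) i" "step d x (j + 1) j"
    unfolding step_def by simp_all
  with assms(1) show ?thesis
    by (rule sim_backward)
next
  case (Inverse x)
  with assms(2,3) have "step c x i (i + 1)" "step d x j (j + 1)"
    unfolding step_def by simp_all
  with assms(1) show ?thesis
    by (rule sim_forward)
qed

text \<open>Two matching letters around the starting positions fix the direction of reading; from
  then on every letter is forced by its left neighbour. The invariant carries both simulations and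
  the next letter, because each step crosses a letter that is already matched.\<close>

lemma aligned_right:
  assumes sims: "sim c d i j" "sim d c j i" and red: "reduced c" "reduced d"
    and eq: "c i = d j" "c (i + 1) = d (j + 1)"
    and letters: "\<And>s. s < t \<Longrightarrow> c (i + 1 + int s) \<noteq> None"
  shows "sim c d (i + int t) (j + int t) \<and> sim d c (j + int t) (i + int t) \<and>
    c (i + int t) = d (j + int t) \<and> c (i + 1 + int t) = d (j + 1 + int t)"
  using letters
proof (induction t)
  case 0
  then show ?case
    using sims eq by simp
next
  case (Suc t)
  let ?i = "i + int t" and ?j = "j + int t"
  have IH: "sim c d ?i ?j" "sim d c ?j ?i" "c (?i + 1) = d (?j + 1)"
    using Suc by (auto simp: algebra_simps)
  obtain l where l: "c (?i + 1) = Some l"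
    using Suc.prems[of t] by (auto simp: algebra_simps)
  have sims': "sim c d (?i + 1) (?j + 1)" "sim d c (?j + 1) (?i + 1)"
    using sim_right[OF IH(1), of l] sim_right[OF IH(2), of l] l IH(3) by auto
  have letters: "d (?j + 1) = c (?i + 1)" "d (?j + 1) \<noteq> None" "c (?i + 1) = d (?j + 1)" "c (?i + 1) \<noteq> None"
    using l IH(3) by auto
  \<comment> \<open>Either both words stop here or a letter of one is transferred to the other. The
    transfer from \<open>d\<close> back to \<open>c\<close> excludes that \<open>c\<close> alone
    stops.\<close>
  have "c (?i + 1 + 1) = d (?j + 1 + 1)"
  proof (cases "c (?i + 1 + 1)")
    case None
    then show ?thesis
      using right_letter_transfer[OF sims'(2,1) red(2) letters(1,2)] by (cases "d (?j + 1 + 1)") auto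
  next
    case (Some l')
    then show ?thesis
      using right_letter_transfer[OF sims' red(1) letters(3,4)] by metis
  qed
  then show ?case
    using sims' IH(3) by (simp add: algebra_simps)
qed

lemma convex_right_end:
  assumes "convex_dom c" "i \<in> letter_positions c" "c (i + 1 + int s) = None" "s < t"
  shows "c (i + int t) = None"
proof (rule ccontr)
  assume *: "c (i + int t) \<noteq> None"
  then obtain k where "c k \<noteq> None" "k \<le> i + 1"
    using assms(2) unfolding letter_positions_def by force
  with * have "c (i + 1 + int s) \<noteq> None"
    using assms(1)[unfolded convex_dom_def, rule_format, of k "i + int t" "i + 1 + int s"] assms(4)
    by simp
  with assms(3) show False
    by simp
qed

text \<open>If no letter is missing before the offset, the induction applies. Otherwise both words
  stop at the same first gap, and convexity leaves nothing beyond it.\<close>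

lemma aligned_right_all:
  assumes al: "sim c d i j" "sim d c j i" "reduced c" "reduced d" "c i = d j" "c (i + 1) = d (j + 1)"
    and conv: "convex_dom c" "convex_dom d" "i \<in> letter_positions c" "j \<in> letter_positions d"
  shows "c (i + int t) = d (j + int t)"
proof (cases "\<forall>s<t. c (i + 1 + int s) \<noteq> None")
  case True
  then have "\<And>s. s < t \<Longrightarrow> c (i + 1 + int s) \<noteq> None"
    by blast
  from aligned_right[OF al this] show ?thesis
    by blast
next
  case False
  define P where "P = (\<lambda>s. c (i + 1 + int s) = None)"
  from False obtain s0 where "P s0" "s0 < t"
    unfolding P_def by blast
  define s where "s = (LEAST s. P s)"
  have "P s" "s < t"
    unfolding s_def using \<open>P s0\<close> \<open>s0 < t\<close> by (auto intro: LeastI Least_le[THEN le_less_trans])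
  have "c (i + 1 + int u) \<noteq> None" if "u < s" for u
    using not_less_Least[OF that[unfolded s_def]] unfolding P_def .
  from aligned_right[OF al this] have "c (i + 1 + int s) = d (j + 1 + int s)"
    by blast
  with \<open>P s\<close> have end_c: "c (i + 1 + int s) = None" and end_d: "d (j + 1 + int s) = None"
    unfolding P_def by simp_all
  show ?thesis
    unfolding convex_right_end[OF conv(1,3) end_c \<open>s < t\<close>] convex_right_end[OF conv(2,4) end_d \<open>s < t\<close>] ..
qed

lemma aligned_all:
  assumes sims: "sim c d i j" "sim d c j i" and red: "reduced c" "reduced d"
    and eq: "c i = d j" "c (i + 1) = d (j + 1)"
    and conv: "convex_dom c" "convex_dom d" "i \<in> letter_positions c" "j \<in> letter_positions d"
  shows "c (i + t) = d (j + t)"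
proof (cases "t \<ge> 0")
  case True
  then show ?thesis
    using aligned_right_all[OF assms, of "nat t"] by simp
next
  case False
  have sims': "sim (reflect c) (reflect d) (- i) (- j)" "sim (reflect d) (reflect c) (- j) (- i)"
    using sims by (blast intro: sim_reflect)+
  have red': "reduced (reflect c)" "reduced (reflect d)"
    using red by (blast intro: reduced_reflect)+
  have eq': "reflect c (- i) = reflect d (- j)" "reflect c (- i + 1) = reflect d (- j + 1)"
    using eq by (simp_all add: reflect_def add.commute)
  have conv': "convex_dom (reflect c)" "convex_dom (reflect d)"
    "- i \<in> letter_positions (reflect c)" "- j \<in> letter_positions (reflect d)"
    using conv by (blast intro: convex_reflect positions_reflect)+
  \<comment> \<open>Letter \<open>i + t\<close> of \<open>c\<close> is letter
    \<open>1 - i - t\<close> of the reflection, hence the offset \<open>1 - t\<close> from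
    \<open>- i\<close> instead of \<open>- t\<close>.\<close>
  have "reflect c (- i + int (nat (1 - t))) = reflect d (- j + int (nat (1 - t)))"
    by (rule aligned_right_all[OF sims' red' eq' conv'])
  moreover have "1 - (- i + int (nat (1 - t))) = i + t" "1 - (- j + int (nat (1 - t))) = j + t"
    using False by simp_all
  ultimately have "map_option letter_inv (c (i + t)) = map_option letter_inv (d (j + t))"
    unfolding reflect_def by (simp only:)
  then show ?thesis
    using inj_map_option_letter_inv by (rule injD[rotated])
qed

text \<open>An unordered pair is determined by the letters occurring in it, provided none occurs
  twice: a doubled letter could not be told from a single one next to \<open>None\<close>.\<close>

lemma option_pair_eq:
  assumes "\<And>l. a = Some l \<or> a' = Some l \<longleftrightarrow> b = Some l \<or> b' = Some l"
    and "\<And>l. \<not> (a = Some l \<and> a' = Some l)" "\<And>l. \<not> (b = Some l \<and> b' = Some l)"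
  shows "a = b \<and> a' = b' \<or> a = b' \<and> a' = b"
  by (metis assms option.exhaust)

text \<open>The letters leaving position \<open>i\<close> are \<open>c (i + 1)\<close> and the
  inverse of \<open>c i\<close>; a direct one is an arrow into the position, an inverse one an arrow
  out of it. Mutual simulation preserves the set of these letters and reducedness keeps the two
  distinct, so only their order is lost.\<close>

lemma sim_cases:
  assumes sims: "sim c d i j" "sim d c j i" and red: "reduced c" "reduced d"
  shows "c i = d j \<and> c (i + 1) = d (j + 1) \<or>
    c i = map_option letter_inv (d (j + 1)) \<and> c (i + 1) = map_option letter_inv (d j)"
proof -
  have inv: "letter_inv l = Direct x \<longleftrightarrow> l = Inverse x" "letter_inv l = Inverse x \<longleftrightarrow> l = Direct x" for l and x :: 'a
    by (cases l; simp)+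
  have out: "(\<exists>k. step e x p k) \<longleftrightarrow> e (p + 1) = Some (Inverse x) \<or> map_option letter_inv (e p) = Some (Inverse x)"
    for e :: "int \<Rightarrow> 'a letter option" and x p
    by (auto simp: step_def inv)
  have inc: "(\<exists>k. step e x k p) \<longleftrightarrow> e (p + 1) = Some (Direct x) \<or> map_option letter_inv (e p) = Some (Direct x)"
    for e :: "int \<Rightarrow> 'a letter option" and x p
    by (auto simp: step_def inv intro: exI[of _ "p + 1"] exI[of _ "p - 1"])
  have "(\<exists>k. step c x i k) = (\<exists>k. step d x j k)" "(\<exists>k. step c x k i) = (\<exists>k. step d x k j)" for x
    using sim_incoming[OF sims(1)] sim_outgoing[OF sims(1)] sim_incoming[OF sims(2)] sim_outgoing[OF sims(2)]
    by blast+
  then have same: "c (i + 1) = Some l \<or> map_option letter_inv (c i) = Some l \<longleftrightarrow>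
      d (j + 1) = Some l \<or> map_option letter_inv (d j) = Some l" for l
    unfolding out inc by (cases l) simp_all
  have dist: "e (p + 1) = Some l \<Longrightarrow> map_option letter_inv (e p) \<noteq> Some l" if "reduced e"
    for e :: "int \<Rightarrow> 'a letter option" and p l
    using that unfolding reduced_def by (metis letter_inv_inv map_option_eq_Some)
  have "c (i + 1) = d (j + 1) \<and> map_option letter_inv (c i) = map_option letter_inv (d j) \<or>
        c (i + 1) = map_option letter_inv (d j) \<and> map_option letter_inv (c i) = d (j + 1)"
  proof (rule option_pair_eq)
    show "\<not> (c (i + 1) = Some l \<and> map_option letter_inv (c i) = Some l)"
      "\<not> (d (j + 1) = Some l \<and> map_option letter_inv (d j) = Some l)" for l
      using dist red by blast+
  qed (rule same)
  moreover have "map_option letter_inv (map_option letter_inv l) = l" for l :: "'a letter option"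
    by (cases l) auto
  ultimately show ?thesis
    by (elim disjE) (metis, metis)
qed

text \<open>In the swapped case \<open>d\<close> is replaced by its reflection, which simulates
  \<open>d\<close> and is simulated by it, and the parallel case applies.\<close>

lemma sim_aligned:
  assumes sims: "sim c d i j" "sim d c j i" and red: "reduced c" "reduced d"
    and conv: "convex_dom c" "convex_dom d" "i \<in> letter_positions c" "j \<in> letter_positions d"
  shows "(\<forall>t. c (i + t) = d (j + t)) \<or> (\<forall>t. c (i + t) = map_option letter_inv (d (j + 1 - t)))"
proof -
  from sim_cases[OF sims red] show ?thesis
  proof
    assume "c i = d j \<and> c (i + 1) = d (j + 1)"
    then show ?thesis
      using aligned_all[OF sims red _ _ conv] by blast
  next
    assume eq: "c i = map_option letter_inv (d (j + 1)) \<and> c (i + 1) = map_option letter_inv (d j)"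
    have "c (i + t) = reflect d (- j + t)" for t
    proof (rule aligned_all)
      show "sim c (reflect d) i (- j)" "sim (reflect d) c (- j) i"
        using sims sim_reflect_self[OF red(2)] by (blast intro: sim_trans)+
      show "reduced (reflect d)" "convex_dom (reflect d)" "- j \<in> letter_positions (reflect d)"
        using red conv by (auto intro: reduced_reflect convex_reflect positions_reflect)
      show "c i = reflect d (- j)" "c (i + 1) = reflect d (- j + 1)"
        using eq by (simp_all add: reflect_def algebra_simps)
    qed (use assms in auto)
    then show ?thesis
      by (simp add: reflect_def algebra_simps)
  qed
qed

text \<open>A reversing self-alignment would invert a letter or a pair of adjacent letters at its centre.\<close>

lemma self_sim_translation:
  assumes sims: "sim c c i j" "sim c c j i" and red: "reduced c"
    and conv: "convex_dom c" "i \<in> letter_positions c" "j \<in> letter_positions c" and "c \<noteq> (\<lambda>_. None)"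
  shows "c (t + (j - i)) = c t"
proof -
  have ends: "\<exists>k\<le>p + 1. c k \<noteq> None" "\<exists>k\<ge>p. c k \<noteq> None" if "p \<in> letter_positions c" for p
  proof -
    have "c p \<noteq> None \<or> c (p + 1) \<noteq> None"
      using that \<open>c \<noteq> (\<lambda>_. None)\<close> by (auto simp: letter_positions_def)
    moreover have "p \<le> p + 1"
      by simp
    ultimately show "\<exists>k\<le>p + 1. c k \<noteq> None" "\<exists>k\<ge>p. c k \<noteq> None"
      by blast+
  qed
  have between: "c u \<noteq> None" if pq: "p \<in> letter_positions c" "q \<in> letter_positions c" and "p + 1 \<le> u" "u \<le> q" for p q u
  proof -
    obtain k k' where "c k \<noteq> None" "k \<le> p + 1" "c k' \<noteq> None" "q \<le> k'"
      using ends(1)[OF pq(1)] ends(2)[OF pq(2)] by blast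
    then show ?thesis
      using conv(1)[unfolded convex_dom_def, rule_format, of k k' u] that by simp
  qed
  have "i = j" if rev: "\<forall>t. c (i + t) = map_option letter_inv (c (j + 1 - t))"
  proof (rule ccontr)
    assume "i \<noteq> j"
    have rev': "c u = map_option letter_inv (c (i + j + 1 - u))" for u
      using rev[rule_format, of "u - i"] by (simp add: algebra_simps)
    \<comment> \<open>The reversal exchanges letters \<open>u\<close> and
      \<open>i + j + 1 - u\<close>. If \<open>i + j\<close> is even, its centre is a position and
      the two letters next to it are mutually inverse; otherwise its centre is a letter equal to its
      own inverse. The central letter exists because it lies between \<open>i\<close> and
      \<open>j\<close>.\<close>
    consider u where "i + j = 2 * u" | u where "i + j + 1 = 2 * u"
      by atomize_elim presburger
    then show False
    proof cases
      case 1
      then have "i + j + 1 - u = u + 1"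
        by simp
      then have "c u = map_option letter_inv (c (u + 1))"
        using rev'[of u] by metis
      moreover have "c (u + 1) \<noteq> None"
      proof (cases "i < j")
        case True
        with 1 show ?thesis
          by (intro between[OF conv(2,3)]) auto
      next
        case False
        with 1 \<open>i \<noteq> j\<close> show ?thesis
          by (intro between[OF conv(3,2)]) auto
      qed
      then obtain l where l: "c (u + 1) = Some l"
        by blast
      ultimately have "c u = Some (letter_inv l)"
        by simp
      with l show False
        using red unfolding reduced_def by (metis letter_inv_inv)
    next
      case 2
      then have "i + j + 1 - u = u"
        by simp
      then have "c u = map_option letter_inv (c u)"
        using rev'[of u] by metis
      then have "c u = None"
        by (metis map_option_letter_inv_fixed)
      moreover have "c u \<noteq> None"
      proof (cases "i < j")
        case True
        with 2 show ?thesis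
          by (intro between[OF conv(2,3)]) auto
      next
        case False
        with 2 \<open>i \<noteq> j\<close> show ?thesis
          by (intro between[OF conv(3,2)]) auto
      qed
      ultimately show False
        by simp
    qed
  qed
  then consider "\<forall>t. c (i + t) = c (j + t)" | "i = j"
    using sim_aligned[OF sims red red conv(1,1,2,3)] by blast
  then show ?thesis
  proof cases
    case 1
    have "c (t + (j - i)) = c (j + (t - i))"
      by (rule arg_cong) simp
    also have "\<dots> = c (i + (t - i))"
      by (rule 1[rule_format, symmetric])
    also have "\<dots> = c t"
      by (rule arg_cong) simp
    finally show ?thesis .
  qed simp
qed

section \<open>Linear extensions\<close>

lemma lookup_kscale [simp]: "Poly_Mapping.lookup (kscale c f) i = c * Poly_Mapping.lookup f i"
  unfolding kscale_def by (simp add: Poly_Mapping.map.rep_eq when_def)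

lemma kscale_add: "kscale c (f + g) = kscale c f + kscale c g"
  by (rule poly_mapping_eqI) (simp add: lookup_add distrib_left)

lemma kscale_add_left: "kscale (c + d) f = kscale c f + kscale d f"
  by (rule poly_mapping_eqI) (simp add: lookup_add distrib_right)

lemma kscale_zero [simp]: "kscale c 0 = 0" "kscale 0 f = 0"
  by (rule poly_mapping_eqI, simp)+

lemma kscale_one [simp]: "kscale 1 f = f"
  by (rule poly_mapping_eqI) simp

lemma kscale_kscale [simp]: "kscale c (kscale d f) = kscale (c * d) f"
  by (rule poly_mapping_eqI) simp

lemma kscale_single [simp]: "kscale c (Poly_Mapping.single i d) = Poly_Mapping.single i (c * d)"
  by (rule poly_mapping_eqI) (simp add: lookup_single when_def)

lemma kscale_sum: "kscale c (sum f A) = (\<Sum>a\<in>A. kscale c (f a))"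
  by (induction A rule: infinite_finite_induct) (simp_all add: kscale_add)

lemma lookup_klinear_extend:
  "Poly_Mapping.lookup (klinear_extend b f) j =
    (\<Sum>i\<in>Poly_Mapping.keys f. Poly_Mapping.lookup f i * Poly_Mapping.lookup (b i) j)"
  unfolding klinear_extend_def by (simp add: lookup_sum)

lemma klinear_extend_superset:
  assumes "finite A" "Poly_Mapping.keys f \<subseteq> A"
  shows "klinear_extend b f = (\<Sum>i\<in>A. kscale (Poly_Mapping.lookup f i) (b i))"
  unfolding klinear_extend_def
  by (rule sum.mono_neutral_left) (use assms in \<open>auto simp: in_keys_iff\<close>)

lemma klinear_extend_add: "klinear_extend b (f + g) = klinear_extend b f + klinear_extend b g"
proof -
  let ?A = "Poly_Mapping.keys f \<union> Poly_Mapping.keys g"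
  have "klinear_extend b h = (\<Sum>i\<in>?A. kscale (Poly_Mapping.lookup h i) (b i))"
    if "Poly_Mapping.keys h \<subseteq> ?A" for h
    by (rule klinear_extend_superset) (use that in auto)
  from this[of f] this[of g] this[of "f + g"] show ?thesis
    using keys_add[of f g] by (simp add: lookup_add kscale_add_left sum.distrib)
qed

lemma klinear_extend_kscale: "klinear_extend b (kscale c f) = kscale c (klinear_extend b f)"
proof -
  have "Poly_Mapping.keys (kscale c f) \<subseteq> Poly_Mapping.keys f"
    by (auto simp: in_keys_iff)
  from klinear_extend_superset[OF _ this] show ?thesis
    unfolding klinear_extend_def by (simp add: kscale_sum)
qed

lemma klinear_extend_zero [simp]: "klinear_extend b 0 = 0"
  unfolding klinear_extend_def by simp

lemma klinear_extend_single [simp]: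
  "klinear_extend b (Poly_Mapping.single i c) = kscale c (b i)"
  by (cases "c = 0") (simp_all add: klinear_extend_def)

lemma klinear_extend_cong:
  "(\<And>i. i \<in> Poly_Mapping.keys f \<Longrightarrow> b i = b' i) \<Longrightarrow> klinear_extend b f = klinear_extend b' f"
  unfolding klinear_extend_def by (rule sum.cong) auto

lemma klinear_extend_pointwise_add:
  "klinear_extend (\<lambda>i. b i + b' i) f = klinear_extend b f + klinear_extend b' f"
  unfolding klinear_extend_def by (simp add: kscale_add sum.distrib)

lemma klinear_extend_compose:
  assumes "\<And>f g. L (f + g) = L f + L g" "\<And>c f. L (kscale c f) = kscale c (L f)"
  shows "L (klinear_extend b f) = klinear_extend (\<lambda>i. L (b i)) f"
proof -
  have zero: "L 0 = 0"
    using assms(1)[of 0 0] by simp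
  show ?thesis
    unfolding klinear_extend_def sum_comp_morphism[of L, OF zero assms(1), symmetric]
    by (simp add: assms(2))
qed

lemma keys_klinear_extend:
  "Poly_Mapping.keys (klinear_extend b f) \<subseteq> (\<Union>i\<in>Poly_Mapping.keys f. Poly_Mapping.keys (b i))"
proof
  fix j assume "j \<in> Poly_Mapping.keys (klinear_extend b f)"
  then have "(\<Sum>i\<in>Poly_Mapping.keys f. Poly_Mapping.lookup f i * Poly_Mapping.lookup (b i) j) \<noteq> 0"
    by (simp add: in_keys_iff lookup_klinear_extend)
  then obtain i where "i \<in> Poly_Mapping.keys f" "Poly_Mapping.lookup f i * Poly_Mapping.lookup (b i) j \<noteq> 0"
    by (meson sum.not_neutral_contains_not_neutral)
  then show "j \<in> (\<Union>i\<in>Poly_Mapping.keys f. Poly_Mapping.keys (b i))"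
    by (auto simp: in_keys_iff)
qed

text \<open>Additive form of the induction over supports. The new index is fresh and lies in
  \<open>S\<close>, so carriers defined by a bound on the support are respected throughout.\<close>

lemma poly_mapping_add_single_induct [consumes 1, case_names zero add]:
  fixes f :: "'i \<Rightarrow>\<^sub>0 'b::comm_monoid_add"
  assumes "Poly_Mapping.keys f \<subseteq> S" and "P 0" "\<And>f i c. P f \<Longrightarrow> i \<notin> Poly_Mapping.keys f \<Longrightarrow> i \<in> S \<Longrightarrow> Poly_Mapping.keys f \<subseteq> S \<Longrightarrow> P (f + Poly_Mapping.single i c)"
  shows "P f"
  using assms(1)
proof (induction f rule: update_induct)
  case const
  then show ?case
    using assms(2) by simp
next
  case (update f i c)
  have "Poly_Mapping.update i c f = f + Poly_Mapping.single i c"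
    by (rule poly_mapping_eqI)
      (use update.hyps in \<open>auto simp: lookup_update lookup_add lookup_single when_def in_keys_iff\<close>)
  moreover have "Poly_Mapping.keys (Poly_Mapping.update i c f) = insert i (Poly_Mapping.keys f)"
    using update.hyps by (simp add: keys_update)
  ultimately show ?case
    using update assms(3) by simp
qed

section \<open>The bound path algebra\<close>

lemma path_algebra_simps [simp]:
  "carrier (path_algebra Q) = {f. Poly_Mapping.keys f \<subseteq> paths Q}"
  "ring.zero (path_algebra Q) = 0"
  "ring.add (path_algebra Q) = (+)"
  "monoid.mult (path_algebra Q) = (\<lambda>f g. klinear_extend (\<lambda>p. klinear_extend (path_mult p) g) f)"
  by (simp_all add: path_algebra_def)

lemma abelian_group_poly_mapping:
  assumes "carrier M = {f :: 'i \<Rightarrow>\<^sub>0 'k::field. Poly_Mapping.keys f \<subseteq> S}"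
    "ring.zero M = 0" "ring.add M = (+)"
  shows "abelian_group M"
proof (rule abelian_groupI)
  fix f g assume "f \<in> carrier M" "g \<in> carrier M"
  then show "f \<oplus>\<^bsub>M\<^esub> g \<in> carrier M"
    using keys_add[of f g] by (auto simp: assms)
next
  fix f assume "f \<in> carrier M"
  then show "\<exists>g\<in>carrier M. g \<oplus>\<^bsub>M\<^esub> f = \<zero>\<^bsub>M\<^esub>"
    by (intro bexI[of _ "- f"]) (auto simp: assms in_keys_iff)
qed (simp_all add: assms algebra_simps)

lemma abelian_group_path_algebra: "abelian_group (path_algebra Q)"
  by (rule abelian_group_poly_mapping) (rule path_algebra_simps)+

lemma path_algebra_l_distr:
  "monoid.mult (path_algebra Q) (f + g) h =
    monoid.mult (path_algebra Q) f h + monoid.mult (path_algebra Q) g h"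
  by (simp add: klinear_extend_add)

lemma path_algebra_r_distr:
  "monoid.mult (path_algebra Q) f (g + h) =
    monoid.mult (path_algebra Q) f g + monoid.mult (path_algebra Q) f h"
  by (simp add: klinear_extend_add klinear_extend_pointwise_add)

section \<open>Composition of paths\<close>

lemma (in pre_digraph) cas_append_iff:
  "cas u (p @ q) w \<longleftrightarrow> (\<exists>v. cas u p v \<and> cas v q w)"
  by (induction p arbitrary: u) auto

context wf_digraph
begin

lemma paths_append:
  assumes "(h, xs, t) \<in> paths G" "(t, ys, s) \<in> paths G"
  shows "(h, xs @ ys, s) \<in> paths G"
  using assms by (auto simp: paths_def awalk_def cas_append_iff)

lemma trivial_path_in_paths_iff: "(v, [], w) \<in> paths G \<longleftrightarrow> v = w \<and> v \<in> verts G"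
  by (auto simp: paths_def awalk_def)

lemma arrow_in_paths_iff: "(h, [x], t) \<in> paths G \<longleftrightarrow> x \<in> arcs G \<and> h = head G x \<and> t = tail G x"
  by (auto simp: paths_def awalk_def)

lemma Cons_in_paths_iff:
  "(h, x # xs, t) \<in> paths G \<longleftrightarrow> x \<in> arcs G \<and> h = head G x \<and> (tail G x, xs, t) \<in> paths G"
  by (auto simp: paths_def awalk_def cas_append_iff)

lemma keys_path_mult:
  assumes "p \<in> paths G" "q \<in> paths G"
  shows "Poly_Mapping.keys (path_mult p q :: _ \<Rightarrow>\<^sub>0 'k::field) \<subseteq> paths G"
  using assms by (cases p; cases q) (auto intro: paths_append)

lemma path_algebra_mult_closed:
  fixes f g :: "_ \<Rightarrow>\<^sub>0 'k::field"
  assumes "f \<in> carrier (path_algebra G)" "g \<in> carrier (path_algebra G)"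
  shows "monoid.mult (path_algebra G) f g \<in> carrier (path_algebra G)"
proof -
  have "Poly_Mapping.keys (klinear_extend (path_mult p) g) \<subseteq> paths G"
    if p: "p \<in> Poly_Mapping.keys f" for p
  proof (rule order_trans[OF keys_klinear_extend], rule UN_least)
    fix q assume "q \<in> Poly_Mapping.keys g"
    with p assms show "Poly_Mapping.keys (path_mult p q :: _ \<Rightarrow>\<^sub>0 'k) \<subseteq> paths G"
      by (intro keys_path_mult) auto
  qed
  then have "Poly_Mapping.keys (klinear_extend (\<lambda>p. klinear_extend (path_mult p) g) f) \<subseteq> paths G"
    by (rule order_trans[OF keys_klinear_extend, OF UN_least])
  then show ?thesis
    by simp
qed

end

section \<open>Ideals and the quotient by the zero relations\<close>

lemma two_sided_ideal_carrier:
  assumes "wf_digraph Q"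
  shows "two_sided_ideal (path_algebra Q :: (('v, 'e) path \<Rightarrow>\<^sub>0 'k::field) ring) (carrier (path_algebra Q))"
proof -
  interpret wf_digraph Q by fact
  interpret abelian_group "path_algebra Q :: (('v, 'e) path \<Rightarrow>\<^sub>0 'k::field) ring"
    by (rule abelian_group_path_algebra)
  show ?thesis
    unfolding two_sided_ideal_def
    using path_algebra_mult_closed
    by (metis add.subgroup_self additive_subgroupI)
qed

lemma two_sided_ideal_Inter:
  assumes "abelian_group A" "\<And>J. J \<in> \<J> \<Longrightarrow> two_sided_ideal A J" "\<J> \<noteq> {}"
  shows "two_sided_ideal A (\<Inter>\<J>)"
proof -
  interpret abelian_group A by fact
  have "subgroup J (add_monoid A)" if "J \<in> \<J>" for J
    using assms(2)[OF that] unfolding two_sided_ideal_def additive_subgroup_def by blast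
  then have "subgroup (\<Inter>\<J>) (add_monoid A)"
    by (rule add.subgroups_Inter[OF _ assms(3)])
  then show ?thesis
    using assms(2) unfolding two_sided_ideal_def additive_subgroup_def by blast
qed

lemma two_sided_ideal_ideal_generated:
  assumes "abelian_group A" "two_sided_ideal A (carrier A)" "S \<subseteq> carrier A"
  shows "two_sided_ideal A (ideal_generated A S)"
  unfolding ideal_generated_def by (rule two_sided_ideal_Inter) (use assms in auto)

lemma ideal_generated_subset: "two_sided_ideal A J \<Longrightarrow> S \<subseteq> J \<Longrightarrow> ideal_generated A S \<subseteq> J"
  unfolding ideal_generated_def by blast

definition bound_class ::
  "('v, 'e) pre_digraph \<Rightarrow> ('v, 'e) path set \<Rightarrow> (('v, 'e) path \<Rightarrow>\<^sub>0 'k::field) \<Rightarrow> (('v, 'e) path \<Rightarrow>\<^sub>0 'k) set"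
  where "bound_class Q \<rho> f = zero_relation_ideal Q \<rho> +>\<^bsub>path_algebra Q\<^esub> f"

text \<open>The class of \<open>c e_v\<close>. Since the algebra need not have a unit, a scalar of
  \<open>k\<close> reaches a module only through such elements; hence the coefficient is a parameter
  here and not in \<open>arrow_class\<close>.\<close>

definition vertex_class ::
  "('v, 'e) pre_digraph \<Rightarrow> ('v, 'e) path set \<Rightarrow> 'v \<Rightarrow> 'k \<Rightarrow> (('v, 'e) path \<Rightarrow>\<^sub>0 'k::field) set"
  where "vertex_class Q \<rho> v c = bound_class Q \<rho> (Poly_Mapping.single (v, [], v) c)"

definition arrow_class ::
  "('v, 'e) pre_digraph \<Rightarrow> ('v, 'e) path set \<Rightarrow> 'e \<Rightarrow> (('v, 'e) path \<Rightarrow>\<^sub>0 'k::field) set"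
  where "arrow_class Q \<rho> x = bound_class Q \<rho> (Poly_Mapping.single (head Q x, [x], tail Q x) 1)"

lemma mem_bound_class:
  "g \<in> bound_class Q \<rho> f \<longleftrightarrow> (\<exists>h\<in>zero_relation_ideal Q \<rho>. g = h + f)"
  by (auto simp: bound_class_def a_r_coset_def')

context string_algebra
begin

lemma two_sided_zero_relation_ideal:
  "two_sided_ideal (path_algebra Q) (zero_relation_ideal Q \<rho> :: (('v, 'e) path \<Rightarrow>\<^sub>0 'k::field) set)"
  unfolding zero_relation_ideal_def
proof (rule two_sided_ideal_ideal_generated[OF abelian_group_path_algebra two_sided_ideal_carrier])
  show "(\<lambda>p. Poly_Mapping.single p (1 :: 'k)) ` \<rho> \<subseteq> carrier (path_algebra Q)"
    using relations_paths by auto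
qed (rule wf_digraph_axioms)

lemma abelian_subgroup_zero_relation_ideal:
  "abelian_subgroup (zero_relation_ideal Q \<rho> :: (('v, 'e) path \<Rightarrow>\<^sub>0 'k::field) set) (path_algebra Q)"
  using two_sided_zero_relation_ideal unfolding two_sided_ideal_def
  by (intro abelian_subgroupI3 abelian_group_path_algebra) blast

lemma carrier_bound_path_algebra:
  "carrier (bound_path_algebra Q \<rho>) =
    bound_class Q \<rho> ` {f :: ('v, 'e) path \<Rightarrow>\<^sub>0 'k::field. Poly_Mapping.keys f \<subseteq> paths Q}"
  by (auto simp: bound_path_algebra_def FactRing_def A_RCOSETS_def' bound_class_def)

lemma bound_class_closed:
  "Poly_Mapping.keys f \<subseteq> paths Q \<Longrightarrow> bound_class Q \<rho> f \<in> carrier (bound_path_algebra Q \<rho>)"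
  by (simp add: carrier_bound_path_algebra)

lemma bound_class_self: "f \<in> bound_class Q \<rho> f"
proof -
  have "(0 :: ('v, 'e) path \<Rightarrow>\<^sub>0 'a) \<in> zero_relation_ideal Q \<rho>"
    using additive_subgroup.zero_closed[of "zero_relation_ideal Q \<rho>" "path_algebra Q"]
      two_sided_zero_relation_ideal unfolding two_sided_ideal_def by fastforce
  then show ?thesis
    by (auto simp: mem_bound_class)
qed

lemma zero_bound_path_algebra:
  "ring.zero (bound_path_algebra Q \<rho>) = bound_class Q \<rho> (0 :: ('v, 'e) path \<Rightarrow>\<^sub>0 'k::field)"
  by (auto simp: mem_bound_class bound_path_algebra_def FactRing_def)

lemma add_bound_class:
  fixes f g :: "('v, 'e) path \<Rightarrow>\<^sub>0 'k::field"
  assumes "Poly_Mapping.keys f \<subseteq> paths Q" "Poly_Mapping.keys g \<subseteq> paths Q"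
  shows "bound_class Q \<rho> f \<oplus>\<^bsub>bound_path_algebra Q \<rho>\<^esub> bound_class Q \<rho> g = bound_class Q \<rho> (f + g)"
  using abelian_subgroup.a_rcos_sum[OF abelian_subgroup_zero_relation_ideal, of f g] assms
  by (simp add: bound_path_algebra_def FactRing_def bound_class_def)

text \<open>By definition the product of two cosets is the union of the classes of all products of
  representatives. Expanding \<open>(a + f) (b + g)\<close> leaves \<open>f g\<close> and terms of
  the ideal, which absorbs products from both sides.\<close>

lemma mult_bound_class:
  fixes f g :: "('v, 'e) path \<Rightarrow>\<^sub>0 'k::field"
  assumes "Poly_Mapping.keys f \<subseteq> paths Q" "Poly_Mapping.keys g \<subseteq> paths Q"
  shows "bound_class Q \<rho> f \<otimes>\<^bsub>bound_path_algebra Q \<rho>\<^esub> bound_class Q \<rho> g =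
    bound_class Q \<rho> (f \<otimes>\<^bsub>path_algebra Q\<^esub> g)"
proof -
  let ?P = "path_algebra Q :: (('v, 'e) path \<Rightarrow>\<^sub>0 'k) ring"
  let ?I = "zero_relation_ideal Q \<rho> :: (('v, 'e) path \<Rightarrow>\<^sub>0 'k) set"
  have I: "additive_subgroup ?I ?P" "a \<in> carrier ?P \<Longrightarrow> x \<in> ?I \<Longrightarrow> a \<otimes>\<^bsub>?P\<^esub> x \<in> ?I \<and> x \<otimes>\<^bsub>?P\<^esub> a \<in> ?I" for a x
    using two_sided_zero_relation_ideal unfolding two_sided_ideal_def by blast+
  have add: "a \<in> ?I \<Longrightarrow> b \<in> ?I \<Longrightarrow> a + b \<in> ?I" for a b
    using additive_subgroup.a_closed[OF I(1)] by simp
  have sub: "?I \<subseteq> carrier ?P"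
    by (rule additive_subgroup.a_subset[OF I(1)])
  have keysI: "Poly_Mapping.keys (a + f') \<subseteq> paths Q" if "a \<in> ?I" "Poly_Mapping.keys f' \<subseteq> paths Q" for a f'
    using that sub keys_add[of a f'] by auto
  have "h + (a + f) \<otimes>\<^bsub>?P\<^esub> (b + g) \<in> bound_class Q \<rho> (f \<otimes>\<^bsub>?P\<^esub> g)"
    if h: "h \<in> ?I" "a \<in> ?I" "b \<in> ?I" for h a b
  proof -
    have "(a + f) \<otimes>\<^bsub>?P\<^esub> (b + g) = a \<otimes>\<^bsub>?P\<^esub> (b + g) + (f \<otimes>\<^bsub>?P\<^esub> b + f \<otimes>\<^bsub>?P\<^esub> g)"
      unfolding path_algebra_l_distr path_algebra_r_distr[of Q f] ..
    moreover have "h + a \<otimes>\<^bsub>?P\<^esub> (b + g) + f \<otimes>\<^bsub>?P\<^esub> b \<in> ?I"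
      using I(2) keysI assms that by (intro add) auto
    ultimately show ?thesis
      unfolding mem_bound_class by (intro bexI[of _ "h + a \<otimes>\<^bsub>?P\<^esub> (b + g) + f \<otimes>\<^bsub>?P\<^esub> b"]) (simp_all only: add.assoc)
  qed
  moreover have "\<exists>a\<in>bound_class Q \<rho> f. \<exists>b\<in>bound_class Q \<rho> g. y \<in> bound_class Q \<rho> (a \<otimes>\<^bsub>?P\<^esub> b)"
    if "y \<in> bound_class Q \<rho> (f \<otimes>\<^bsub>?P\<^esub> g)" for y
    using that bound_class_self by blast
  ultimately have "(\<Union>a\<in>bound_class Q \<rho> f. \<Union>b\<in>bound_class Q \<rho> g. bound_class Q \<rho> (a \<otimes>\<^bsub>?P\<^esub> b)) =
      bound_class Q \<rho> (f \<otimes>\<^bsub>?P\<^esub> g)"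
    unfolding set_eq_iff UN_iff by (metis mem_bound_class)
  then show ?thesis
    by (simp only: bound_path_algebra_def FactRing_def monoid.simps rcoset_mult_def bound_class_def ring.simps)
qed

lemma vertex_class_closed: "v \<in> verts Q \<Longrightarrow> vertex_class Q \<rho> v c \<in> carrier (bound_path_algebra Q \<rho>)"
  unfolding vertex_class_def by (rule bound_class_closed) (simp add: trivial_path_in_paths_iff)

lemma arrow_class_closed: "x \<in> arcs Q \<Longrightarrow> arrow_class Q \<rho> x \<in> carrier (bound_path_algebra Q \<rho>)"
  unfolding arrow_class_def by (rule bound_class_closed) (simp add: arrow_in_paths_iff)

text \<open>The classes of \<open>c e_v\<close> and of the arrows generate the algebra under sums
  and products. Statements about an action that are stable under both are thereby reduced to these
  elements.\<close>

lemma bound_path_algebra_induct [consumes 1, case_names zero vertex arrow add mult]: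
  fixes L :: "(('v, 'e) path \<Rightarrow>\<^sub>0 'k::field) set"
  assumes "L \<in> carrier (bound_path_algebra Q \<rho>)"
    and zero: "P \<zero>\<^bsub>bound_path_algebra Q \<rho>\<^esub>"
    and vertex: "\<And>v c. v \<in> verts Q \<Longrightarrow> P (vertex_class Q \<rho> v c)"
    and arrow: "\<And>x. x \<in> arcs Q \<Longrightarrow> P (arrow_class Q \<rho> x)"
    and add: "\<And>L L'. L \<in> carrier (bound_path_algebra Q \<rho>) \<Longrightarrow> L' \<in> carrier (bound_path_algebra Q \<rho>) \<Longrightarrow>
      P L \<Longrightarrow> P L' \<Longrightarrow> P (L \<oplus>\<^bsub>bound_path_algebra Q \<rho>\<^esub> L')"
    and mult: "\<And>L L'. L \<in> carrier (bound_path_algebra Q \<rho>) \<Longrightarrow> L' \<in> carrier (bound_path_algebra Q \<rho>) \<Longrightarrow>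
      P L \<Longrightarrow> P L' \<Longrightarrow> P (L \<otimes>\<^bsub>bound_path_algebra Q \<rho>\<^esub> L')"
  shows "P L"
proof -
  \<comment> \<open>Arrows are split off one by one at the head of the path. The coefficient travels
    to the trivial path at its tail, so arrows occur with coefficient 1 only.\<close>
  have path: "P (bound_class Q \<rho> (Poly_Mapping.single (h, xs, t) c))" if "(h, xs, t) \<in> paths Q" for h xs t c
    using that
  proof (induction xs arbitrary: h)
    case Nil
    then show ?case
      using vertex[of h c] by (auto simp: trivial_path_in_paths_iff vertex_class_def)
  next
    case (Cons x xs)
    then have x: "x \<in> arcs Q" "h = head Q x" "(tail Q x, xs, t) \<in> paths Q"
      by (simp_all add: Cons_in_paths_iff)
    let ?x = "Poly_Mapping.single (head Q x, [x], tail Q x) (1 :: 'k)"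
    let ?p = "Poly_Mapping.single (tail Q x, xs, t) c"
    have "P (bound_class Q \<rho> ?x \<otimes>\<^bsub>bound_path_algebra Q \<rho>\<^esub> bound_class Q \<rho> ?p)"
      using x Cons.IH arrow by (intro mult bound_class_closed) (auto simp: arrow_in_paths_iff arrow_class_def)
    also have "bound_class Q \<rho> ?x \<otimes>\<^bsub>bound_path_algebra Q \<rho>\<^esub> bound_class Q \<rho> ?p =
        bound_class Q \<rho> (Poly_Mapping.single (h, x # xs, t) c)"
      using x by (subst mult_bound_class) (auto simp: arrow_in_paths_iff)
    finally show ?case .
  qed
  obtain f where "L = bound_class Q \<rho> f" "Poly_Mapping.keys f \<subseteq> paths Q"
    using assms(1) by (auto simp: carrier_bound_path_algebra)
  moreover have "P (bound_class Q \<rho> f)" if "Poly_Mapping.keys f \<subseteq> paths Q" for f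
    using that
  proof (induction rule: poly_mapping_add_single_induct)
    case zero
    then show ?case
      using \<open>P \<zero>\<^bsub>bound_path_algebra Q \<rho>\<^esub>\<close> by (simp add: zero_bound_path_algebra)
  next
    case (add f p c)
    then have "P (bound_class Q \<rho> f \<oplus>\<^bsub>bound_path_algebra Q \<rho>\<^esub> bound_class Q \<rho> (Poly_Mapping.single p c))"
      using path by (cases p) (intro \<open>\<And>L L'. _ \<Longrightarrow> _ \<Longrightarrow> P L \<Longrightarrow> P L' \<Longrightarrow> P (L \<oplus>\<^bsub>bound_path_algebra Q \<rho>\<^esub> L')\<close> bound_class_closed, auto)
    then show ?case
      using add by (subst (asm) add_bound_class) auto
  qed
  ultimately show ?thesis
    by simp
qed

end

section \<open>The action on string modules\<close>

locale string_algebra_word = string_algebra Q \<rho>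
  for Q :: "('v, 'e) pre_digraph" and \<rho> +
  fixes C :: "('v, 'e) word"
  assumes word: "is_word Q \<rho> C"
begin

section \<open>Combinatorics of a single word\<close>

lemma dom_letters:
  assumes "C = Letters c"
  obtains I where "I \<in> index_sets" "I \<noteq> {0}" "\<And>i. c i \<noteq> None \<longleftrightarrow> i \<in> I \<and> i - 1 \<in> I"
proof -
  obtain I where "I \<in> index_sets" "I \<noteq> {0}" "dom c = {i \<in> I. i - 1 \<in> I}"
    using word unfolding assms is_word.simps by blast
  then show thesis
    by (intro that[of I]) (auto simp: dom_def set_eq_iff)
qed

lemma letter_arrow_in_arcs: "letter_at C i = Some l \<Longrightarrow> letter_arrow l \<in> arcs Q"
proof (cases C)
  case (Letters c)
  have "\<forall>i l. c i = Some l \<longrightarrow> letter_arrow l \<in> arcs Q"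
    using word unfolding Letters is_word.simps by blast
  then show "letter_at C i = Some l \<Longrightarrow> letter_arrow l \<in> arcs Q"
    unfolding Letters letter_at.simps by blast
qed simp

lemma adjacent_letters:
  assumes "letter_at C i = Some l" "letter_at C (i + 1) = Some l'"
  shows "letter_tail Q l = letter_head Q l'" "letter_inv l \<noteq> l'"
proof -
  obtain c where C: "C = Letters c"
    using assms by (cases C) auto
  have "\<forall>i l l'. c i = Some l \<and> c (i + 1) = Some l' \<longrightarrow> letter_tail Q l = letter_head Q l' \<and> letter_inv l \<noteq> l'"
    using word unfolding C is_word.simps by blast
  then show "letter_tail Q l = letter_head Q l'" "letter_inv l \<noteq> l'"
    using assms unfolding C letter_at.simps by blast+
qed

lemma reduced_letters: "reduced (letter_at C)"
  using adjacent_letters(2) unfolding reduced_def by blast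

text \<open>A word of the form \<open>Letters c\<close> contains a letter because its index set is
  not \<open>{0}\<close>. Absence of letters thus characterises the trivial words, whose only
  position is 0.\<close>

lemma word_index_iff: "i \<in> word_index C \<longleftrightarrow>
    letter_at C i \<noteq> None \<or> letter_at C (i + 1) \<noteq> None \<or> i = 0 \<and> (\<forall>j. letter_at C j = None)"
proof (cases C)
  case (Letters c)
  have "\<exists>j. c j \<noteq> None"
  proof (rule ccontr)
    assume "\<nexists>j. c j \<noteq> None"
    moreover obtain I where I: "I \<in> index_sets" "I \<noteq> {0}" "\<And>i. c i \<noteq> None \<longleftrightarrow> i \<in> I \<and> i - 1 \<in> I"
      by (rule dom_letters[OF Letters]) blast
    ultimately have "\<And>i. i \<in> I \<Longrightarrow> i - 1 \<notin> I"
      by blast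
    \<comment> \<open>Every index set other than \<open>{0}\<close> contains 0 together with 1 or
      -1.\<close>
    from this[of 1] this[of 0] show False
      using I(1,2) unfolding index_sets_def by force
  qed
  then show ?thesis
    using Letters by auto
qed auto

lemma word_index_positions: "i \<in> word_index C \<Longrightarrow> i \<in> letter_positions (letter_at C)"
  unfolding word_index_iff letter_positions_def by auto

lemma convex_letters: "convex_dom (letter_at C)"
proof (cases C)
  case (Letters c)
  obtain I where I: "I \<in> index_sets" "\<And>i. c i \<noteq> None \<longleftrightarrow> i \<in> I \<and> i - 1 \<in> I"
    by (rule dom_letters[OF Letters]) blast
  have "j \<in> I" if "i \<in> I" "k \<in> I" "i \<le> j" "j \<le> k" for i j k
    using I(1) that unfolding index_sets_def by auto
  then show ?thesis
    unfolding Letters letter_at.simps convex_dom_def I(2)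
    by (meson diff_mono order.refl)
qed (simp add: convex_dom_def)

text \<open>\<open>word_vertex\<close> reads the letter to the left of a position if there is one.
  When the step uses the letter on the right, compatibility of adjacent letters gives the same
  vertex.\<close>

lemma step_endpoints:
  assumes "step (letter_at C) x i i'"
  shows "x \<in> arcs Q" "i \<in> word_index C" "i' \<in> word_index C"
    and "word_vertex Q C i = tail Q x" "word_vertex Q C i' = head Q x"
proof -
  obtain c where C: "C = Letters c"
    using assms by (cases C) (auto simp: step_def)
  from assms have "x \<in> arcs Q \<and> i \<in> word_index C \<and> i' \<in> word_index C \<and>
    word_vertex Q C i = tail Q x \<and> word_vertex Q C i' = head Q x"
    unfolding step_def
  proof (elim disjE conjE)
    assume *: "letter_at C i = Some (Direct x)" "i' = i - 1"
    then show ?thesis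
      using letter_arrow_in_arcs[OF *(1)] adjacent_letters(1)[of "i - 1" _ "Direct x"]
      unfolding C by (auto split: option.split)
  next
    assume *: "letter_at C (i + 1) = Some (Inverse x)" "i' = i + 1"
    then show ?thesis
      using letter_arrow_in_arcs[OF *(1)] adjacent_letters(1)[of i _ "Inverse x"]
      unfolding C by (auto split: option.split)
  qed
  then show "x \<in> arcs Q" "i \<in> word_index C" "i' \<in> word_index C"
    "word_vertex Q C i = tail Q x" "word_vertex Q C i' = head Q x"
    by blast+
qed

lemma word_vertex_in_verts: "i \<in> word_index C \<Longrightarrow> word_vertex Q C i \<in> verts Q"
proof (cases C)
  case (Letters c)
  have "letter_head Q l \<in> verts Q \<and> letter_tail Q l \<in> verts Q" if "letter_arrow l \<in> arcs Q" for l
    using that by (cases l) auto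
  then have "letter_at C j = Some l \<Longrightarrow> letter_head Q l \<in> verts Q \<and> letter_tail Q l \<in> verts Q" for j l
    using letter_arrow_in_arcs by blast
  then show "i \<in> word_index C \<Longrightarrow> word_vertex Q C i \<in> verts Q"
    unfolding Letters by (auto split: option.split)
qed (use word in auto)

lemma step_step_unique: "step (letter_at C) x i i' \<Longrightarrow> step (letter_at C) x i i'' \<Longrightarrow> i' = i''"
  by (rule step_unique[OF reduced_letters])

lemma step_step_unique': "step (letter_at C) x i' i \<Longrightarrow> step (letter_at C) x i'' i \<Longrightarrow> i' = i''"
  by (rule step_unique'[OF reduced_letters])

lemma lookup_arrow_act:
  "Poly_Mapping.lookup (arrow_act C x i :: int \<Rightarrow>\<^sub>0 'k::field) j = (if step (letter_at C) x i j then 1 else 0)"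
proof -
  have "\<not> (letter_at C i = Some (Direct x) \<and> letter_at C (i + 1) = Some (Inverse x))"
    using reduced_letters unfolding reduced_def by (metis letter_inv.simps(1))
  then show ?thesis
    by (auto simp: arrow_act_def step_def lookup_single when_def)
qed

lemma arrow_act_step:
  "step (letter_at C) x i i' \<Longrightarrow> arrow_act C x i = Poly_Mapping.single i' (1 :: 'k::field)"
  by (rule poly_mapping_eqI)
    (auto simp: lookup_arrow_act lookup_single when_def dest: step_step_unique)

lemma arrow_act_no_step:
  "\<nexists>i'. step (letter_at C) x i i' \<Longrightarrow> arrow_act C x i = (0 :: int \<Rightarrow>\<^sub>0 'k::field)"
  by (rule poly_mapping_eqI) (auto simp: lookup_arrow_act)

lemma lookup_arrow:
  fixes m :: "int \<Rightarrow>\<^sub>0 'k::field"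
  assumes "step (letter_at C) x i j"
  shows "Poly_Mapping.lookup (klinear_extend (arrow_act C x) m) j = Poly_Mapping.lookup m i"
proof -
  have "step (letter_at C) x k j \<longleftrightarrow> k = i" for k
    using assms step_step_unique' by blast
  then have "Poly_Mapping.lookup (klinear_extend (arrow_act C x) m) j =
      (\<Sum>k\<in>Poly_Mapping.keys m. if k = i then Poly_Mapping.lookup m k else 0)"
    unfolding lookup_klinear_extend lookup_arrow_act by (intro sum.cong) auto
  then show ?thesis
    by (simp add: in_keys_iff)
qed

lemma lookup_arrow_zero:
  fixes m :: "int \<Rightarrow>\<^sub>0 'k::field"
  assumes "\<nexists>i. step (letter_at C) x i j"
  shows "Poly_Mapping.lookup (klinear_extend (arrow_act C x) m) j = 0"
  using assms by (simp add: lookup_klinear_extend lookup_arrow_act)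

lemma lookup_vertex:
  fixes m :: "int \<Rightarrow>\<^sub>0 'k::field"
  shows "Poly_Mapping.lookup (klinear_extend (vertex_act Q C v) m) j =
    (if word_vertex Q C j = v then Poly_Mapping.lookup m j else 0)"
proof -
  have "Poly_Mapping.lookup (klinear_extend (vertex_act Q C v) m) j =
      (\<Sum>k\<in>Poly_Mapping.keys m. if k = j then (if word_vertex Q C j = v then Poly_Mapping.lookup m j else 0) else 0)"
    unfolding lookup_klinear_extend by (intro sum.cong) (auto simp: vertex_act_def lookup_single when_def)
  then show ?thesis
    by (simp add: in_keys_iff)
qed

section \<open>The action of paths and of the path algebra\<close>

lemma path_act_add: "path_act Q C p (m + m') = path_act Q C p m + path_act Q C p (m' :: int \<Rightarrow>\<^sub>0 'k::field)"
proof -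
  obtain h xs t where p: "p = (h, xs, t)"
    by (metis prod.exhaust)
  show ?thesis
    unfolding p by (induction xs arbitrary: h) (simp_all add: klinear_extend_add)
qed

lemma path_act_kscale: "path_act Q C p (kscale c m) = kscale c (path_act Q C p (m :: int \<Rightarrow>\<^sub>0 'k::field))"
proof -
  obtain h xs t where p: "p = (h, xs, t)"
    by (metis prod.exhaust)
  show ?thesis
    unfolding p by (induction xs arbitrary: h) (simp_all add: klinear_extend_kscale)
qed

lemma path_act_Cons:
  "path_act Q C (h, x # xs, t) m = klinear_extend (arrow_act C x) (path_act Q C (h', xs, t) m)"
  by simp

lemma keys_path_act:
  fixes m :: "int \<Rightarrow>\<^sub>0 'k::field"
  assumes "(h, xs, t) \<in> paths Q" "Poly_Mapping.keys m \<subseteq> word_index C"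
  shows "Poly_Mapping.keys (path_act Q C (h, xs, t) m) \<subseteq> {i \<in> word_index C. word_vertex Q C i = h}"
proof (cases xs)
  case Nil
  then show ?thesis
    using assms by (auto simp: trivial_path_in_paths_iff in_keys_iff lookup_vertex subset_iff split: if_splits)
next
  case (Cons x ys)
  have "\<exists>k. step (letter_at C) x k i" if "i \<in> Poly_Mapping.keys (klinear_extend (arrow_act C x) m')"
    for i and m' :: "int \<Rightarrow>\<^sub>0 'k"
    using that lookup_arrow_zero[of x i m'] by (auto simp: in_keys_iff)
  then show ?thesis
    using assms step_endpoints unfolding Cons path_act_Cons[of h x ys t m h] Cons_in_paths_iff by blast
qed

text \<open>The image of a path is supported at its head vertex. The trivial path at
  \<open>t\<close>, with which the left factor starts, therefore acts on it as the identity or as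
  zero.\<close>

lemma path_act_append:
  fixes m :: "int \<Rightarrow>\<^sub>0 'k::field"
  assumes "(h', ys, t') \<in> paths Q" "Poly_Mapping.keys m \<subseteq> word_index C"
  shows "path_act Q C (h, xs, t) (path_act Q C (h', ys, t') m) =
    (if t = h' then path_act Q C (h, xs @ ys, t') m else 0)"
proof -
  let ?m = "path_act Q C (h', ys, t') m"
  have "klinear_extend (vertex_act Q C t) ?m = (if t = h' then ?m else 0)"
    using keys_path_act[OF assms]
    by (intro poly_mapping_eqI) (auto simp: lookup_vertex in_keys_iff simp del: path_act.simps)
  moreover have "foldr (\<lambda>x. klinear_extend (arrow_act C x)) xs (0 :: int \<Rightarrow>\<^sub>0 'k) = 0"
    by (induction xs) simp_all
  ultimately show ?thesis
    by simp
qed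

lemma path_algebra_act_add:
  "path_algebra_act Q C f (m + m') = path_algebra_act Q C f m + path_algebra_act Q C f (m' :: int \<Rightarrow>\<^sub>0 'k::field)"
  unfolding path_algebra_act_def path_act_add by (rule klinear_extend_pointwise_add)

lemma path_algebra_act_add_left:
  "path_algebra_act Q C (f + g) m = path_algebra_act Q C f m + path_algebra_act Q C g (m :: int \<Rightarrow>\<^sub>0 'k::field)"
  unfolding path_algebra_act_def by (rule klinear_extend_add)

lemma path_algebra_act_zero [simp]: "path_algebra_act Q C 0 m = (0 :: int \<Rightarrow>\<^sub>0 'k::field)"
  unfolding path_algebra_act_def by simp

lemma path_algebra_act_single:
  "path_algebra_act Q C (Poly_Mapping.single p c) m = kscale c (path_act Q C p (m :: int \<Rightarrow>\<^sub>0 'k::field))"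
  unfolding path_algebra_act_def by simp

lemma path_algebra_act_closed:
  fixes m :: "int \<Rightarrow>\<^sub>0 'k::field"
  assumes "Poly_Mapping.keys f \<subseteq> paths Q" "Poly_Mapping.keys m \<subseteq> word_index C"
  shows "Poly_Mapping.keys (path_algebra_act Q C f m) \<subseteq> word_index C"
  unfolding path_algebra_act_def
proof (rule order_trans[OF keys_klinear_extend], rule UN_least)
  fix p assume "p \<in> Poly_Mapping.keys f"
  then show "Poly_Mapping.keys (path_act Q C p m) \<subseteq> word_index C"
    using keys_path_act assms by (cases p) (blast dest: subsetD)
qed

text \<open>Both sides are linear in \<open>f\<close> and in \<open>g\<close>, which reduces the
  claim to two paths; a product of paths that do not compose is zero on either side.\<close>

lemma path_algebra_act_mult:
  fixes m :: "int \<Rightarrow>\<^sub>0 'k::field"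
  assumes "Poly_Mapping.keys g \<subseteq> paths Q" "Poly_Mapping.keys m \<subseteq> word_index C"
  shows "path_algebra_act Q C (f \<otimes>\<^bsub>path_algebra Q\<^esub> g) m = path_algebra_act Q C f (path_algebra_act Q C g m)"
proof -
  have mult: "path_algebra_act Q C (path_mult p q) m = path_act Q C p (path_act Q C q m)"
    if "q \<in> Poly_Mapping.keys g" for p q
  proof -
    obtain h xs t h' ys t' where pq: "p = (h, xs, t)" "q = (h', ys, t')"
      by (metis prod.exhaust)
    then show ?thesis
      using path_act_append[of h' ys t' m h xs t] that assms
      by (auto simp: path_algebra_act_single simp del: path_act.simps)
  qed
  have comp: "path_algebra_act Q C (klinear_extend b h) m = klinear_extend (\<lambda>p. path_algebra_act Q C (b p) m) h"
    for b and h :: "('v, 'e) path \<Rightarrow>\<^sub>0 'k"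
    by (rule klinear_extend_compose)
      (simp_all add: path_algebra_act_def klinear_extend_add klinear_extend_kscale)
  have "path_algebra_act Q C (f \<otimes>\<^bsub>path_algebra Q\<^esub> g) m =
      klinear_extend (\<lambda>p. klinear_extend (\<lambda>q. path_algebra_act Q C (path_mult p q) m) g) f"
    by (simp add: comp)
  also have "\<dots> = klinear_extend (\<lambda>p. klinear_extend (\<lambda>q. path_act Q C p (path_act Q C q m)) g) f"
    using mult by (intro klinear_extend_cong) blast
  also have "\<dots> = klinear_extend (\<lambda>p. path_act Q C p (klinear_extend (\<lambda>q. path_act Q C q m) g)) f"
    by (subst klinear_extend_compose[of "path_act Q C _"]) (simp_all add: path_act_add path_act_kscale del: path_act.simps)
  also have "\<dots> = path_algebra_act Q C f (path_algebra_act Q C g m)"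
    unfolding path_algebra_act_def ..
  finally show ?thesis .
qed

text \<open>
  A path that does not annihilate \<open>b\<^sub>i\<close> moves it monotonically, hence reads off consecutive letters.
\<close>

lemma path_act_single:
  assumes "xs \<noteq> []"
  shows "(\<forall>j<length xs. letter_at C (i - int (length xs) + 1 + int j) = Some (Direct (xs ! j))) \<and>
      foldr (\<lambda>x. klinear_extend (arrow_act C x)) xs (Poly_Mapping.single i (1 :: 'k::field)) =
        Poly_Mapping.single (i - int (length xs)) 1 \<or>
    (\<forall>j<length xs. letter_at C (i + 1 + int j) = Some (Inverse (rev xs ! j))) \<and>
      foldr (\<lambda>x. klinear_extend (arrow_act C x)) xs (Poly_Mapping.single i (1 :: 'k)) =
        Poly_Mapping.single (i + int (length xs)) 1 \<or>
    foldr (\<lambda>x. klinear_extend (arrow_act C x)) xs (Poly_Mapping.single i (1 :: 'k)) = 0"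
    (is "?down xs \<and> ?fd xs \<or> ?up xs \<and> ?fu xs \<or> ?f0 xs")
  using assms
proof (induction xs)
  case (Cons x xs)
  let ?n = "int (length xs)"
  have next_zero: "?f0 (x # xs)" if "?f0 xs"
    using that by simp
  have down: "?down (x # xs) \<and> ?fd (x # xs) \<or> ?f0 (x # xs)"
    if "?down xs" "?fd xs" "xs \<noteq> []"
  proof (cases "\<exists>k. step (letter_at C) x (i - ?n) k")
    case True
    then obtain k where k: "step (letter_at C) x (i - ?n) k"
      by blast
    \<comment> \<open>The letter read last is direct. A step upwards would need an inverse letter in
      that very place, so the next arrow can only go further down.\<close>
    have "letter_at C (i - ?n + 1) = Some (Direct (xs ! 0))"
      using that(1,3) by (metis add.right_neutral length_greater_0_conv of_nat_0)
    with k have *: "letter_at C (i - ?n) = Some (Direct x)" "k = i - ?n - 1"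
      unfolding step_def by auto
    have "letter_at C (i - int (length (x # xs)) + 1 + int j) = Some (Direct ((x # xs) ! j))"
      if "j < length (x # xs)" for j
    proof (cases j)
      case 0
      then show ?thesis
        using * by simp
    next
      case (Suc j')
      then have "letter_at C (i - ?n + 1 + int j') = Some (Direct (xs ! j'))"
        using \<open>?down xs\<close> that by simp
      moreover have "i - int (length (x # xs)) + 1 + int j = i - ?n + 1 + int j'"
        using Suc by simp
      ultimately show ?thesis
        unfolding Suc by (simp only: nth_Cons_Suc)
    qed
    moreover have "?fd (x # xs)"
      using that(2) k * by (simp add: arrow_act_step algebra_simps)
    ultimately show ?thesis
      by blast
  next
    case False
    then show ?thesis
      using that(2) by (simp add: arrow_act_no_step)
  qed
  have up: "?up (x # xs) \<and> ?fu (x # xs) \<or> ?f0 (x # xs)"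
    if "?up xs" "?fu xs" "xs \<noteq> []"
  proof (cases "\<exists>k. step (letter_at C) x (i + ?n) k")
    case True
    then obtain k where k: "step (letter_at C) x (i + ?n) k"
      by blast
    \<comment> \<open>Symmetrically, the letter read last is inverse and occupies the place that a
      step downwards would need.\<close>
    have "letter_at C (i + 1 + int (length xs - 1)) = Some (Inverse (rev xs ! (length xs - 1)))"
      using that(1,3) by simp
    moreover have "i + 1 + int (length xs - 1) = i + ?n"
      using that(3) by (cases xs) simp_all
    ultimately have *: "letter_at C (i + ?n + 1) = Some (Inverse x)" "k = i + ?n + 1"
      using k unfolding step_def by auto
    have "letter_at C (i + 1 + int j) = Some (Inverse (rev (x # xs) ! j))"
      if "j < length (x # xs)" for j
    proof (cases "j = length xs")
      case True
      moreover have "i + 1 + int j = i + ?n + 1"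
        using True by simp
      ultimately show ?thesis
        using *(1) unfolding \<open>i + 1 + int j = i + ?n + 1\<close> by (simp add: nth_append)
    next
      case False
      then have "j < length xs"
        using that by simp
      with \<open>?up xs\<close> show ?thesis
        by (simp add: nth_append)
    qed
    moreover have "?fu (x # xs)"
      using that(2) k * by (simp add: arrow_act_step algebra_simps)
    ultimately show ?thesis
      by blast
  next
    case False
    then show ?thesis
      using that(2) by (simp add: arrow_act_no_step)
  qed
  show ?case
  proof (cases "xs = []")
    case True
    then show ?thesis
      by (auto simp: arrow_act_def)
  next
    case False
    then show ?thesis
      using Cons.IH down up next_zero by blast
  qed
qed simp

text \<open>A relation that does not kill a basis vector is read off consecutive letters, directly
  when moving down and as its inverse when moving up. A word contains neither.\<close>

lemma relation_act:
  fixes m :: "int \<Rightarrow>\<^sub>0 'k::field"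
  assumes "p \<in> \<rho>"
  shows "path_act Q C p m = 0"
proof -
  obtain h xs t where p: "p = (h, xs, t)"
    by (metis prod.exhaust)
  have len: "2 \<le> length xs"
    using relations_length[OF assms] by (simp add: p path_length_def)
  have none: "\<not> (\<forall>j<length xs. letter_at C (i + int j) = Some (Direct (xs ! j)))"
    "\<not> (\<forall>j<length xs. letter_at C (i + int j) = Some (Inverse (rev xs ! j)))" for i
  proof -
    have len: "0 < length xs"
      using len by linarith
    have "\<not> (\<forall>j<length xs. letter_at C (i + int j) = Some (Direct (xs ! j))) \<and>
      \<not> (\<forall>j<length xs. letter_at C (i + int j) = Some (Inverse (rev xs ! j)))"
    proof (cases C)
      case (Trivial v \<epsilon>)
      then show ?thesis
        using len by auto
    next
      case (Letters c)
      have "\<forall>(h, xs, t)\<in>\<rho>. \<forall>i. \<not> (\<forall>j<length xs. c (i + int j) = Some (Direct (xs ! j))) \<and>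
          \<not> (\<forall>j<length xs. c (i + int j) = Some (Inverse (rev xs ! j)))"
        using word unfolding Letters is_word.simps by (elim conjE)
      from this[rule_format, OF assms] show ?thesis
        unfolding Letters letter_at.simps p by simp
    qed
    then show "\<not> (\<forall>j<length xs. letter_at C (i + int j) = Some (Direct (xs ! j)))"
      "\<not> (\<forall>j<length xs. letter_at C (i + int j) = Some (Inverse (rev xs ! j)))"
      by blast+
  qed
  have zero: "foldr (\<lambda>x. klinear_extend (arrow_act C x)) xs (Poly_Mapping.single i (1 :: 'k)) = 0" for i
  proof -
    have "xs \<noteq> []"
      by (metis len list.size(3) not_numeral_le_zero)
    from path_act_single[OF this, of i, where ?'k = 'k] show ?thesis
      using none[of "i - int (length xs) + 1"] none[of "i + 1"] by blast
  qed
  have foldr_add: "foldr (\<lambda>x. klinear_extend (arrow_act C x)) ys (f + g) =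
      foldr (\<lambda>x. klinear_extend (arrow_act C x)) ys f + foldr (\<lambda>x. klinear_extend (arrow_act C x)) ys g"
    and scale: "foldr (\<lambda>x. klinear_extend (arrow_act C x)) ys (kscale c f) =
      kscale c (foldr (\<lambda>x. klinear_extend (arrow_act C x)) ys f)"
    for ys c and f g :: "int \<Rightarrow>\<^sub>0 'k"
    by (induction ys) (simp_all add: klinear_extend_add klinear_extend_kscale)
  have foldr_zero: "foldr (\<lambda>x. klinear_extend (arrow_act C x)) xs f = 0" for f :: "int \<Rightarrow>\<^sub>0 'k"
    using subset_UNIV[of "Poly_Mapping.keys f"]
  proof (induction rule: poly_mapping_add_single_induct)
    case zero
    show ?case
      using scale[of xs 0 0] by simp
  next
    case (add f i c)
    have "foldr (\<lambda>x. klinear_extend (arrow_act C x)) xs (Poly_Mapping.single i c) = 0"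
      using scale[of xs c "Poly_Mapping.single i 1"] zero[of i] by simp
    then show ?case
      unfolding foldr_add add(1) by simp
  qed
  show ?thesis
    unfolding p path_act.simps by (rule foldr_zero)
qed

text \<open>The elements of the path algebra that kill all of \<open>M(C)\<close> form a two-sided
  ideal containing the relations. Quantifying over every \<open>m\<close> supported on the word
  gives closure under right factors, since the action preserves that support.\<close>

lemma zero_relation_ideal_act:
  fixes m :: "int \<Rightarrow>\<^sub>0 'k::field"
  assumes "f \<in> zero_relation_ideal Q \<rho>" "Poly_Mapping.keys m \<subseteq> word_index C"
  shows "path_algebra_act Q C f m = 0"
proof -
  let ?P = "path_algebra Q :: (('v, 'e) path \<Rightarrow>\<^sub>0 'k) ring"
  let ?J = "{f \<in> carrier ?P. \<forall>m. Poly_Mapping.keys m \<subseteq> word_index C \<longrightarrow> path_algebra_act Q C f m = 0}"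
  interpret abelian_group ?P
    by (rule abelian_group_path_algebra)
  have neg: "path_algebra_act Q C (- f) m = - path_algebra_act Q C f m" for f m
    using path_algebra_act_add_left[of f "- f" m] by (simp add: eq_neg_iff_add_eq_0 add.commute)
  have "subgroup ?J (add_monoid ?P)"
  proof (rule add.subgroupI)
    show "?J \<noteq> {}"
      by (auto intro: exI[of _ 0])
  next
    fix a assume a: "a \<in> ?J"
    have "\<ominus>\<^bsub>?P\<^esub> a = - a"
      by (rule minus_equality) (use a in auto)
    then show "\<ominus>\<^bsub>?P\<^esub> a \<in> ?J"
      using a by (simp add: neg)
  next
    fix a b assume "a \<in> ?J" "b \<in> ?J"
    then show "a \<oplus>\<^bsub>?P\<^esub> b \<in> ?J"
      using keys_add[of a b] by (auto simp: path_algebra_act_add_left)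
  qed auto
  moreover have "a \<otimes>\<^bsub>?P\<^esub> x \<in> ?J \<and> x \<otimes>\<^bsub>?P\<^esub> a \<in> ?J" if "a \<in> carrier ?P" "x \<in> ?J" for a x
  proof -
    have zero: "path_algebra_act Q C a 0 = (0 :: int \<Rightarrow>\<^sub>0 'k)"
      using path_algebra_act_add[of a 0 0] by (metis add.right_neutral add_left_cancel)
    have a: "Poly_Mapping.keys a \<subseteq> paths Q" and x: "Poly_Mapping.keys x \<subseteq> paths Q"
      "\<And>m. Poly_Mapping.keys m \<subseteq> word_index C \<Longrightarrow> path_algebra_act Q C x m = 0"
      using that by auto
    have "path_algebra_act Q C (a \<otimes>\<^bsub>?P\<^esub> x) m = 0 \<and> path_algebra_act Q C (x \<otimes>\<^bsub>?P\<^esub> a) m = 0"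
      if m: "Poly_Mapping.keys m \<subseteq> word_index C" for m
      unfolding path_algebra_act_mult[OF x(1) m] path_algebra_act_mult[OF a m] x(2)[OF m]
      using x(2)[OF path_algebra_act_closed[OF a m]] zero by simp
    moreover have "a \<otimes>\<^bsub>?P\<^esub> x \<in> carrier ?P" "x \<otimes>\<^bsub>?P\<^esub> a \<in> carrier ?P"
      using a x(1) by (intro path_algebra_mult_closed; simp)+
    ultimately show ?thesis
      by blast
  qed
  ultimately have ideal: "two_sided_ideal ?P ?J"
    unfolding two_sided_ideal_def additive_subgroup_def by (intro conjI ballI) simp_all
  have "(\<lambda>p. Poly_Mapping.single p 1) ` \<rho> \<subseteq> ?J"
    using relations_paths by (auto simp: path_algebra_act_single relation_act simp del: path_act.simps)
  with ideal have "zero_relation_ideal Q \<rho> \<subseteq> ?J"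
    unfolding zero_relation_ideal_def by (rule ideal_generated_subset)
  then show ?thesis
    using assms by blast
qed

section \<open>The module structure over the quotient algebra\<close>

lemma string_module_simps [simp]:
  "carrier (string_module Q C) = {m. Poly_Mapping.keys m \<subseteq> word_index C}"
  "ring.zero (string_module Q C) = 0"
  "ring.add (string_module Q C) = (+)"
  by (simp_all add: string_module_def)

lemma smult_bound_class:
  fixes m :: "int \<Rightarrow>\<^sub>0 'k::field"
  assumes "Poly_Mapping.keys f \<subseteq> paths Q" "Poly_Mapping.keys m \<subseteq> word_index C"
  shows "bound_class Q \<rho> f \<odot>\<^bsub>string_module Q C\<^esub> m = path_algebra_act Q C f m"
proof -
  have "path_algebra_act Q C g m = path_algebra_act Q C f m" if "g \<in> bound_class Q \<rho> f" for g
    using that zero_relation_ideal_act[OF _ assms(2)]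
    by (auto simp: mem_bound_class path_algebra_act_add_left)
  then have "(\<lambda>g. path_algebra_act Q C g m) ` bound_class Q \<rho> f =
      (\<lambda>g. path_algebra_act Q C f m) ` bound_class Q \<rho> f"
    by (rule image_cong[OF refl])
  also have "\<dots> = {path_algebra_act Q C f m}"
    using bound_class_self[of f] by blast
  finally have "(\<lambda>g. path_algebra_act Q C g m) ` bound_class Q \<rho> f = {path_algebra_act Q C f m}" .
  then show ?thesis
    by (simp add: string_module_def)
qed

lemma vertex_class_smult:
  fixes m :: "int \<Rightarrow>\<^sub>0 'k::field"
  assumes "v \<in> verts Q" "Poly_Mapping.keys m \<subseteq> word_index C"
  shows "vertex_class Q \<rho> v c \<odot>\<^bsub>string_module Q C\<^esub> m = kscale c (klinear_extend (vertex_act Q C v) m)"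
  unfolding vertex_class_def using assms
  by (subst smult_bound_class) (auto simp: trivial_path_in_paths_iff path_algebra_act_single)

text \<open>The path with the single arrow \<open>x\<close> first applies the trivial path at
  \<open>tail Q x\<close>. This does not affect the result, because every step along
  \<open>x\<close> starts at a position with that vertex.\<close>

lemma arrow_class_smult:
  fixes m :: "int \<Rightarrow>\<^sub>0 'k::field"
  assumes "x \<in> arcs Q" "Poly_Mapping.keys m \<subseteq> word_index C"
  shows "arrow_class Q \<rho> x \<odot>\<^bsub>string_module Q C\<^esub> m = klinear_extend (arrow_act C x) m"
proof -
  have "klinear_extend (arrow_act C x) (klinear_extend (vertex_act Q C (tail Q x)) m) = klinear_extend (arrow_act C x) m"
  proof (rule poly_mapping_eqI)
    fix j
    show "Poly_Mapping.lookup (klinear_extend (arrow_act C x) (klinear_extend (vertex_act Q C (tail Q x)) m)) j =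
        Poly_Mapping.lookup (klinear_extend (arrow_act C x) m) j"
      using step_endpoints(4)[of x _ j]
      by (cases "\<exists>i. step (letter_at C) x i j") (auto simp: lookup_arrow lookup_arrow_zero lookup_vertex)
  qed
  then show ?thesis
    unfolding arrow_class_def using assms
    by (subst smult_bound_class) (auto simp: arrow_in_paths_iff path_algebra_act_single)
qed

lemma left_module_string_module:
  "left_module (bound_path_algebra Q \<rho>)
    (string_module Q C :: ((('v, 'e) path \<Rightarrow>\<^sub>0 'k::field) set, int \<Rightarrow>\<^sub>0 'k) module)"
proof -
  let ?M = "string_module Q C :: ((('v, 'e) path \<Rightarrow>\<^sub>0 'k) set, int \<Rightarrow>\<^sub>0 'k) module"
  let ?L = "bound_path_algebra Q \<rho> :: (('v, 'e) path \<Rightarrow>\<^sub>0 'k) set ring"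
  interpret M: abelian_group ?M
    by (rule abelian_group_poly_mapping) (rule string_module_simps)+
  have repr: "\<exists>f. a = bound_class Q \<rho> f \<and> Poly_Mapping.keys f \<subseteq> paths Q" if "a \<in> carrier ?L" for a
    using that by (auto simp: carrier_bound_path_algebra)
  have closed: "a \<odot>\<^bsub>?M\<^esub> x \<in> carrier ?M" if a: "a \<in> carrier ?L" and x: "x \<in> carrier ?M" for a x
  proof -
    from repr[OF a] obtain f where "a = bound_class Q \<rho> f" "Poly_Mapping.keys f \<subseteq> paths Q"
      by blast
    then show ?thesis
      using x path_algebra_act_closed[of f x] by (simp add: smult_bound_class)
  qed
  let ?S = "{a \<odot>\<^bsub>?M\<^esub> x | a x. a \<in> carrier ?L \<and> x \<in> carrier ?M}"
  have generates: "m \<in> generate (add_monoid ?M) ?S" if "Poly_Mapping.keys m \<subseteq> word_index C" for m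
    using that
  proof (induction rule: poly_mapping_add_single_induct)
    case zero
    show ?case
      using generate.one[of "add_monoid ?M"] by simp
  next
    case (add f i c)
    let ?v = "word_vertex Q C i" and ?b = "Poly_Mapping.single i c"
    have v: "?v \<in> verts Q"
      using add by (intro word_vertex_in_verts)
    have b: "Poly_Mapping.keys ?b \<subseteq> word_index C"
      using add by simp
    \<comment> \<open>A multiple of a basis vector is fixed by the trivial path at its vertex; this
      is the source of \<Lambda> M = M.\<close>
    have "?b = vertex_class Q \<rho> ?v 1 \<odot>\<^bsub>?M\<^esub> ?b"
      by (subst vertex_class_smult[OF v b]) (simp add: vertex_act_def)
    moreover have "?b \<in> carrier ?M"
      using b by simp
    ultimately have "?b \<in> ?S"
      using vertex_class_closed[OF v] by blast
    then have "?b \<in> generate (add_monoid ?M) ?S"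
      by (rule generate.incl)
    from generate.eng[OF add(1) this] show ?case
      by simp
  qed
  have "generate (add_monoid ?M) ?S \<subseteq> carrier ?M"
    by (rule M.add.generate_incl) (use closed in force)
  with generates have generate: "generate (add_monoid ?M) ?S = carrier ?M"
    by auto
  have l_distr: "(a \<oplus>\<^bsub>?L\<^esub> b) \<odot>\<^bsub>?M\<^esub> x = a \<odot>\<^bsub>?M\<^esub> x \<oplus>\<^bsub>?M\<^esub> b \<odot>\<^bsub>?M\<^esub> x"
    and assoc: "(a \<otimes>\<^bsub>?L\<^esub> b) \<odot>\<^bsub>?M\<^esub> x = a \<odot>\<^bsub>?M\<^esub> (b \<odot>\<^bsub>?M\<^esub> x)"
    if a: "a \<in> carrier ?L" and b: "b \<in> carrier ?L" and x: "x \<in> carrier ?M" for a b x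
  proof -
    from repr[OF a] obtain f where f: "a = bound_class Q \<rho> f" "Poly_Mapping.keys f \<subseteq> paths Q"
      by blast
    from repr[OF b] obtain g where g: "b = bound_class Q \<rho> g" "Poly_Mapping.keys g \<subseteq> paths Q"
      by blast
    have "Poly_Mapping.keys (f + g) \<subseteq> paths Q"
      using f g keys_add[of f g] by blast
    then show "(a \<oplus>\<^bsub>?L\<^esub> b) \<odot>\<^bsub>?M\<^esub> x = a \<odot>\<^bsub>?M\<^esub> x \<oplus>\<^bsub>?M\<^esub> b \<odot>\<^bsub>?M\<^esub> x"
      using f g x by (simp add: add_bound_class smult_bound_class path_algebra_act_add_left)
    have x': "Poly_Mapping.keys x \<subseteq> word_index C"
      using x by simp
    have "f \<otimes>\<^bsub>path_algebra Q\<^esub> g \<in> carrier (path_algebra Q)"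
      using f g by (intro path_algebra_mult_closed) simp_all
    then have "Poly_Mapping.keys (f \<otimes>\<^bsub>path_algebra Q\<^esub> g) \<subseteq> paths Q"
      by (simp only: path_algebra_simps(1) mem_Collect_eq)
    note fg = smult_bound_class[OF this x']
    show "(a \<otimes>\<^bsub>?L\<^esub> b) \<odot>\<^bsub>?M\<^esub> x = a \<odot>\<^bsub>?M\<^esub> (b \<odot>\<^bsub>?M\<^esub> x)"
      unfolding f(1) g(1) mult_bound_class[OF f(2) g(2)] fg smult_bound_class[OF g(2) x']
        smult_bound_class[OF f(2) path_algebra_act_closed[OF g(2) x']]
      by (rule path_algebra_act_mult[OF g(2) x'])
  qed
  have r_distr: "a \<odot>\<^bsub>?M\<^esub> (x \<oplus>\<^bsub>?M\<^esub> y) = a \<odot>\<^bsub>?M\<^esub> x \<oplus>\<^bsub>?M\<^esub> a \<odot>\<^bsub>?M\<^esub> y"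
    if a: "a \<in> carrier ?L" and xy: "x \<in> carrier ?M" "y \<in> carrier ?M" for a x y
  proof -
    from repr[OF a] obtain f where "a = bound_class Q \<rho> f" "Poly_Mapping.keys f \<subseteq> paths Q"
      by blast
    moreover have "Poly_Mapping.keys (x + y) \<subseteq> word_index C"
      using xy keys_add[of x y] by auto
    ultimately show ?thesis
      using xy by (simp add: smult_bound_class path_algebra_act_add)
  qed
  show ?thesis
    by (intro left_module.intro left_module_axioms.intro M.abelian_group_axioms
        closed l_distr r_distr assoc generate)
qed

end

section \<open>Tensor products\<close>

locale tensor_product = M: abelian_group M + V: abelian_group V
  for R :: "('r, 'a) ring_scheme" and M :: "('r, 'x) module" and V :: "('r, 'y) module" +
  assumes M_smult_closed: "r \<in> carrier R \<Longrightarrow> x \<in> carrier M \<Longrightarrow> r \<odot>\<^bsub>M\<^esub> x \<in> carrier M"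
    and V_smult_closed: "r \<in> carrier R \<Longrightarrow> v \<in> carrier V \<Longrightarrow> r \<odot>\<^bsub>V\<^esub> v \<in> carrier V"
begin

abbreviation free_group :: "('x \<times> 'y \<Rightarrow>\<^sub>0 int) monoid" where
  "free_group \<equiv> free_Abelian_group (carrier M \<times> carrier V)"

abbreviation relations :: "('x \<times> 'y \<Rightarrow>\<^sub>0 int) set" where
  "relations \<equiv> generate free_group (tensor_relations R M V)"

definition tclass :: "('x \<times> 'y \<Rightarrow>\<^sub>0 int) \<Rightarrow> ('x \<times> 'y \<Rightarrow>\<^sub>0 int) set" where
  "tclass z = relations #>\<^bsub>free_group\<^esub> z"

definition pure :: "'x \<Rightarrow> 'y \<Rightarrow> ('x \<times> 'y \<Rightarrow>\<^sub>0 int) set" where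
  "pure x v = tclass (frag_of (x, v))"

sublocale F: comm_group free_group
  by (rule abelian_free_Abelian_group)

lemma keys_diff_subset: "Poly_Mapping.keys a \<subseteq> S \<Longrightarrow> Poly_Mapping.keys b \<subseteq> S \<Longrightarrow> Poly_Mapping.keys (a - b) \<subseteq> S"
  using keys_diff[of a b] by blast

lemma tensor_relations_subset: "tensor_relations R M V \<subseteq> carrier free_group"
proof
  fix z assume "z \<in> tensor_relations R M V"
  then show "z \<in> carrier free_group"
    unfolding tensor_relations_def
    by (elim UnE CollectE exE conjE; hypsubst_thin)
      (simp only: carrier_free_Abelian_group_iff; intro keys_diff_subset; simp add: keys_frag_of M_smult_closed V_smult_closed)+
qed

lemma tensor_relations_add_left:
    "x \<in> carrier M \<Longrightarrow> x' \<in> carrier M \<Longrightarrow> v \<in> carrier V \<Longrightarrow>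
      frag_of (x \<oplus>\<^bsub>M\<^esub> x', v) - frag_of (x, v) - frag_of (x', v) \<in> tensor_relations R M V"
  and tensor_relations_add_right:
    "x \<in> carrier M \<Longrightarrow> v \<in> carrier V \<Longrightarrow> v' \<in> carrier V \<Longrightarrow>
      frag_of (x, v \<oplus>\<^bsub>V\<^esub> v') - frag_of (x, v) - frag_of (x, v') \<in> tensor_relations R M V"
  and tensor_relations_balanced:
    "r \<in> carrier R \<Longrightarrow> x \<in> carrier M \<Longrightarrow> v \<in> carrier V \<Longrightarrow>
      frag_of (r \<odot>\<^bsub>M\<^esub> x, v) - frag_of (x, r \<odot>\<^bsub>V\<^esub> v) \<in> tensor_relations R M V"
  unfolding tensor_relations_def by blast+

section \<open>The quotient group and its pure tensors\<close>

lemma subgroup_relations: "subgroup relations free_group"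
  by (rule F.generate_is_subgroup[OF tensor_relations_subset])

lemma normal_relations: "relations \<lhd> free_group"
  using subgroup_relations by (simp add: F.normal_iff_subgroup)

lemma comm_group_tensor: "comm_group (tensor_group R M V)"
  unfolding tensor_group_def by (rule F.abelian_FactGroup[OF subgroup_relations])

sublocale T: comm_group "tensor_group R M V"
  by (rule comm_group_tensor)

lemma carrier_tensor_group:
  "carrier (tensor_group R M V) = tclass ` {z. Poly_Mapping.keys z \<subseteq> carrier M \<times> carrier V}"
  unfolding tensor_group_def carrier_FactGroup tclass_def by (rule image_cong) auto

lemma tclass_closed: "Poly_Mapping.keys z \<subseteq> carrier M \<times> carrier V \<Longrightarrow> tclass z \<in> carrier (tensor_group R M V)"
  by (auto simp: carrier_tensor_group)

lemma tclass_mult: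
  assumes "Poly_Mapping.keys z \<subseteq> carrier M \<times> carrier V" "Poly_Mapping.keys w \<subseteq> carrier M \<times> carrier V"
  shows "tclass z \<otimes>\<^bsub>tensor_group R M V\<^esub> tclass w = tclass (z + w)"
  using normal.rcos_sum[OF normal_relations, of z w] assms
  by (simp add: tclass_def tensor_group_def)

lemma mem_tclass: "y \<in> tclass z \<longleftrightarrow> (\<exists>h\<in>relations. y = h + z)"
  by (auto simp: tclass_def r_coset_def)

lemma zero_in_relations: "0 \<in> relations"
  using generate.one[of free_group] by simp

lemma tclass_self: "z \<in> tclass z"
  using zero_in_relations by (auto simp: mem_tclass)

lemma tclass_eqI:
  assumes "z - w \<in> relations" "Poly_Mapping.keys w \<subseteq> carrier M \<times> carrier V"
  shows "tclass z = tclass w"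
proof -
  have "z \<in> tclass w"
    unfolding mem_tclass by (rule bexI[OF _ assms(1)]) simp
  then have "tclass w = tclass z"
    unfolding tclass_def using assms(2) subgroup_relations by (intro F.repr_independence) simp_all
  then show ?thesis ..
qed

lemma one_tensor_group: "\<one>\<^bsub>tensor_group R M V\<^esub> = tclass 0"
  by (auto simp: tensor_group_def mem_tclass)

lemma one_tensor_group': "\<one>\<^bsub>tensor_group R M V\<^esub> = relations"
  by (simp add: tensor_group_def)

lemma pure_closed: "x \<in> carrier M \<Longrightarrow> v \<in> carrier V \<Longrightarrow> pure x v \<in> carrier (tensor_group R M V)"
  unfolding pure_def by (rule tclass_closed) (simp add: keys_frag_of)

lemma keys_frag_add:
  "x \<in> carrier M \<Longrightarrow> v \<in> carrier V \<Longrightarrow> x' \<in> carrier M \<Longrightarrow> v' \<in> carrier V \<Longrightarrow>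
    Poly_Mapping.keys (frag_of (x, v) + frag_of (x', v')) \<subseteq> carrier M \<times> carrier V"
  using keys_add[of "frag_of (x, v)" "frag_of (x', v')"] by (auto simp: keys_frag_of)

lemma pure_add_left:
  assumes "x \<in> carrier M" "x' \<in> carrier M" "v \<in> carrier V"
  shows "pure (x \<oplus>\<^bsub>M\<^esub> x') v = pure x v \<otimes>\<^bsub>tensor_group R M V\<^esub> pure x' v"
proof -
  have "frag_of (x \<oplus>\<^bsub>M\<^esub> x', v) - frag_of (x, v) - frag_of (x', v) \<in> tensor_relations R M V"
    unfolding tensor_relations_def using assms by blast
  then have "frag_of (x \<oplus>\<^bsub>M\<^esub> x', v) - (frag_of (x, v) + frag_of (x', v)) \<in> relations"
    unfolding diff_diff_eq by (rule generate.incl)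
  then have "pure (x \<oplus>\<^bsub>M\<^esub> x') v = tclass (frag_of (x, v) + frag_of (x', v))"
    unfolding pure_def by (rule tclass_eqI) (rule keys_frag_add; fact)
  also have "\<dots> = pure x v \<otimes>\<^bsub>tensor_group R M V\<^esub> pure x' v"
    unfolding pure_def by (rule tclass_mult[symmetric]) (simp_all add: keys_frag_of assms)
  finally show ?thesis .
qed

lemma pure_add_right:
  assumes "x \<in> carrier M" "v \<in> carrier V" "v' \<in> carrier V"
  shows "pure x (v \<oplus>\<^bsub>V\<^esub> v') = pure x v \<otimes>\<^bsub>tensor_group R M V\<^esub> pure x v'"
proof -
  have "frag_of (x, v \<oplus>\<^bsub>V\<^esub> v') - frag_of (x, v) - frag_of (x, v') \<in> tensor_relations R M V"
    unfolding tensor_relations_def using assms by blast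
  then have "frag_of (x, v \<oplus>\<^bsub>V\<^esub> v') - (frag_of (x, v) + frag_of (x, v')) \<in> relations"
    unfolding diff_diff_eq by (rule generate.incl)
  then have "pure x (v \<oplus>\<^bsub>V\<^esub> v') = tclass (frag_of (x, v) + frag_of (x, v'))"
    unfolding pure_def by (rule tclass_eqI) (rule keys_frag_add; fact)
  also have "\<dots> = pure x v \<otimes>\<^bsub>tensor_group R M V\<^esub> pure x v'"
    unfolding pure_def by (rule tclass_mult[symmetric]) (simp_all add: keys_frag_of assms)
  finally show ?thesis .
qed

lemma pure_balanced:
  assumes "r \<in> carrier R" "x \<in> carrier M" "v \<in> carrier V"
  shows "pure (r \<odot>\<^bsub>M\<^esub> x) v = pure x (r \<odot>\<^bsub>V\<^esub> v)"
proof -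
  have "frag_of (r \<odot>\<^bsub>M\<^esub> x, v) - frag_of (x, r \<odot>\<^bsub>V\<^esub> v) \<in> tensor_relations R M V"
    unfolding tensor_relations_def using assms by blast
  then have "frag_of (r \<odot>\<^bsub>M\<^esub> x, v) - frag_of (x, r \<odot>\<^bsub>V\<^esub> v) \<in> relations"
    by (rule generate.incl)
  then show ?thesis
    unfolding pure_def by (rule tclass_eqI) (simp add: keys_frag_of assms V_smult_closed)
qed

lemma pure_zero_right:
  assumes "x \<in> carrier M"
  shows "pure x \<zero>\<^bsub>V\<^esub> = \<one>\<^bsub>tensor_group R M V\<^esub>"
proof -
  have "pure x \<zero>\<^bsub>V\<^esub> \<otimes>\<^bsub>tensor_group R M V\<^esub> pure x \<zero>\<^bsub>V\<^esub> = pure x \<zero>\<^bsub>V\<^esub>"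
    using pure_add_right[of x "\<zero>\<^bsub>V\<^esub>" "\<zero>\<^bsub>V\<^esub>"] assms by simp
  then show ?thesis
    using pure_closed[OF assms V.zero_closed] by (metis T.l_cancel_one')
qed

lemma pure_zero_left:
  assumes "v \<in> carrier V"
  shows "pure \<zero>\<^bsub>M\<^esub> v = \<one>\<^bsub>tensor_group R M V\<^esub>"
proof -
  have "pure \<zero>\<^bsub>M\<^esub> v \<otimes>\<^bsub>tensor_group R M V\<^esub> pure \<zero>\<^bsub>M\<^esub> v = pure \<zero>\<^bsub>M\<^esub> v"
    using pure_add_left[of "\<zero>\<^bsub>M\<^esub>" "\<zero>\<^bsub>M\<^esub>" v] assms by simp
  then show ?thesis
    using pure_closed[OF M.zero_closed assms] by (metis T.l_cancel_one')
qed

lemma pure_minus: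
  assumes "x \<in> carrier M" "v \<in> carrier V"
  shows "inv\<^bsub>tensor_group R M V\<^esub> pure x v = pure x (\<ominus>\<^bsub>V\<^esub> v)"
proof (rule T.inv_equality)
  show "pure x (\<ominus>\<^bsub>V\<^esub> v) \<otimes>\<^bsub>tensor_group R M V\<^esub> pure x v = \<one>\<^bsub>tensor_group R M V\<^esub>"
    using assms by (simp add: pure_add_right[symmetric] V.l_neg pure_zero_right)
qed (use assms pure_closed in auto)

text \<open>Negatives are absorbed by \<open>- (x \<otimes> v) = x \<otimes> (- v)\<close>. The
  claim is proved for \<open>z\<close> and \<open>- z\<close> together, because the induction over
  the free abelian group proceeds by differences.\<close>

lemma tensor_induct [consumes 1, case_names one pure mult]:
  assumes "Z \<in> carrier (tensor_group R M V)"
    and one: "P \<one>\<^bsub>tensor_group R M V\<^esub>"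
    and pure: "\<And>x v. x \<in> carrier M \<Longrightarrow> v \<in> carrier V \<Longrightarrow> P (pure x v)"
    and mult: "\<And>X Y. X \<in> carrier (tensor_group R M V) \<Longrightarrow> Y \<in> carrier (tensor_group R M V) \<Longrightarrow>
      P X \<Longrightarrow> P Y \<Longrightarrow> P (X \<otimes>\<^bsub>tensor_group R M V\<^esub> Y)"
  shows "P Z"
proof -
  have *: "P (tclass z) \<and> P (tclass (- z))" if "Poly_Mapping.keys z \<subseteq> carrier M \<times> carrier V" for z
    using that
  proof (induction rule: free_Abelian_group_induct[consumes 1, case_names zero diff frag])
    case zero
    show ?case
      using one by (simp add: one_tensor_group)
  next
    case (diff x y)
    have "tclass (x - y) = tclass x \<otimes>\<^bsub>tensor_group R M V\<^esub> tclass (- y)"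
      "tclass (- (x - y)) = tclass (- x) \<otimes>\<^bsub>tensor_group R M V\<^esub> tclass y"
      using diff.hyps by (simp_all add: tclass_mult)
    then show ?case
      using diff by (auto intro!: mult tclass_closed)
  next
    case (frag a)
    obtain x v where a: "a = (x, v)" "x \<in> carrier M" "v \<in> carrier V"
      using frag by (cases a) auto
    have "tclass (- frag_of a) \<otimes>\<^bsub>tensor_group R M V\<^esub> tclass (frag_of a) = \<one>\<^bsub>tensor_group R M V\<^esub>"
      using frag by (subst tclass_mult) (auto simp: keys_frag_of one_tensor_group)
    then have "inv\<^bsub>tensor_group R M V\<^esub> pure x v = tclass (- frag_of a)"
      unfolding pure_def a(1) by (rule T.inv_equality) (use frag a in \<open>auto intro!: tclass_closed simp: keys_frag_of\<close>)
    then have "tclass (- frag_of a) = pure x (\<ominus>\<^bsub>V\<^esub> v)"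
      using a pure_minus by simp
    then show ?case
      using pure a by (simp add: pure_def[symmetric])
  qed
  obtain z where "Z = tclass z" "Poly_Mapping.keys z \<subseteq> carrier M \<times> carrier V"
    using assms(1) by (auto simp: carrier_tensor_group)
  then show ?thesis
    using * by blast
qed

lemma hom_kills_relations:
  assumes "comm_group H" "h \<in> hom free_group H"
    and "\<And>z. z \<in> tensor_relations R M V \<Longrightarrow> h z = \<one>\<^bsub>H\<^esub>" and "z \<in> relations"
  shows "h z = \<one>\<^bsub>H\<^esub>"
proof -
  interpret H: comm_group H by fact
  interpret group_hom free_group H h
    using assms(2) by unfold_locales
  have "relations \<subseteq> kernel free_group H h"
    by (rule F.generate_subgroup_incl[OF _ subgroup_kernel])
      (use assms(3) tensor_relations_subset in \<open>auto simp: kernel_def simp del: carrier_free_Abelian_group_iff\<close>)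
  then show ?thesis
    using assms(4) by (auto simp: kernel_def)
qed

text \<open>A balanced biadditive map extends to the free abelian group on pairs. Each defining
  relation is sent to a product that cancels, so the extension factors through the quotient.\<close>

lemma tensor_universal:
  assumes "comm_group H"
    and closed: "\<And>x v. x \<in> carrier M \<Longrightarrow> v \<in> carrier V \<Longrightarrow> \<beta> x v \<in> carrier H"
    and add_left: "\<And>x x' v. x \<in> carrier M \<Longrightarrow> x' \<in> carrier M \<Longrightarrow> v \<in> carrier V \<Longrightarrow>
      \<beta> (x \<oplus>\<^bsub>M\<^esub> x') v = \<beta> x v \<otimes>\<^bsub>H\<^esub> \<beta> x' v"
    and add_right: "\<And>x v v'. x \<in> carrier M \<Longrightarrow> v \<in> carrier V \<Longrightarrow> v' \<in> carrier V \<Longrightarrow>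
      \<beta> x (v \<oplus>\<^bsub>V\<^esub> v') = \<beta> x v \<otimes>\<^bsub>H\<^esub> \<beta> x v'"
    and balanced: "\<And>r x v. r \<in> carrier R \<Longrightarrow> x \<in> carrier M \<Longrightarrow> v \<in> carrier V \<Longrightarrow>
      \<beta> (r \<odot>\<^bsub>M\<^esub> x) v = \<beta> x (r \<odot>\<^bsub>V\<^esub> v)"
  obtains \<phi> where "\<phi> \<in> hom (tensor_group R M V) H"
    "\<And>x v. x \<in> carrier M \<Longrightarrow> v \<in> carrier V \<Longrightarrow> \<phi> (pure x v) = \<beta> x v"
proof -
  interpret H: comm_group H by fact
  have "(\<lambda>(x, v). \<beta> x v) ` (carrier M \<times> carrier V) \<subseteq> carrier H"
    using closed by auto
  then obtain h where h: "h \<in> hom free_group H"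
    "\<And>p. p \<in> carrier M \<times> carrier V \<Longrightarrow> h (frag_of p) = (\<lambda>(x, v). \<beta> x v) p"
    by (rule H.free_Abelian_group_universal) blast
  have hfrag: "h (frag_of (x, v)) = \<beta> x v" if "x \<in> carrier M" "v \<in> carrier V" for x v
    using h(2)[of "(x, v)"] that by simp
  interpret h: group_hom free_group H h
    using h(1) by unfold_locales
  have hdiff: "h (a - b) = h a \<otimes>\<^bsub>H\<^esub> inv\<^bsub>H\<^esub> h b"
    if "Poly_Mapping.keys a \<subseteq> carrier M \<times> carrier V" "Poly_Mapping.keys b \<subseteq> carrier M \<times> carrier V" for a b
    using h.hom_mult[of a "- b"] h.hom_inv[of b] that by simp
  have keys: "Poly_Mapping.keys (frag_of (x, v)) \<subseteq> carrier M \<times> carrier V" if "x \<in> carrier M" "v \<in> carrier V" for x v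
    using that by (simp add: keys_frag_of)
  have cancel: "(a \<otimes>\<^bsub>H\<^esub> b) \<otimes>\<^bsub>H\<^esub> inv\<^bsub>H\<^esub> a \<otimes>\<^bsub>H\<^esub> inv\<^bsub>H\<^esub> b = \<one>\<^bsub>H\<^esub>" if "a \<in> carrier H" "b \<in> carrier H" for a b
  proof -
    have "(a \<otimes>\<^bsub>H\<^esub> b) \<otimes>\<^bsub>H\<^esub> inv\<^bsub>H\<^esub> a = b"
      using that by (simp add: H.m_comm[of a b] H.m_assoc)
    then show ?thesis
      using that by simp
  qed
  have "h z = \<one>\<^bsub>H\<^esub>" if "z \<in> tensor_relations R M V" for z
    using that unfolding tensor_relations_def
  proof (elim UnE CollectE exE conjE; hypsubst_thin)
    fix x x' v assume "x \<in> carrier M" "x' \<in> carrier M" "v \<in> carrier V"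
    then show "h (frag_of (x \<oplus>\<^bsub>M\<^esub> x', v) - frag_of (x, v) - frag_of (x', v)) = \<one>\<^bsub>H\<^esub>"
      using closed cancel by (simp add: hdiff keys keys_diff_subset hfrag add_left)
  next
    fix x v v' assume "x \<in> carrier M" "v \<in> carrier V" "v' \<in> carrier V"
    then show "h (frag_of (x, v \<oplus>\<^bsub>V\<^esub> v') - frag_of (x, v) - frag_of (x, v')) = \<one>\<^bsub>H\<^esub>"
      using closed cancel by (simp add: hdiff keys keys_diff_subset hfrag add_right)
  next
    fix r x v assume "r \<in> carrier R" "x \<in> carrier M" "v \<in> carrier V"
    then show "h (frag_of (r \<odot>\<^bsub>M\<^esub> x, v) - frag_of (x, r \<odot>\<^bsub>V\<^esub> v)) = \<one>\<^bsub>H\<^esub>"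
      using closed by (simp add: hdiff keys hfrag balanced M_smult_closed V_smult_closed)
  qed
  then have zero: "h z = \<one>\<^bsub>H\<^esub>" if "z \<in> relations" for z
    by (rule hom_kills_relations[OF assms(1) h(1) _ that])
  obtain \<phi> where \<phi>: "\<phi> \<in> hom (free_group Mod relations) H"
    "\<And>z. z \<in> carrier free_group \<Longrightarrow> \<phi> (relations #>\<^bsub>free_group\<^esub> z) = h z"
  proof (rule FactGroup_universal[OF h(1) normal_relations])
    fix y z assume y: "y \<in> carrier free_group" and z: "z \<in> carrier free_group"
      and "relations #>\<^bsub>free_group\<^esub> y = relations #>\<^bsub>free_group\<^esub> z"
    then have "y \<in> tclass z"
      using tclass_self[of y] by (simp add: tclass_def)
    then obtain k where "k \<in> relations" "y = k + z"
      unfolding mem_tclass by blast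
    moreover have "k \<in> carrier free_group"
      using \<open>k \<in> relations\<close> subgroup.subset[OF subgroup_relations] by blast
    ultimately show "h y = h z"
      using h.hom_mult[of k z] z zero[of k] h.hom_closed[OF z] by simp
  qed blast
  show thesis
  proof (rule that)
    show "\<phi> \<in> hom (tensor_group R M V) H"
      using \<phi>(1) by (simp add: tensor_group_def)
    fix x v assume "x \<in> carrier M" "v \<in> carrier V"
    then show "\<phi> (pure x v) = \<beta> x v"
      using \<phi>(2)[of "frag_of (x, v)"] hfrag by (simp add: pure_def tclass_def keys_frag_of)
  qed
qed

end

section \<open>Tensor products whose first factor carries a second action\<close>

locale tensor_left_module = tensor_product R M' V + L: left_module A M
  for R :: "('r, 'b) ring_scheme" and M' :: "('r, 'x) module" and V :: "('r, 'y) module"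
    and A :: "('l, 'a) ring_scheme" and M :: "('l, 'x) module" +
  assumes same_carrier: "carrier M = carrier M'"
    and same_add: "ring.add M = ring.add M'"
    and smult_commute: "a \<in> carrier A \<Longrightarrow> r \<in> carrier R \<Longrightarrow> x \<in> carrier M' \<Longrightarrow>
      r \<odot>\<^bsub>M'\<^esub> (a \<odot>\<^bsub>M\<^esub> x) = a \<odot>\<^bsub>M\<^esub> (r \<odot>\<^bsub>M'\<^esub> x)"
    and A_add_closed: "a \<in> carrier A \<Longrightarrow> b \<in> carrier A \<Longrightarrow> a \<oplus>\<^bsub>A\<^esub> b \<in> carrier A"
    and A_mult_closed: "a \<in> carrier A \<Longrightarrow> b \<in> carrier A \<Longrightarrow> a \<otimes>\<^bsub>A\<^esub> b \<in> carrier A"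
begin

abbreviation act :: "'l \<Rightarrow> ('x \<times> 'y \<Rightarrow>\<^sub>0 int) \<Rightarrow> ('x \<times> 'y \<Rightarrow>\<^sub>0 int)" where
  "act a \<equiv> frag_extend (\<lambda>(x, v). frag_of (a \<odot>\<^bsub>M\<^esub> x, v))"

abbreviation tensor :: "('l, ('x \<times> 'y \<Rightarrow>\<^sub>0 int) set) module" where
  "tensor \<equiv> tensor_module R M M' V"

lemma tensor_simps:
  "carrier tensor = carrier (tensor_group R M' V)"
  "\<zero>\<^bsub>tensor\<^esub> = \<one>\<^bsub>tensor_group R M' V\<^esub>"
  "ring.add tensor = monoid.mult (tensor_group R M' V)"
  by (simp_all add: tensor_module_def)

lemma smult_in: "a \<in> carrier A \<Longrightarrow> x \<in> carrier M' \<Longrightarrow> a \<odot>\<^bsub>M\<^esub> x \<in> carrier M'"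
  using L.smult_closed same_carrier by simp

lemma keys_act:
  assumes "a \<in> carrier A" "Poly_Mapping.keys z \<subseteq> carrier M' \<times> carrier V"
  shows "Poly_Mapping.keys (act a z) \<subseteq> carrier M' \<times> carrier V"
proof -
  have "Poly_Mapping.keys (case p of (x, v) \<Rightarrow> frag_of (a \<odot>\<^bsub>M\<^esub> x, v)) \<subseteq> carrier M' \<times> carrier V"
    if "p \<in> Poly_Mapping.keys z" for p
    using subsetD[OF assms(2) that] smult_in[OF assms(1)] by (cases p) (simp add: keys_frag_of)
  then show ?thesis
    by (intro order_trans[OF keys_frag_extend] UN_least)
qed

lemma act_tensor_relations:
  assumes a: "a \<in> carrier A" and z: "z \<in> tensor_relations R M' V"
  shows "act a z \<in> tensor_relations R M' V"
proof -
  from z consider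
      (left) x x' v where "z = frag_of (x \<oplus>\<^bsub>M'\<^esub> x', v) - frag_of (x, v) - frag_of (x', v)"
        "x \<in> carrier M'" "x' \<in> carrier M'" "v \<in> carrier V"
    | (right) x v v' where "z = frag_of (x, v \<oplus>\<^bsub>V\<^esub> v') - frag_of (x, v) - frag_of (x, v')"
        "x \<in> carrier M'" "v \<in> carrier V" "v' \<in> carrier V"
    | (balanced) r x v where "z = frag_of (r \<odot>\<^bsub>M'\<^esub> x, v) - frag_of (x, r \<odot>\<^bsub>V\<^esub> v)"
        "r \<in> carrier R" "x \<in> carrier M'" "v \<in> carrier V"
    unfolding tensor_relations_def by (elim UnE CollectE exE conjE)
  then show ?thesis
  proof cases
    case left
    have "a \<odot>\<^bsub>M\<^esub> (x \<oplus>\<^bsub>M'\<^esub> x') = a \<odot>\<^bsub>M\<^esub> x \<oplus>\<^bsub>M'\<^esub> a \<odot>\<^bsub>M\<^esub> x'"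
      using L.smult_r_distr[OF a, of x x'] left by (simp add: same_carrier same_add)
    then have "act a z = frag_of (a \<odot>\<^bsub>M\<^esub> x \<oplus>\<^bsub>M'\<^esub> a \<odot>\<^bsub>M\<^esub> x', v) - frag_of (a \<odot>\<^bsub>M\<^esub> x, v) - frag_of (a \<odot>\<^bsub>M\<^esub> x', v)"
      unfolding left(1) by (simp add: frag_extend_diff)
    then show ?thesis
      using tensor_relations_add_left smult_in[OF a] left by simp
  next
    case right
    have "act a z = frag_of (a \<odot>\<^bsub>M\<^esub> x, v \<oplus>\<^bsub>V\<^esub> v') - frag_of (a \<odot>\<^bsub>M\<^esub> x, v) - frag_of (a \<odot>\<^bsub>M\<^esub> x, v')"
      unfolding right(1) by (simp add: frag_extend_diff)
    then show ?thesis
      using tensor_relations_add_right smult_in[OF a] right by simp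
  next
    case balanced
    have "act a z = frag_of (r \<odot>\<^bsub>M'\<^esub> (a \<odot>\<^bsub>M\<^esub> x), v) - frag_of (a \<odot>\<^bsub>M\<^esub> x, r \<odot>\<^bsub>V\<^esub> v)"
      unfolding balanced(1) smult_commute[OF a balanced(2,3)] by (simp add: frag_extend_diff)
    then show ?thesis
      using tensor_relations_balanced smult_in[OF a] balanced by simp
  qed
qed

text \<open>The elements that the action carries into the relations form a subgroup, so it is enough
  that the generating relations are among them.\<close>

lemma act_relations:
  assumes a: "a \<in> carrier A" and "z \<in> relations"
  shows "act a z \<in> relations"
proof -
  let ?K = "{z \<in> carrier free_group. act a z \<in> relations}"
  have "act a z \<in> relations" if "z \<in> tensor_relations R M' V" for z
    by (rule generate.incl[OF act_tensor_relations[OF a that]])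
  then have sub: "tensor_relations R M' V \<subseteq> ?K"
    using tensor_relations_subset by blast
  have "subgroup ?K free_group"
  proof (rule F.subgroupI)
    have "0 \<in> ?K"
      using zero_in_relations by simp
    then show "?K \<noteq> {}"
      by blast
  next
    fix y assume y: "y \<in> ?K"
    then have "inv\<^bsub>free_group\<^esub> act a y \<in> relations"
      using subgroup.m_inv_closed[OF subgroup_relations] by blast
    then have "- act a y \<in> relations"
      using y keys_act[OF a, of y] by simp
    then show "inv\<^bsub>free_group\<^esub> y \<in> ?K"
      using y by (simp add: frag_extend_minus)
  next
    fix y z assume yz: "y \<in> ?K" "z \<in> ?K"
    then have "act a y \<otimes>\<^bsub>free_group\<^esub> act a z \<in> relations"
      using subgroup.m_closed[OF subgroup_relations] by blast
    moreover have "y \<otimes>\<^bsub>free_group\<^esub> z \<in> carrier free_group"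
      using yz by (intro F.m_closed) auto
    ultimately show "y \<otimes>\<^bsub>free_group\<^esub> z \<in> ?K"
      by (simp add: frag_extend_add)
  qed blast
  from F.generate_subgroup_incl[OF sub this] show ?thesis
    using assms(2) by blast
qed

text \<open>The image in the definition of the action is a singleton: representatives of a class
  differ by relations, and the action preserves these.\<close>

lemma smult_tclass:
  assumes "a \<in> carrier A" "Poly_Mapping.keys z \<subseteq> carrier M' \<times> carrier V"
  shows "a \<odot>\<^bsub>tensor\<^esub> tclass z = tclass (act a z)"
proof -
  have "tclass (act a y) = tclass (act a z)" if y: "y \<in> tclass z" for y
  proof (rule tclass_eqI)
    obtain k where "k \<in> relations" "y = k + z"
      using y unfolding mem_tclass by blast
    then show "act a y - act a z \<in> relations"
      using act_relations[OF assms(1)] by (simp add: frag_extend_add)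
  qed (rule keys_act[OF assms])
  then have "(\<lambda>y. tclass (act a y)) ` tclass z = (\<lambda>y. tclass (act a z)) ` tclass z"
    by (rule image_cong[OF refl])
  also have "\<dots> = {tclass (act a z)}"
    using tclass_self[of z] by blast
  finally show ?thesis
    by (simp add: tensor_module_def one_tensor_group' flip: tclass_def)
qed

lemma smult_pure:
  assumes "a \<in> carrier A" "x \<in> carrier M'" "v \<in> carrier V"
  shows "a \<odot>\<^bsub>tensor\<^esub> pure x v = pure (a \<odot>\<^bsub>M\<^esub> x) v"
  unfolding pure_def using assms by (subst smult_tclass) (simp_all add: keys_frag_of)

lemma tensor_smult_closed:
  assumes "a \<in> carrier A" "Z \<in> carrier tensor"
  shows "a \<odot>\<^bsub>tensor\<^esub> Z \<in> carrier tensor"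
proof -
  obtain z where "Z = tclass z" "Poly_Mapping.keys z \<subseteq> carrier M' \<times> carrier V"
    using assms(2) by (auto simp: tensor_simps carrier_tensor_group)
  then show ?thesis
    using assms(1) by (simp add: smult_tclass tensor_simps tclass_closed keys_act)
qed

lemma tensor_smult_r_distr:
  assumes "a \<in> carrier A" "Y \<in> carrier tensor" "Z \<in> carrier tensor"
  shows "a \<odot>\<^bsub>tensor\<^esub> (Y \<oplus>\<^bsub>tensor\<^esub> Z) = a \<odot>\<^bsub>tensor\<^esub> Y \<oplus>\<^bsub>tensor\<^esub> a \<odot>\<^bsub>tensor\<^esub> Z"
proof -
  obtain y where y: "Y = tclass y" "Poly_Mapping.keys y \<subseteq> carrier M' \<times> carrier V"
    using assms(2) by (auto simp: tensor_simps carrier_tensor_group)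
  obtain z where z: "Z = tclass z" "Poly_Mapping.keys z \<subseteq> carrier M' \<times> carrier V"
    using assms(3) by (auto simp: tensor_simps carrier_tensor_group)
  have "Poly_Mapping.keys (y + z) \<subseteq> carrier M' \<times> carrier V"
    using y(2) z(2) keys_add[of y z] by blast
  then show ?thesis
    unfolding tensor_simps y(1) z(1) tclass_mult[OF y(2) z(2)] smult_tclass[OF assms(1) y(2)]
      smult_tclass[OF assms(1) z(2)]
    using assms(1) y z by (simp only: smult_tclass tclass_mult keys_act frag_extend_add)
qed

lemma abelian_group_tensor: "abelian_group tensor"
proof (rule abelian_groupI; unfold tensor_simps)
  fix X assume X: "X \<in> carrier (tensor_group R M' V)"
  show "\<exists>Y\<in>carrier (tensor_group R M' V). Y \<otimes>\<^bsub>tensor_group R M' V\<^esub> X = \<one>\<^bsub>tensor_group R M' V\<^esub>"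
    using T.l_inv[OF X] T.inv_closed[OF X] by blast
qed (simp_all add: T.m_ac)

lemma left_module_tensor: "left_module A tensor"
proof -
  interpret Tm: abelian_group tensor
    by (rule abelian_group_tensor)
  have zero: "a \<odot>\<^bsub>tensor\<^esub> \<zero>\<^bsub>tensor\<^esub> = \<zero>\<^bsub>tensor\<^esub>" if "a \<in> carrier A" for a
    using tensor_smult_r_distr[OF that, of "\<zero>\<^bsub>tensor\<^esub>" "\<zero>\<^bsub>tensor\<^esub>"] tensor_smult_closed[OF that, of "\<zero>\<^bsub>tensor\<^esub>"]
    by (simp add: Tm.add.l_cancel_one')
  have l_distr: "(a \<oplus>\<^bsub>A\<^esub> b) \<odot>\<^bsub>tensor\<^esub> Z = a \<odot>\<^bsub>tensor\<^esub> Z \<oplus>\<^bsub>tensor\<^esub> b \<odot>\<^bsub>tensor\<^esub> Z"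
    if a: "a \<in> carrier A" and b: "b \<in> carrier A" and ab: "a \<oplus>\<^bsub>A\<^esub> b \<in> carrier A" and "Z \<in> carrier tensor" for a b Z
    using that(4) unfolding tensor_simps(1)
  proof (induction rule: tensor_induct)
    case one
    show ?case
      using zero[OF a] zero[OF b] zero[OF ab] unfolding tensor_simps(2)[symmetric] by simp
  next
    case (pure x v)
    have "(a \<oplus>\<^bsub>A\<^esub> b) \<odot>\<^bsub>M\<^esub> x = a \<odot>\<^bsub>M\<^esub> x \<oplus>\<^bsub>M'\<^esub> b \<odot>\<^bsub>M\<^esub> x"
      using L.smult_l_distr[OF a b, of x] pure same_carrier same_add by simp
    then show ?case
      using pure a b ab smult_in by (simp add: smult_pure tensor_simps pure_add_left)
  next
    case (mult X Y)
    then have XY: "X \<in> carrier tensor" "Y \<in> carrier tensor"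
      by (simp_all add: tensor_simps)
    show ?case
      unfolding tensor_simps(3)[symmetric] tensor_smult_r_distr[OF a XY] tensor_smult_r_distr[OF b XY]
        tensor_smult_r_distr[OF ab XY] mult.IH
      using tensor_smult_closed[OF a] tensor_smult_closed[OF b] XY by (simp add: Tm.add.m_ac)
  qed
  have assoc: "(a \<otimes>\<^bsub>A\<^esub> b) \<odot>\<^bsub>tensor\<^esub> Z = a \<odot>\<^bsub>tensor\<^esub> (b \<odot>\<^bsub>tensor\<^esub> Z)"
    if a: "a \<in> carrier A" and b: "b \<in> carrier A" and ab: "a \<otimes>\<^bsub>A\<^esub> b \<in> carrier A" and "Z \<in> carrier tensor" for a b Z
    using that(4) unfolding tensor_simps(1)
  proof (induction rule: tensor_induct)
    case one
    show ?case
      using zero[OF a] zero[OF b] zero[OF ab] unfolding tensor_simps(2)[symmetric] by simp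
  next
    case (pure x v)
    have "(a \<otimes>\<^bsub>A\<^esub> b) \<odot>\<^bsub>M\<^esub> x = a \<odot>\<^bsub>M\<^esub> (b \<odot>\<^bsub>M\<^esub> x)"
      using L.smult_assoc[OF a b, of x] pure same_carrier by simp
    then show ?case
      using pure a b ab smult_in by (simp add: smult_pure)
  next
    case (mult X Y)
    then have XY: "X \<in> carrier tensor" "Y \<in> carrier tensor"
      by (simp_all add: tensor_simps)
    show ?case
      unfolding tensor_simps(3)[symmetric] tensor_smult_r_distr[OF b XY] tensor_smult_r_distr[OF ab XY] mult.IH
      using tensor_smult_r_distr[OF a] tensor_smult_closed[OF b] XY by simp
  qed
  let ?S = "{a \<odot>\<^bsub>M\<^esub> x | a x. a \<in> carrier A \<and> x \<in> carrier M}"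
  let ?St = "{a \<odot>\<^bsub>tensor\<^esub> Z | a Z. a \<in> carrier A \<and> Z \<in> carrier tensor}"
  \<comment> \<open>The two records share carrier and addition but have zero fields of their own;
    \<open>x + x = x\<close> identifies them.\<close>
  have zero_eq: "\<zero>\<^bsub>M\<^esub> = \<zero>\<^bsub>M'\<^esub>"
  proof -
    have "\<zero>\<^bsub>M\<^esub> \<in> carrier M'" "\<zero>\<^bsub>M\<^esub> \<oplus>\<^bsub>M'\<^esub> \<zero>\<^bsub>M\<^esub> = \<zero>\<^bsub>M\<^esub>"
      using L.l_zero[OF L.zero_closed] L.zero_closed unfolding same_carrier same_add by simp_all
    then show ?thesis
      by (metis M.add.l_cancel_one')
  qed
  have S_closed: "x \<in> carrier M'" if "x \<in> ?S" for x
    using that smult_in unfolding same_carrier by blast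
  have pure_S: "pure x v \<in> ?St" if "x \<in> ?S" "v \<in> carrier V" for x v
  proof -
    obtain a y where a: "a \<in> carrier A" "y \<in> carrier M'" "x = a \<odot>\<^bsub>M\<^esub> y"
      using \<open>x \<in> ?S\<close> unfolding same_carrier by blast
    then have "pure x v = a \<odot>\<^bsub>tensor\<^esub> pure y v"
      using \<open>v \<in> carrier V\<close> by (simp add: smult_pure)
    moreover have "pure y v \<in> carrier tensor"
      using a \<open>v \<in> carrier V\<close> by (simp add: tensor_simps pure_closed)
    ultimately show ?thesis
      using a(1) by blast
  qed
  \<comment> \<open>For fixed \<open>v\<close> the map \<open>x \<mapsto> x \<otimes> v\<close> is
    additive and sends products \<open>a x\<close> to products, so it carries the generation of
    \<open>M\<close> by products over to the tensor product.\<close>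
  have gen_pure: "x \<in> carrier M' \<and> pure x v \<in> generate (add_monoid tensor) ?St"
    if "x \<in> generate (add_monoid M) ?S" and v: "v \<in> carrier V" for x v
    using that(1)
  proof induction
    case one
    then show ?case
      using generate.one[of "add_monoid tensor" ?St] v by (simp add: zero_eq pure_zero_left tensor_simps)
  next
    case (incl h)
    then show ?case
      using generate.incl[OF pure_S[OF incl v]] S_closed by blast
  next
    case (inv h)
    have h: "h \<in> carrier M'"
      using inv by (rule S_closed)
    have "inv\<^bsub>add_monoid M\<^esub> h = \<ominus>\<^bsub>M\<^esub> h"
      by (simp add: a_inv_def)
    moreover have "\<ominus>\<^bsub>M\<^esub> h \<in> carrier M'" "\<ominus>\<^bsub>M\<^esub> h \<oplus>\<^bsub>M'\<^esub> h = \<zero>\<^bsub>M'\<^esub>"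
      using L.a_inv_closed[of h] L.l_neg[of h] h unfolding same_carrier same_add zero_eq by auto
    moreover from this have "pure (\<ominus>\<^bsub>M\<^esub> h) v = inv\<^bsub>tensor_group R M' V\<^esub> pure h v"
      using h v by (intro T.inv_equality[symmetric]) (auto simp: pure_add_left[symmetric] pure_zero_left pure_closed)
    moreover have "inv\<^bsub>tensor_group R M' V\<^esub> pure h v = inv\<^bsub>add_monoid tensor\<^esub> pure h v"
      by (simp add: m_inv_def tensor_simps)
    ultimately show ?case
      using generate.inv[OF pure_S[OF inv v], of "add_monoid tensor"] by simp
  next
    case (eng h1 h2)
    then show ?case
      using generate.eng[of "pure h1 v" "add_monoid tensor" ?St "pure h2 v"] v
      by (simp add: same_add pure_add_left tensor_simps)
  qed
  have "Z \<in> generate (add_monoid tensor) ?St" if "Z \<in> carrier (tensor_group R M' V)" for Z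
    using that
  proof (induction rule: tensor_induct)
    case one
    show ?case
      using generate.one[of "add_monoid tensor" ?St] by (simp add: tensor_simps)
  next
    case (pure x v)
    then show ?case
      using gen_pure[of x v] L.smult_generates same_carrier by simp
  next
    case (mult X Y)
    then show ?case
      using generate.eng[of X "add_monoid tensor" ?St Y] by (simp add: tensor_simps)
  qed
  moreover have "generate (add_monoid tensor) ?St \<subseteq> carrier tensor"
    by (rule Tm.add.generate_incl) (use tensor_smult_closed in blast)
  ultimately have "generate (add_monoid tensor) ?St = carrier tensor"
    unfolding tensor_simps(1) by blast
  then show ?thesis
    by (intro left_module.intro left_module_axioms.intro Tm.abelian_group_axioms tensor_smult_closed
        l_distr assoc tensor_smult_r_distr A_add_closed A_mult_closed)
qed

end

section \<open>Modules with word coordinates\<close>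

text \<open>Congruence of positions is expressed by divisibility throughout. Modulo 0 it is
  equality, which lets strings and bands share one development.\<close>

lemma dvd_diff_obtain: "(n :: int) dvd j - i \<Longrightarrow> \<exists>l. j = i + n * l"
proof -
  assume "n dvd j - i"
  then obtain l where "j - i = n * l"
    by (rule dvdE)
  then show ?thesis
    by (intro exI[of _ l]) simp
qed

text \<open>
  String modules and the modules \<open>M(C,V)\<close> are treated uniformly: an element has coordinates
  \<open>co m i\<close> in an abelian group \<open>V\<close>, and \<open>emb i v\<close> plays the role of \<open>b\<^sub>i \<otimes> v\<close>. Coordinates at
  positions that are congruent modulo \<open>n\<close> determine each other through the powers \<open>\<tau> k\<close> of \<open>T\<close>.
  For string modules \<open>n = 0\<close>, and for periodic words \<open>n\<close> is the period.
\<close>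

locale word_module = string_algebra_word Q \<rho> C +
  M: left_module "bound_path_algebra Q \<rho>" M + V: abelian_group V
  for Q :: "('v, 'e) pre_digraph" and \<rho> and C
    and M :: "((('v, 'e) path \<Rightarrow>\<^sub>0 'k::field) set, 'm) module"
    and V :: "('w, 'z) ring_scheme" +
  fixes n :: int and \<kappa> :: "'k \<Rightarrow> 'w \<Rightarrow> 'w" and \<tau> :: "int \<Rightarrow> 'w \<Rightarrow> 'w"
    and emb :: "int \<Rightarrow> 'w \<Rightarrow> 'm" and co :: "'m \<Rightarrow> int \<Rightarrow> 'w"
  assumes letter_periodic: "letter_at C (i + n * k) = letter_at C i"
    and index_periodic: "i \<in> word_index C \<Longrightarrow> i + n * k \<in> word_index C"
    and scalar_closed: "v \<in> carrier V \<Longrightarrow> \<kappa> c v \<in> carrier V"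
    and scalar_zero: "\<kappa> c \<zero>\<^bsub>V\<^esub> = \<zero>\<^bsub>V\<^esub>"
    and scalar_one: "v \<in> carrier V \<Longrightarrow> \<kappa> 1 v = v"
    and twist_closed: "v \<in> carrier V \<Longrightarrow> \<tau> k v \<in> carrier V"
    and twist_neutral: "v \<in> carrier V \<Longrightarrow> \<tau> 0 v = v"
    and twist_twist: "v \<in> carrier V \<Longrightarrow> \<tau> k (\<tau> l v) = \<tau> (k + l) v"
    and twist_zero: "\<tau> k \<zero>\<^bsub>V\<^esub> = \<zero>\<^bsub>V\<^esub>"
    and emb_closed: "i \<in> word_index C \<Longrightarrow> v \<in> carrier V \<Longrightarrow> emb i v \<in> carrier M"
    and emb_add: "i \<in> word_index C \<Longrightarrow> v \<in> carrier V \<Longrightarrow> w \<in> carrier V \<Longrightarrow>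
      emb i (v \<oplus>\<^bsub>V\<^esub> w) = emb i v \<oplus>\<^bsub>M\<^esub> emb i w"
    and co_closed: "m \<in> carrier M \<Longrightarrow> co m i \<in> carrier V"
    and co_outside: "m \<in> carrier M \<Longrightarrow> i \<notin> word_index C \<Longrightarrow> co m i = \<zero>\<^bsub>V\<^esub>"
    and co_add: "m \<in> carrier M \<Longrightarrow> m' \<in> carrier M \<Longrightarrow> co (m \<oplus>\<^bsub>M\<^esub> m') i = co m i \<oplus>\<^bsub>V\<^esub> co m' i"
    and co_shift: "m \<in> carrier M \<Longrightarrow> co m (i + n * k) = \<tau> k (co m i)"
    and co_emb_same: "i \<in> word_index C \<Longrightarrow> v \<in> carrier V \<Longrightarrow> co (emb i v) i = v"
    and co_emb_other: "i \<in> word_index C \<Longrightarrow> v \<in> carrier V \<Longrightarrow> \<not> n dvd j - i \<Longrightarrow> co (emb i v) j = \<zero>\<^bsub>V\<^esub>"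
    and arrow_emb: "step (letter_at C) x i i' \<Longrightarrow> v \<in> carrier V \<Longrightarrow>
      arrow_class Q \<rho> x \<odot>\<^bsub>M\<^esub> emb i v = emb i' v"
    and arrow_emb_zero: "x \<in> arcs Q \<Longrightarrow> i \<in> word_index C \<Longrightarrow> \<nexists>i'. step (letter_at C) x i i' \<Longrightarrow> v \<in> carrier V \<Longrightarrow>
      arrow_class Q \<rho> x \<odot>\<^bsub>M\<^esub> emb i v = \<zero>\<^bsub>M\<^esub>"
    and co_arrow: "step (letter_at C) x j' j \<Longrightarrow> m \<in> carrier M \<Longrightarrow>
      co (arrow_class Q \<rho> x \<odot>\<^bsub>M\<^esub> m) j = co m j'"
    and co_arrow_zero: "x \<in> arcs Q \<Longrightarrow> \<nexists>j'. step (letter_at C) x j' j \<Longrightarrow> m \<in> carrier M \<Longrightarrow>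
      co (arrow_class Q \<rho> x \<odot>\<^bsub>M\<^esub> m) j = \<zero>\<^bsub>V\<^esub>"
    and vertex_emb: "i \<in> word_index C \<Longrightarrow> v \<in> carrier V \<Longrightarrow>
      vertex_class Q \<rho> (word_vertex Q C i) c \<odot>\<^bsub>M\<^esub> emb i v = emb i (\<kappa> c v)"
    and co_vertex: "u \<in> verts Q \<Longrightarrow> j \<in> word_index C \<Longrightarrow> m \<in> carrier M \<Longrightarrow>
      co (vertex_class Q \<rho> u c \<odot>\<^bsub>M\<^esub> m) j = (if word_vertex Q C j = u then \<kappa> c (co m j) else \<zero>\<^bsub>V\<^esub>)"
    and expand_induct: "m \<in> carrier M \<Longrightarrow> P \<zero>\<^bsub>M\<^esub> \<Longrightarrow>
      (\<And>m j v. m \<in> carrier M \<Longrightarrow> P m \<Longrightarrow> j \<in> word_index C \<Longrightarrow> v \<in> carrier V \<Longrightarrow> co m j = \<zero>\<^bsub>V\<^esub> \<Longrightarrow>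
        P (m \<oplus>\<^bsub>M\<^esub> emb j v)) \<Longrightarrow> P m"
begin

lemma letter_between:
  assumes p: "p \<in> word_index C" and q: "q \<in> word_index C" and "p < u" "u \<le> q"
  shows "letter_at C u \<noteq> None"
proof -
  have some: "\<exists>j. letter_at C j \<noteq> None"
  proof (rule ccontr)
    assume "\<nexists>j. letter_at C j \<noteq> None"
    then have "p = 0" "q = 0"
      using p q unfolding word_index_iff by blast+
    with \<open>p < u\<close> \<open>u \<le> q\<close> show False
      by simp
  qed
  have "\<exists>a\<le>p + 1. letter_at C a \<noteq> None"
    using p some unfolding word_index_iff by (metis order.refl less_add_one less_imp_le)
  moreover have "\<exists>b\<ge>q. letter_at C b \<noteq> None"
    using q some unfolding word_index_iff by (metis order.refl less_add_one less_imp_le)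
  ultimately obtain a b where "a \<le> p + 1" "letter_at C a \<noteq> None" "q \<le> b" "letter_at C b \<noteq> None"
    by blast
  moreover have "a \<le> u" "u \<le> b"
    using \<open>a \<le> p + 1\<close> \<open>q \<le> b\<close> \<open>p < u\<close> \<open>u \<le> q\<close> by simp_all
  ultimately show ?thesis
    using convex_letters unfolding convex_dom_def by blast
qed

section \<open>Elements determined by their coordinates\<close>

lemma double_zero: "x \<in> carrier V \<Longrightarrow> x \<oplus>\<^bsub>V\<^esub> x = x \<Longrightarrow> x = \<zero>\<^bsub>V\<^esub>"
  by (metis V.add.l_cancel_one')

lemma co_zero [simp]: "co \<zero>\<^bsub>M\<^esub> i = \<zero>\<^bsub>V\<^esub>"
  using co_add[of "\<zero>\<^bsub>M\<^esub>" "\<zero>\<^bsub>M\<^esub>" i] by (intro double_zero) (auto simp: co_closed)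

lemma emb_zero: "i \<in> word_index C \<Longrightarrow> emb i \<zero>\<^bsub>V\<^esub> = \<zero>\<^bsub>M\<^esub>"
  using emb_add[of i "\<zero>\<^bsub>V\<^esub>" "\<zero>\<^bsub>V\<^esub>"] emb_closed[of i "\<zero>\<^bsub>V\<^esub>"] by (metis M.add.l_cancel_one' V.l_zero V.zero_closed)

lemma co_minus: "m \<in> carrier M \<Longrightarrow> co (\<ominus>\<^bsub>M\<^esub> m) i = \<ominus>\<^bsub>V\<^esub> co m i"
  using co_add[of "\<ominus>\<^bsub>M\<^esub> m" m i] by (intro V.minus_equality[symmetric]) (auto simp: co_closed M.l_neg)

lemma co_emb_shift: "i \<in> word_index C \<Longrightarrow> v \<in> carrier V \<Longrightarrow> co (emb i v) (i + n * k) = \<tau> k v"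
  by (simp add: co_shift emb_closed co_emb_same)

text \<open>In the expansion each new summand sits where the element built so far has coordinate
  zero, so its coefficient can be read off there. If all coordinates vanish, nothing was ever
  added.\<close>

lemma co_eq_zeroD:
  assumes "m \<in> carrier M" "\<And>j. j \<in> word_index C \<Longrightarrow> co m j = \<zero>\<^bsub>V\<^esub>"
  shows "m = \<zero>\<^bsub>M\<^esub>"
proof -
  have "(\<forall>j\<in>word_index C. co m j = \<zero>\<^bsub>V\<^esub>) \<longrightarrow> m = \<zero>\<^bsub>M\<^esub>"
    using assms(1)
  proof (rule expand_induct)
    fix m j v
    assume m: "m \<in> carrier M" and IH: "(\<forall>j\<in>word_index C. co m j = \<zero>\<^bsub>V\<^esub>) \<longrightarrow> m = \<zero>\<^bsub>M\<^esub>"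
      and j: "j \<in> word_index C" and v: "v \<in> carrier V" and zero: "co m j = \<zero>\<^bsub>V\<^esub>"
    show "(\<forall>i\<in>word_index C. co (m \<oplus>\<^bsub>M\<^esub> emb j v) i = \<zero>\<^bsub>V\<^esub>) \<longrightarrow> m \<oplus>\<^bsub>M\<^esub> emb j v = \<zero>\<^bsub>M\<^esub>"
    proof
      assume all: "\<forall>i\<in>word_index C. co (m \<oplus>\<^bsub>M\<^esub> emb j v) i = \<zero>\<^bsub>V\<^esub>"
      have "v = \<zero>\<^bsub>V\<^esub>"
        using all[rule_format, OF j] m j v zero by (simp add: co_add emb_closed co_emb_same)
      then show "m \<oplus>\<^bsub>M\<^esub> emb j v = \<zero>\<^bsub>M\<^esub>"
        using all IH m j by (simp add: emb_zero)
    qed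
  qed simp
  then show ?thesis
    using assms(2) by blast
qed

lemma co_inject:
  assumes "m \<in> carrier M" "m' \<in> carrier M" "\<And>j. j \<in> word_index C \<Longrightarrow> co m j = co m' j"
  shows "m = m'"
proof -
  have "m \<oplus>\<^bsub>M\<^esub> \<ominus>\<^bsub>M\<^esub> m' = \<zero>\<^bsub>M\<^esub>"
    by (rule co_eq_zeroD) (use assms in \<open>auto simp: co_add co_minus co_closed V.r_neg\<close>)
  then show ?thesis
    using assms M.minus_equality[of m "\<ominus>\<^bsub>M\<^esub> m'"] by simp
qed

text \<open>As \<open>T\<close> moves \<open>b_i\<close> to \<open>b_{i-n}\<close>, the basis vector
  at \<open>i + n * k\<close> is the power \<open>- k\<close> of \<open>T\<close> applied to the one
  at \<open>i\<close>, and this power passes across the tensor sign. Coordinates transform with the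
  opposite sign, as in \<open>co_shift\<close>.\<close>

lemma emb_shift:
  assumes i: "i \<in> word_index C" and v: "v \<in> carrier V"
  shows "emb (i + n * k) v = emb i (\<tau> (- k) v)"
proof (rule co_inject)
  show "emb (i + n * k) v \<in> carrier M" "emb i (\<tau> (- k) v) \<in> carrier M"
    using assms by (auto intro: emb_closed index_periodic twist_closed)
  fix j
  show "co (emb (i + n * k) v) j = co (emb i (\<tau> (- k) v)) j"
  proof (cases "n dvd j - i")
    case True
    then obtain l where l: "j = i + n * l"
      using dvd_diff_obtain by blast
    then have "j = (i + n * k) + n * (l - k)"
      by (simp add: algebra_simps)
    then have "co (emb (i + n * k) v) j = \<tau> (l - k) v"
      using co_emb_shift[OF index_periodic[OF i] v, of k "l - k"] by simp
    also have "\<dots> = co (emb i (\<tau> (- k) v)) j"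
      unfolding l using i v by (simp add: co_emb_shift twist_closed twist_twist)
    finally show ?thesis .
  next
    case False
    moreover have "n dvd j - (i + n * k) \<longleftrightarrow> n dvd j - i"
    proof -
      have "j - (i + n * k) = (j - i) + n * (- k)"
        by simp
      then show ?thesis
        by (simp only: dvd_add_left_iff dvd_triv_left)
    qed
    ultimately show ?thesis
      using assms by (simp add: co_emb_other index_periodic twist_closed)
  qed
qed

text \<open>Finiteness holds for residue classes: in a band module the support is a union of whole
  classes modulo the period.\<close>

lemma finite_support:
  assumes "m \<in> carrier M"
  shows "\<exists>F. finite F \<and> (\<forall>i. co m i \<noteq> \<zero>\<^bsub>V\<^esub> \<longrightarrow> (\<exists>f\<in>F. n dvd i - f))"
  using assms
proof (rule expand_induct)
  fix m j v
  assume m: "m \<in> carrier M" "j \<in> word_index C" "v \<in> carrier V"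
    and "\<exists>F. finite F \<and> (\<forall>i. co m i \<noteq> \<zero>\<^bsub>V\<^esub> \<longrightarrow> (\<exists>f\<in>F. n dvd i - f))"
  then obtain F where F: "finite F" "\<And>i. co m i \<noteq> \<zero>\<^bsub>V\<^esub> \<Longrightarrow> \<exists>f\<in>F. n dvd i - f"
    by blast
  have "\<exists>f\<in>insert j F. n dvd i - f" if "co (m \<oplus>\<^bsub>M\<^esub> emb j v) i \<noteq> \<zero>\<^bsub>V\<^esub>" for i
  proof (cases "n dvd i - j")
    case False
    then have "co m i \<noteq> \<zero>\<^bsub>V\<^esub>"
      using that m by (auto simp: co_add emb_closed co_emb_other)
    then show ?thesis
      using F(2) by blast
  qed blast
  then show "\<exists>F. finite F \<and> (\<forall>i. co (m \<oplus>\<^bsub>M\<^esub> emb j v) i \<noteq> \<zero>\<^bsub>V\<^esub> \<longrightarrow> (\<exists>f\<in>F. n dvd i - f))"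
    using F(1) by (intro exI[of _ "insert j F"]) blast
qed (auto intro: exI[of _ "{}"])

end

section \<open>Homomorphisms and their entries\<close>

lemma linear_maps_closed: "h \<in> linear_maps A M N \<Longrightarrow> x \<in> carrier M \<Longrightarrow> h x \<in> carrier N"
  and linear_maps_add: "h \<in> linear_maps A M N \<Longrightarrow> x \<in> carrier M \<Longrightarrow> y \<in> carrier M \<Longrightarrow>
    h (x \<oplus>\<^bsub>M\<^esub> y) = h x \<oplus>\<^bsub>N\<^esub> h y"
  and linear_maps_smult: "h \<in> linear_maps A M N \<Longrightarrow> a \<in> carrier A \<Longrightarrow> x \<in> carrier M \<Longrightarrow>
    h (a \<odot>\<^bsub>M\<^esub> x) = a \<odot>\<^bsub>N\<^esub> h x"
  by (auto simp: linear_maps_def hom_def)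

lemma linear_mapsI:
  assumes "\<And>x. x \<in> carrier M \<Longrightarrow> h x \<in> carrier N"
    and "\<And>x y. x \<in> carrier M \<Longrightarrow> y \<in> carrier M \<Longrightarrow> h (x \<oplus>\<^bsub>M\<^esub> y) = h x \<oplus>\<^bsub>N\<^esub> h y"
    and "\<And>a x. a \<in> carrier A \<Longrightarrow> x \<in> carrier M \<Longrightarrow> h (a \<odot>\<^bsub>M\<^esub> x) = a \<odot>\<^bsub>N\<^esub> h x"
  shows "h \<in> linear_maps A M N"
  using assms by (auto simp: linear_maps_def hom_def)

lemma linear_maps_zero:
  assumes "abelian_group M" "abelian_group N" "h \<in> linear_maps A M N"
  shows "h \<zero>\<^bsub>M\<^esub> = \<zero>\<^bsub>N\<^esub>"
proof -
  interpret M: abelian_group M by fact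
  interpret N: abelian_group N by fact
  show ?thesis
    using linear_maps_add[OF assms(3), of "\<zero>\<^bsub>M\<^esub>" "\<zero>\<^bsub>M\<^esub>"] linear_maps_closed[OF assms(3), of "\<zero>\<^bsub>M\<^esub>"]
    by (metis M.l_zero M.zero_closed N.add.l_cancel_one')
qed

locale word_module_hom =
  A: word_module Q \<rho> C M V n \<kappa> \<tau> emb co + B: word_module Q \<rho> D N W n' \<kappa>' \<tau>' emb' co'
  for Q :: "('v, 'e) pre_digraph" and \<rho> and C D
    and M :: "((('v, 'e) path \<Rightarrow>\<^sub>0 'k::field) set, 'm) module"
    and N :: "((('v, 'e) path \<Rightarrow>\<^sub>0 'k::field) set, 'm') module"
    and V :: "('w, 'z) ring_scheme" and W :: "('w', 'z') ring_scheme"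
    and n n' \<kappa> \<kappa>' \<tau> \<tau>' emb emb' co co' +
  fixes h
  assumes linear: "h \<in> linear_maps (bound_path_algebra Q \<rho>) M N"
begin

text \<open>A matrix entry of \<open>h\<close>, itself an additive map on coefficients. The indices
  are integers and not residues; entries at congruent target indices differ by a twist.\<close>

definition entry :: "int \<Rightarrow> int \<Rightarrow> 'w \<Rightarrow> 'w'" where
  "entry i j v = co' (h (emb i v)) j"

lemmas h_closed = linear_maps_closed[OF linear]
  and h_add = linear_maps_add[OF linear]
  and h_smult = linear_maps_smult[OF linear]
  and h_zero = linear_maps_zero[OF A.M.abelian_group_axioms B.M.abelian_group_axioms linear]

lemma entry_closed: "i \<in> word_index C \<Longrightarrow> v \<in> carrier V \<Longrightarrow> entry i j v \<in> carrier W"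
  unfolding entry_def by (intro B.co_closed h_closed A.emb_closed)

lemma entry_add: "i \<in> word_index C \<Longrightarrow> v \<in> carrier V \<Longrightarrow> w \<in> carrier V \<Longrightarrow>
    entry i j (v \<oplus>\<^bsub>V\<^esub> w) = entry i j v \<oplus>\<^bsub>W\<^esub> entry i j w"
  unfolding entry_def by (simp add: A.emb_add h_add A.emb_closed B.co_add h_closed)

text \<open>A scalar acts on \<open>emb i v\<close> as a multiple of the trivial path at the vertex
  of \<open>i\<close>. On a target coordinate this multiple acts by the same scalar when the
  vertices agree.\<close>

lemma entry_scalar:
  assumes i: "i \<in> word_index C" and v: "v \<in> carrier V" and j: "j \<in> word_index D"
    and "word_vertex Q D j = word_vertex Q C i"
  shows "entry i j (\<kappa> c v) = \<kappa>' c (entry i j v)"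
proof -
  have vert: "word_vertex Q C i \<in> verts Q"
    by (rule A.word_vertex_in_verts[OF i])
  have "h (emb i (\<kappa> c v)) = vertex_class Q \<rho> (word_vertex Q C i) c \<odot>\<^bsub>N\<^esub> h (emb i v)"
    unfolding A.vertex_emb[OF i v, symmetric]
    by (rule h_smult) (use A.vertex_class_closed[OF vert] A.emb_closed[OF i v] in auto)
  then show ?thesis
    unfolding entry_def using assms B.co_vertex[OF vert j h_closed[OF A.emb_closed[OF i v]], of c] by simp
qed

text \<open>The trivial path at the vertex of \<open>i\<close> fixes \<open>emb i v\<close>, hence
  also its image, whose coordinates can then be nonzero only at positions with that vertex.\<close>

lemma entry_vertex:
  assumes i: "i \<in> word_index C" and v: "v \<in> carrier V" and nz: "entry i j v \<noteq> \<zero>\<^bsub>W\<^esub>"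
  shows "j \<in> word_index D" "word_vertex Q D j = word_vertex Q C i"
proof -
  have hv: "h (emb i v) \<in> carrier N"
    by (intro h_closed A.emb_closed i v)
  show j: "j \<in> word_index D"
    using nz B.co_outside[OF hv] unfolding entry_def by blast
  have vert: "word_vertex Q C i \<in> verts Q"
    by (rule A.word_vertex_in_verts[OF i])
  have "h (emb i (\<kappa> 1 v)) = vertex_class Q \<rho> (word_vertex Q C i) 1 \<odot>\<^bsub>N\<^esub> h (emb i v)"
    unfolding A.vertex_emb[OF i v, symmetric]
    by (rule h_smult) (use A.vertex_class_closed[OF vert] A.emb_closed[OF i v] in auto)
  then have "h (emb i v) = vertex_class Q \<rho> (word_vertex Q C i) 1 \<odot>\<^bsub>N\<^esub> h (emb i v)"
    unfolding A.scalar_one[OF v] .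
  from arg_cong[OF this, of "\<lambda>y. co' y j"] show "word_vertex Q D j = word_vertex Q C i"
    using nz B.co_vertex[OF vert j hv, of 1] unfolding entry_def by (auto split: if_splits)
qed

lemma h_arrow:
  assumes "step (letter_at C) x i i'" "v \<in> carrier V"
  shows "h (emb i' v) = arrow_class Q \<rho> x \<odot>\<^bsub>N\<^esub> h (emb i v)"
  unfolding A.arrow_emb[OF assms, symmetric]
  by (rule h_smult) (use assms A.step_endpoints[OF assms(1)] in \<open>auto intro: A.arrow_class_closed A.emb_closed\<close>)

lemma entry_step:
  assumes c: "step (letter_at C) x i i'" and d: "step (letter_at D) x j j'" and v: "v \<in> carrier V"
  shows "entry i' j' v = entry i j v"
  unfolding entry_def h_arrow[OF c v]
  by (rule B.co_arrow[OF d]) (intro h_closed A.emb_closed A.step_endpoints(2)[OF c] v)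

lemma entry_incoming:
  assumes c: "step (letter_at C) x i i'" and v: "v \<in> carrier V" and nz: "entry i' j' v \<noteq> \<zero>\<^bsub>W\<^esub>"
  shows "\<exists>j. step (letter_at D) x j j'"
proof (rule ccontr)
  assume "\<nexists>j. step (letter_at D) x j j'"
  then have "entry i' j' v = \<zero>\<^bsub>W\<^esub>"
    unfolding entry_def h_arrow[OF c v]
    by (intro B.co_arrow_zero A.step_endpoints(1)[OF c] h_closed A.emb_closed A.step_endpoints(2)[OF c] v)
  with nz show False ..
qed

text \<open>The arrow \<open>x\<close> moves the coefficient at \<open>j\<close> to
  \<open>j'\<close>. If \<open>x\<close> annihilated \<open>emb i v\<close>, all coordinates of
  \<open>x h (emb i v) = h (x emb i v)\<close> would be zero, this one included.\<close>

lemma entry_outgoing: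
  assumes i: "i \<in> word_index C" and d: "step (letter_at D) x j j'" and v: "v \<in> carrier V"
    and nz: "entry i j v \<noteq> \<zero>\<^bsub>W\<^esub>"
  shows "\<exists>i'. step (letter_at C) x i i'"
proof (rule ccontr)
  assume none: "\<nexists>i'. step (letter_at C) x i i'"
  have x: "x \<in> arcs Q"
    by (rule B.step_endpoints(1)[OF d])
  have "entry i j v = co' (arrow_class Q \<rho> x \<odot>\<^bsub>N\<^esub> h (emb i v)) j'"
    unfolding entry_def by (rule B.co_arrow[OF d, symmetric]) (intro h_closed A.emb_closed i v)
  also have "arrow_class Q \<rho> x \<odot>\<^bsub>N\<^esub> h (emb i v) = h (arrow_class Q \<rho> x \<odot>\<^bsub>M\<^esub> emb i v)"
    by (rule h_smult[symmetric]) (intro A.arrow_class_closed x A.emb_closed i v)+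
  also have "\<dots> = \<zero>\<^bsub>N\<^esub>"
    unfolding A.arrow_emb_zero[OF x i none v] by (rule h_zero)
  finally show False
    using nz by simp
qed

lemma entry_sim:
  assumes "i \<in> word_index C" "v \<in> carrier V" "entry i j v \<noteq> \<zero>\<^bsub>W\<^esub>"
  shows "sim (letter_at C) (letter_at D) i j"
proof (rule simI[where R = "\<lambda>i j. i \<in> word_index C \<and> (\<exists>v\<in>carrier V. entry i j v \<noteq> \<zero>\<^bsub>W\<^esub>)"])
  show "simulation (letter_at C) (letter_at D) (\<lambda>i j. i \<in> word_index C \<and> (\<exists>v\<in>carrier V. entry i j v \<noteq> \<zero>\<^bsub>W\<^esub>))"
    unfolding simulation_def
  proof (intro allI impI conjI; elim conjE bexE)
    fix i j x i' v assume "step (letter_at C) x i' i" "v \<in> carrier V" "entry i j v \<noteq> \<zero>\<^bsub>W\<^esub>"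
    then show "\<exists>j'. step (letter_at D) x j' j"
      by (rule entry_incoming)
  next
    fix i j x j' v assume "i \<in> word_index C" "step (letter_at D) x j j'" "v \<in> carrier V" "entry i j v \<noteq> \<zero>\<^bsub>W\<^esub>"
    then show "\<exists>i'. step (letter_at C) x i i'"
      by (rule entry_outgoing)
  next
    fix x i i' assume "step (letter_at C) x i i'"
    then show "i' \<in> word_index C"
      by (rule A.step_endpoints)
  next
    fix i j x i' j' v
    assume "step (letter_at C) x i i'" "step (letter_at D) x j j'" "v \<in> carrier V" "entry i j v \<noteq> \<zero>\<^bsub>W\<^esub>"
    then show "\<exists>v\<in>carrier V. entry i' j' v \<noteq> \<zero>\<^bsub>W\<^esub>"
      using entry_step by metis
  next
    fix x i i' assume "step (letter_at C) x i' i"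
    then show "i' \<in> word_index C"
      by (rule A.step_endpoints)
  next
    fix i j x i' j' v
    assume "step (letter_at C) x i' i" "step (letter_at D) x j' j" "v \<in> carrier V" "entry i j v \<noteq> \<zero>\<^bsub>W\<^esub>"
    then show "\<exists>v\<in>carrier V. entry i' j' v \<noteq> \<zero>\<^bsub>W\<^esub>"
      using entry_step by metis
  qed
qed (use assms in blast)

text \<open>The coordinate of \<open>h m\<close> at \<open>j\<close> is the sum of
  \<open>entry i j (co m i)\<close> over representatives \<open>i\<close> modulo \<open>n\<close>.
  What is used of this formula is that the sum vanishes when all its terms do, and the expansion
  induction gives that without choosing representatives.\<close>

lemma co_h_zero:
  assumes "m \<in> carrier M"
    and "\<And>i. i \<in> word_index C \<Longrightarrow> co m i \<noteq> \<zero>\<^bsub>V\<^esub> \<Longrightarrow> entry i j (co m i) = \<zero>\<^bsub>W\<^esub>"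
  shows "co' (h m) j = \<zero>\<^bsub>W\<^esub>"
proof -
  have "(\<forall>i\<in>word_index C. co m i \<noteq> \<zero>\<^bsub>V\<^esub> \<longrightarrow> entry i j (co m i) = \<zero>\<^bsub>W\<^esub>) \<longrightarrow> co' (h m) j = \<zero>\<^bsub>W\<^esub>"
    using assms(1)
  proof (rule A.expand_induct)
    show "(\<forall>i\<in>word_index C. co \<zero>\<^bsub>M\<^esub> i \<noteq> \<zero>\<^bsub>V\<^esub> \<longrightarrow> entry i j (co \<zero>\<^bsub>M\<^esub> i) = \<zero>\<^bsub>W\<^esub>) \<longrightarrow> co' (h \<zero>\<^bsub>M\<^esub>) j = \<zero>\<^bsub>W\<^esub>"
      unfolding h_zero by simp
  next
    fix m k v
    assume m: "m \<in> carrier M" and k: "k \<in> word_index C" and v: "v \<in> carrier V" and zero: "co m k = \<zero>\<^bsub>V\<^esub>"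
      and IH: "(\<forall>i\<in>word_index C. co m i \<noteq> \<zero>\<^bsub>V\<^esub> \<longrightarrow> entry i j (co m i) = \<zero>\<^bsub>W\<^esub>) \<longrightarrow> co' (h m) j = \<zero>\<^bsub>W\<^esub>"
    note kv = A.emb_closed[OF k v]
    show "(\<forall>i\<in>word_index C. co (m \<oplus>\<^bsub>M\<^esub> emb k v) i \<noteq> \<zero>\<^bsub>V\<^esub> \<longrightarrow> entry i j (co (m \<oplus>\<^bsub>M\<^esub> emb k v) i) = \<zero>\<^bsub>W\<^esub>) \<longrightarrow>
        co' (h (m \<oplus>\<^bsub>M\<^esub> emb k v)) j = \<zero>\<^bsub>W\<^esub>"
    proof
      assume all: "\<forall>i\<in>word_index C. co (m \<oplus>\<^bsub>M\<^esub> emb k v) i \<noteq> \<zero>\<^bsub>V\<^esub> \<longrightarrow> entry i j (co (m \<oplus>\<^bsub>M\<^esub> emb k v) i) = \<zero>\<^bsub>W\<^esub>"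
      have "entry i j (co m i) = \<zero>\<^bsub>W\<^esub>" if i: "i \<in> word_index C" and nz: "co m i \<noteq> \<zero>\<^bsub>V\<^esub>" for i
      proof -
        \<comment> \<open>At a position congruent to \<open>k\<close> the coordinate of
          \<open>m\<close> is a twist of its zero coordinate at \<open>k\<close>. The new summand
          therefore leaves the nonzero coordinates of \<open>m\<close> unchanged.\<close>
        have "\<not> n dvd i - k"
        proof
          assume "n dvd i - k"
          then obtain l where "i = k + n * l"
            using dvd_diff_obtain by blast
          then have "co m i = \<zero>\<^bsub>V\<^esub>"
            using A.co_shift[OF m, of k l] zero A.twist_zero by simp
          with nz show False ..
        qed
        then have "co (m \<oplus>\<^bsub>M\<^esub> emb k v) i = co m i"
          using m k v kv by (simp add: A.co_add A.co_emb_other A.co_closed)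
        then show ?thesis
          using all i nz by metis
      qed
      then have "co' (h m) j = \<zero>\<^bsub>W\<^esub>"
        using IH by blast
      moreover have "co (m \<oplus>\<^bsub>M\<^esub> emb k v) k = v"
        using m k v kv zero by (simp add: A.co_add A.co_emb_same)
      then have "entry k j v = \<zero>\<^bsub>W\<^esub>"
        using all k by (cases "v = \<zero>\<^bsub>V\<^esub>") (auto simp: entry_def A.emb_zero h_zero)
      ultimately show "co' (h (m \<oplus>\<^bsub>M\<^esub> emb k v)) j = \<zero>\<^bsub>W\<^esub>"
        unfolding entry_def using m kv by (simp add: h_add B.co_add h_closed)
    qed
  qed
  then show ?thesis
    using assms(2) by blast
qed

end

section \<open>Composites of two homomorphisms\<close>

locale word_module_hom_pair =
  H: word_module_hom Q \<rho> C D M N V W n n' \<kappa> \<kappa>' \<tau> \<tau>' emb emb' co co' h +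
  G: word_module_hom Q \<rho> D C N M W V n' n \<kappa>' \<kappa> \<tau>' \<tau> emb' emb co' co g
  for Q :: "('v, 'e) pre_digraph" and \<rho> and C D
    and M :: "((('v, 'e) path \<Rightarrow>\<^sub>0 'k::field) set, 'm) module"
    and N :: "((('v, 'e) path \<Rightarrow>\<^sub>0 'k::field) set, 'm') module"
    and V :: "('w, 'z) ring_scheme" and W :: "('w', 'z') ring_scheme"
    and n n' \<kappa> \<kappa>' \<tau> \<tau>' emb emb' co co' h g
begin

text \<open>A nonzero coordinate of the composite passes through some \<open>j\<close> for which the
  entry from \<open>i\<close> to \<open>j\<close> and the entry back are both nonzero. Each of them
  is one of the simulations.\<close>

lemma sim_of_retraction:
  assumes i: "i \<in> word_index C" and v: "v \<in> carrier V" and nz: "co (g (h (emb i v))) i \<noteq> \<zero>\<^bsub>V\<^esub>"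
  obtains j where "j \<in> word_index D" "sim (letter_at C) (letter_at D) i j"
    "sim (letter_at D) (letter_at C) j i" "word_vertex Q D j = word_vertex Q C i"
proof -
  have hv: "h (emb i v) \<in> carrier N"
    by (intro H.h_closed H.A.emb_closed i v)
  obtain j where j: "j \<in> word_index D" "co' (h (emb i v)) j \<noteq> \<zero>\<^bsub>W\<^esub>"
    "G.entry j i (co' (h (emb i v)) j) \<noteq> \<zero>\<^bsub>V\<^esub>"
    using G.co_h_zero[OF hv, of i] nz by blast
  then have "H.entry i j v \<noteq> \<zero>\<^bsub>W\<^esub>"
    unfolding H.entry_def by blast
  with j show thesis
    using H.entry_sim[OF i v] G.entry_sim[OF j(1) H.B.co_closed[OF hv] j(3)] H.entry_vertex(2)[OF i v]
    by (intro that[of j]) auto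
qed

end

locale word_module_rigid_pair =
  word_module_hom_pair Q \<rho> C C M N V W n n \<kappa> \<kappa>' \<tau> \<tau>' emb emb' co co' h g
  for Q :: "('v, 'e) pre_digraph" and \<rho> and C
    and M :: "((('v, 'e) path \<Rightarrow>\<^sub>0 'k::field) set, 'm) module"
    and N :: "((('v, 'e) path \<Rightarrow>\<^sub>0 'k::field) set, 'm') module"
    and V :: "('w, 'z) ring_scheme" and W :: "('w', 'z') ring_scheme"
    and n \<kappa> \<kappa>' \<tau> \<tau>' emb emb' co co' h g +
  assumes rigid: "i \<in> word_index C \<Longrightarrow> j \<in> word_index C \<Longrightarrow> sim (letter_at C) (letter_at C) i j \<Longrightarrow>
    sim (letter_at C) (letter_at C) j i \<Longrightarrow> n dvd j - i"
begin

text \<open>A contribution through \<open>j\<close> makes \<open>i\<close> and \<open>j\<close>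
  simulate each other. By rigidity \<open>j\<close> is then congruent to \<open>i\<close>, and the
  contribution already belongs to the diagonal.\<close>

lemma diagonal_composition:
  assumes i: "i \<in> word_index C" and v: "v \<in> carrier V"
  shows "co (g (h (emb i v))) i = G.entry i i (H.entry i i v)"
proof -
  have hv: "h (emb i v) \<in> carrier N"
    by (intro H.h_closed H.A.emb_closed i v)
  define w where "w = H.entry i i v"
  have w: "w \<in> carrier W"
    unfolding w_def by (rule H.entry_closed[OF i v])
  have iw: "emb' i w \<in> carrier N"
    by (rule H.B.emb_closed[OF i w])
  \<comment> \<open>Subtracting the diagonal part kills the coordinates at all positions congruent
    to \<open>i\<close>; elsewhere the coordinates remain entries of \<open>h\<close>.\<close>
  define m where "m = h (emb i v) \<oplus>\<^bsub>N\<^esub> \<ominus>\<^bsub>N\<^esub> emb' i w"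
  have m: "m \<in> carrier N"
    unfolding m_def using hv iw by simp
  have co_m: "co' m j = H.entry i j v \<oplus>\<^bsub>W\<^esub> \<ominus>\<^bsub>W\<^esub> co' (emb' i w) j" for j
    unfolding m_def H.entry_def using hv iw by (simp add: H.B.co_add H.B.co_minus)
  have "co (g m) i = \<zero>\<^bsub>V\<^esub>"
  proof (rule G.co_h_zero[OF m], rule ccontr)
    fix j assume j: "j \<in> word_index C" and nz: "co' m j \<noteq> \<zero>\<^bsub>W\<^esub>" and g: "G.entry j i (co' m j) \<noteq> \<zero>\<^bsub>V\<^esub>"
    have "n dvd j - i"
    proof (rule ccontr)
      assume *: "\<not> n dvd j - i"
      then have "co' m j = H.entry i j v"
        unfolding co_m using H.B.co_emb_other[OF i w *] H.entry_closed[OF i v] by simp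
      then have "sim (letter_at C) (letter_at C) i j"
        using nz by (intro H.entry_sim[OF i v]) simp
      moreover have "sim (letter_at C) (letter_at C) j i"
        using G.entry_sim[OF j H.B.co_closed[OF m] g] .
      ultimately show False
        using rigid[OF i j] * by blast
    qed
    then obtain l where "j = i + n * l"
      using dvd_diff_obtain by blast
    moreover have "co' m i = \<zero>\<^bsub>W\<^esub>"
      unfolding co_m using H.B.co_emb_same[OF i w] w by (simp add: w_def H.B.V.r_neg)
    ultimately have "co' m j = \<zero>\<^bsub>W\<^esub>"
      using H.B.co_shift[OF m, of i l] H.B.twist_zero by simp
    with nz show False ..
  qed
  moreover have "m \<oplus>\<^bsub>N\<^esub> emb' i w = h (emb i v)"
    unfolding m_def using hv iw by (simp add: H.B.M.add.m_assoc H.B.M.l_neg)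
  then have "co (g (h (emb i v))) i = co (g m) i \<oplus>\<^bsub>V\<^esub> co (g (emb' i w)) i"
    using m iw by (metis G.h_add G.h_closed H.A.co_add)
  ultimately show ?thesis
    using H.A.co_closed[OF G.h_closed[OF iw]] by (simp add: G.entry_def w_def)
qed

end

section \<open>Entries along a diagonal\<close>

locale word_module_same =
  word_module_hom Q \<rho> C C M N V W n n \<kappa> \<kappa>' \<tau> \<tau>' emb emb' co co' h
  for Q :: "('v, 'e) pre_digraph" and \<rho> and C
    and M :: "((('v, 'e) path \<Rightarrow>\<^sub>0 'k::field) set, 'm) module"
    and N :: "((('v, 'e) path \<Rightarrow>\<^sub>0 'k::field) set, 'm') module"
    and V :: "('w, 'z) ring_scheme" and W :: "('w', 'z') ring_scheme"
    and n \<kappa> \<kappa>' \<tau> \<tau>' emb emb' co co' h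
begin

lemma entry_next:
  assumes per: "letter_at C (p + 1 + s) = letter_at C (p + 1)"
    and letter: "letter_at C (p + 1) \<noteq> None" and v: "v \<in> carrier V"
  shows "entry p (p + s) v = entry (p + 1) (p + 1 + s) v"
proof -
  obtain l where l: "letter_at C (p + 1) = Some l"
    using letter by blast
  have l': "letter_at C (p + s + 1) = Some l"
    using per l by (simp only: add.assoc add.commute[of s 1])
  have pos: "p + 1 - 1 = p" "p + s + 1 - 1 = p + s" "p + 1 + s = p + s + 1"
    by simp_all
  show ?thesis
  proof (cases l)
    case (Direct x)
    then have "step (letter_at C) x (p + 1) p" "step (letter_at C) x (p + s + 1) (p + s)"
      using l l' pos unfolding step_def by metis+
    from entry_step[OF this v] show ?thesis
      unfolding pos .
  next
    case (Inverse x)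
    then have "step (letter_at C) x p (p + 1)" "step (letter_at C) x (p + s) (p + s + 1)"
      using l l' unfolding step_def by metis+
    from entry_step[OF this v] show ?thesis
      unfolding pos ..
  qed
qed

text \<open>If translation by \<open>s\<close> preserves the letters, crossing a letter moves both
  indices at once and keeps the entry; consecutive letters lead from any position to any other.
  Offset 0 compares the diagonal entries, and multiples of the period give compatibility with
  \<open>T\<close>.\<close>

lemma entry_diagonal:
  assumes per: "\<And>t. letter_at C (t + s) = letter_at C t"
    and p: "p \<in> word_index C" and q: "q \<in> word_index C" and v: "v \<in> carrier V"
  shows "entry p (p + s) v = entry q (q + s) v"
proof -
  have up: "entry p (p + s) v = entry (p + int k) (p + int k + s) v"
    if "p \<in> word_index C" "p + int k \<in> word_index C" for p k
    using that
  proof (induction k)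
    case (Suc k)
    have between: "letter_at C (p + int k + 1) \<noteq> None"
      by (rule A.letter_between[OF Suc.prems]) simp_all
    have "p + int k \<in> word_index C"
      unfolding A.word_index_iff using between by (intro disjI2 disjI1)
    then have "entry p (p + s) v = entry (p + int k) (p + int k + s) v"
      by (rule Suc.IH[OF Suc.prems(1)])
    also have "\<dots> = entry (p + int k + 1) (p + int k + 1 + s) v"
      by (rule entry_next[OF per between v])
    also have "p + int k + 1 = p + int (Suc k)"
      by simp
    finally show ?case .
  qed simp
  show ?thesis
  proof (cases "p \<le> q")
    case True
    then have "p + int (nat (q - p)) = q"
      by simp
    then show ?thesis
      using up[of p "nat (q - p)"] p q by metis
  next
    case False
    then have "q + int (nat (p - q)) = p"
      by simp
    then show ?thesis
      using up[of q "nat (p - q)"] p q by metis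
  qed
qed

text \<open>Applying the power \<open>k\<close> of \<open>T\<close> to the coefficient at
  \<open>i\<close> gives the vector at \<open>i - n k\<close>. Sliding its entry at \<open>i\<close>
  along the diagonal yields the entry from \<open>i\<close> to \<open>i + n k\<close>, which is the
  twisted coordinate at \<open>i\<close>.\<close>

lemma entry_twist:
  assumes i: "i \<in> word_index C" and v: "v \<in> carrier V"
  shows "entry i i (\<tau> k v) = \<tau>' k (entry i i v)"
proof -
  have hv: "h (emb i v) \<in> carrier N"
    by (intro h_closed A.emb_closed i v)
  have i': "i + n * - k \<in> word_index C"
    by (rule A.index_periodic[OF i])
  have pos: "i + n * - k + n * k = i"
    by simp
  have "emb (i + n * - k) v = emb i (\<tau> k v)"
    using A.emb_shift[OF i v, of "- k"] unfolding minus_minus .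
  then have "entry i i (\<tau> k v) = entry (i + n * - k) i v"
    unfolding entry_def by (rule arg_cong[OF sym])
  also have "\<dots> = entry (i + n * - k) (i + n * - k + n * k) v"
    unfolding pos ..
  also have "\<dots> = entry i (i + n * k) v"
    by (rule entry_diagonal[OF A.letter_periodic i' i v])
  also have "\<dots> = \<tau>' k (entry i i v)"
    unfolding entry_def by (rule B.co_shift[OF hv])
  finally show ?thesis .
qed

end

text \<open>Linearity over \<open>k[T,T^{-1}]\<close>, tested on scalars and powers of
  \<open>T\<close>. In this form it also covers string modules, where the twists are trivial and it
  means linearity over \<open>k\<close>.\<close>

definition twisted_linear ::
  "('w, 'z) ring_scheme \<Rightarrow> ('w', 'z') ring_scheme \<Rightarrow> ('k \<Rightarrow> 'w \<Rightarrow> 'w) \<Rightarrow> ('k \<Rightarrow> 'w' \<Rightarrow> 'w') \<Rightarrow>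
   (int \<Rightarrow> 'w \<Rightarrow> 'w) \<Rightarrow> (int \<Rightarrow> 'w' \<Rightarrow> 'w') \<Rightarrow> ('w \<Rightarrow> 'w') \<Rightarrow> bool" where
  "twisted_linear V W \<kappa> \<kappa>' \<tau> \<tau>' a \<longleftrightarrow>
     (\<forall>v\<in>carrier V. a v \<in> carrier W) \<and>
     (\<forall>v\<in>carrier V. \<forall>w\<in>carrier V. a (v \<oplus>\<^bsub>V\<^esub> w) = a v \<oplus>\<^bsub>W\<^esub> a w) \<and>
     (\<forall>v\<in>carrier V. \<forall>c. a (\<kappa> c v) = \<kappa>' c (a v)) \<and>
     (\<forall>v\<in>carrier V. \<forall>k. a (\<tau> k v) = \<tau>' k (a v))"

lemma (in word_module_same) twisted_linear_entry:
  assumes i: "i \<in> word_index C"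
  shows "twisted_linear V W \<kappa> \<kappa>' \<tau> \<tau>' (entry i i)"
  unfolding twisted_linear_def
  by (intro conjI ballI allI entry_closed entry_add entry_twist entry_scalar i refl)

sublocale word_module_rigid_pair \<subseteq> S: word_module_same Q \<rho> C M N V W n \<kappa> \<kappa>' \<tau> \<tau>' emb emb' co co' h
  by unfold_locales

lemma (in word_module_rigid_pair) coefficient_iso:
  assumes inverse: "\<And>m. m \<in> carrier M \<Longrightarrow> g (h m) = m" "\<And>m. m \<in> carrier N \<Longrightarrow> h (g m) = m"
    and i: "i \<in> word_index C"
  shows "\<exists>a. twisted_linear V W \<kappa> \<kappa>' \<tau> \<tau>' a \<and> bij_betw a (carrier V) (carrier W)"
proof (intro exI conjI)
  \<comment> \<open>Exchanging the roles of \<open>h\<close> and \<open>g\<close> provides the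
    second inverse law for the diagonal entries.\<close>
  interpret swap: word_module_rigid_pair Q \<rho> C N M W V n \<kappa>' \<kappa> \<tau>' \<tau> emb' emb co' co g h
    by unfold_locales (rule rigid)
  show "twisted_linear V W \<kappa> \<kappa>' \<tau> \<tau>' (H.entry i i)"
    by (rule S.twisted_linear_entry[OF i])
  show "bij_betw (H.entry i i) (carrier V) (carrier W)"
  proof (rule bij_betwI[where g = "G.entry i i"])
    fix v assume v: "v \<in> carrier V"
    show "G.entry i i (H.entry i i v) = v"
      using diagonal_composition[OF i v] inverse(1)[OF H.A.emb_closed[OF i v]] H.A.co_emb_same[OF i v] by simp
  next
    fix w assume w: "w \<in> carrier W"
    show "H.entry i i (G.entry i i w) = w"
      using swap.diagonal_composition[OF i w] inverse(2)[OF H.B.emb_closed[OF i w]] H.B.co_emb_same[OF i w] by simp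
  qed (use H.entry_closed[OF i] G.entry_closed[OF i] in auto)
qed

text \<open>Uniqueness of the decomposition makes the component in \<open>X\<close> a linear
  function. Direct sums are thereby translated into projections, to which the calculus of entries
  applies.\<close>

lemma (in left_module) complement_projection:
  assumes X: "submodule X A M" and Y: "submodule Y A M"
    and inter: "X \<inter> Y = {\<zero>}" and sum: "X <+> Y = carrier M"
  obtains e where "e \<in> linear_maps A M M" "\<And>x y. x \<in> X \<Longrightarrow> y \<in> Y \<Longrightarrow> e (x \<oplus> y) = x"
proof -
  interpret X: submodule X A M by fact
  interpret Y: submodule Y A M by fact
  have sub: "x \<in> X \<Longrightarrow> x \<in> carrier M" "y \<in> Y \<Longrightarrow> y \<in> carrier M" for x y
    using X.subset Y.subset by auto
  have unique: "x = x'"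
    if x: "x \<in> X" "x' \<in> X" and y: "y \<in> Y" "y' \<in> Y" and eq: "x \<oplus> y = x' \<oplus> y'" for x x' y y'
  proof -
    note c = sub(1)[OF x(1)] sub(1)[OF x(2)] sub(2)[OF y(1)] sub(2)[OF y(2)]
    have "x \<oplus> \<ominus> x' = y' \<oplus> \<ominus> y"
    proof -
      have "x \<oplus> \<ominus> x' = (x \<oplus> y) \<oplus> (\<ominus> y \<oplus> \<ominus> x')"
        using c by (simp add: a_assoc r_neg2)
      also have "\<dots> = y' \<oplus> \<ominus> y"
        unfolding eq using c
        by (simp add: a_comm[of x' y'] a_comm[of "\<ominus> y" "\<ominus> x'"] a_assoc r_neg2)
      finally show ?thesis .
    qed
    moreover have "x \<oplus> \<ominus> x' \<in> X"
      using X.m_closed[OF x(1) X.m_inv_closed[OF x(2)]] by (simp add: a_inv_def)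
    moreover have "y' \<oplus> \<ominus> y \<in> Y"
      using Y.m_closed[OF y(2) Y.m_inv_closed[OF y(1)]] by (simp add: a_inv_def)
    ultimately have "x \<oplus> \<ominus> x' = \<zero>"
      using inter by (metis IntI singletonD)
    then show ?thesis
      using c by (metis minus_equality minus_minus a_inv_closed)
  qed
  define e where "e m = (THE x. x \<in> X \<and> (\<exists>y\<in>Y. m = x \<oplus> y))" for m
  have e: "e (x \<oplus> y) = x" if "x \<in> X" "y \<in> Y" for x y
    unfolding e_def using that unique by (intro the_equality) blast+
  have decompose: "\<exists>x\<in>X. \<exists>y\<in>Y. m = x \<oplus> y" if "m \<in> carrier M" for m
    using that unfolding sum[symmetric] set_add_def' by auto
  have "e \<in> linear_maps A M M"
  proof (rule linear_mapsI)
    fix m assume "m \<in> carrier M"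
    then show "e m \<in> carrier M"
      using decompose e sub by metis
  next
    fix m m' assume "m \<in> carrier M" "m' \<in> carrier M"
    then obtain x y x' y' where m: "x \<in> X" "y \<in> Y" "m = x \<oplus> y" and m': "x' \<in> X" "y' \<in> Y" "m' = x' \<oplus> y'"
      using decompose by metis
    have "m \<oplus> m' = (x \<oplus> x') \<oplus> (y \<oplus> y')"
      using m m' sub by (simp add: a_ac)
    moreover have "x \<oplus> x' \<in> X" "y \<oplus> y' \<in> Y"
      using X.m_closed[of x x'] Y.m_closed[of y y'] m m' by simp_all
    ultimately show "e (m \<oplus> m') = e m \<oplus> e m'"
      using e m m' by simp
  next
    fix a m assume a: "a \<in> carrier A" and "m \<in> carrier M"
    then obtain x y where m: "x \<in> X" "y \<in> Y" "m = x \<oplus> y"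
      using decompose by metis
    then have "a \<odot> m = a \<odot> x \<oplus> a \<odot> y"
      using a sub by (simp add: smult_r_distr)
    then show "e (a \<odot> m) = a \<odot> e m"
      using e m X.smult_closed[OF a m(1)] Y.smult_closed[OF a m(2)] by simp
  qed
  then show thesis
    using e by (rule that)
qed

text \<open>At a support position \<open>g\<close> the coordinate of \<open>m = e m\<close> comes
  from a support position \<open>i\<close> with nonzero entry, so \<open>i\<close> simulates
  \<open>g\<close>. If \<open>g\<close> also simulated \<open>i\<close>, the two would be congruent
  and the entry a twist of a diagonal one, which is zero. Every support position thus has a strictly
  smaller one, against finiteness modulo \<open>n\<close>.\<close>

lemma (in word_module) fixed_point_zero:
  assumes rigid: "\<And>i j. i \<in> word_index C \<Longrightarrow> j \<in> word_index C \<Longrightarrow> sim (letter_at C) (letter_at C) i j \<Longrightarrow>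
      sim (letter_at C) (letter_at C) j i \<Longrightarrow> n dvd j - i"
    and e: "e \<in> linear_maps (bound_path_algebra Q \<rho>) M M"
    and diag: "\<And>i v. i \<in> word_index C \<Longrightarrow> v \<in> carrier V \<Longrightarrow> co (e (emb i v)) i = \<zero>\<^bsub>V\<^esub>"
    and m: "m \<in> carrier M" and fixed: "e m = m"
  shows "m = \<zero>\<^bsub>M\<^esub>"
proof (rule ccontr)
  interpret E: word_module_hom Q \<rho> C C M M V V n n \<kappa> \<kappa> \<tau> \<tau> emb emb co co e
    by unfold_locales (rule e)
  let ?sim = "sim (letter_at C) (letter_at C)"
  define S where "S = {i \<in> word_index C. co m i \<noteq> \<zero>\<^bsub>V\<^esub>}"
  assume "m \<noteq> \<zero>\<^bsub>M\<^esub>"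
  then have "S \<noteq> {}"
    using co_eq_zeroD[OF m] unfolding S_def by blast
  obtain F where F: "finite F" "\<And>i. co m i \<noteq> \<zero>\<^bsub>V\<^esub> \<Longrightarrow> \<exists>f\<in>F. n dvd i - f"
    using finite_support[OF m] by blast
  \<comment> \<open>\<open>F\<close> merely meets the residue classes of the support. It is replaced
    by representatives inside the support, where the descent can be repeated.\<close>
  define r where "r f = (SOME i. i \<in> S \<and> n dvd i - f)" for f
  define G where "G = r ` {f \<in> F. \<exists>i\<in>S. n dvd i - f}"
  have r: "r f \<in> S \<and> n dvd r f - f" if "i \<in> S" "n dvd i - f" for f i
    unfolding r_def by (rule someI[of _ i]) (use that in blast)
  have "finite G"
    unfolding G_def using F(1) by simp
  have "G \<subseteq> S"
    unfolding G_def using r by blast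
  have reps: "\<exists>g\<in>G. n dvd i - g" if "i \<in> S" for i
  proof -
    from that F(2) obtain f where f: "f \<in> F" "n dvd i - f"
      unfolding S_def by blast
    then have "r f \<in> G" "n dvd r f - f"
      using that r unfolding G_def by blast+
    moreover from f(2) this(2) have "n dvd (i - f) - (r f - f)"
      by (rule dvd_diff)
    ultimately show ?thesis
      by auto
  qed
  have pred: "\<exists>g'\<in>G. ?sim g' g \<and> \<not> ?sim g g'" if "g \<in> G" for g
  proof -
    have g: "g \<in> word_index C" "co (e m) g \<noteq> \<zero>\<^bsub>V\<^esub>"
      using that \<open>G \<subseteq> S\<close> unfolding fixed S_def by blast+
    obtain i where i: "i \<in> word_index C" "co m i \<noteq> \<zero>\<^bsub>V\<^esub>" and nz: "E.entry i g (co m i) \<noteq> \<zero>\<^bsub>V\<^esub>"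
      using E.co_h_zero[OF m, of g] g(2) by blast
    note v = co_closed[OF m, of i]
    obtain g' where g': "g' \<in> G" "n dvd i - g'"
      using reps[of i] i unfolding S_def by blast
    then obtain k where k: "i = g' + n * k"
      using dvd_diff_obtain by blast
    have "?sim i g"
      by (rule E.entry_sim[OF i(1) v nz])
    \<comment> \<open>The position \<open>i\<close> may lie outside the finite set \<open>G\<close>;
      invariance under translation by the period moves it to its representative.\<close>
    then have "?sim (i + n * - k) (g + n * 0)"
      by (rule sim_shift) (simp_all only: letter_periodic)
    then have "?sim g' g"
      unfolding k by simp
    moreover have "\<not> ?sim g g'"
    proof
      assume "?sim g g'"
      then have "?sim (g + n * 0) (g' + n * k)"
        by (rule sim_shift) (simp_all only: letter_periodic)
      then have "?sim g i"
        unfolding k by simp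
      then have "n dvd g - i"
        using rigid[OF i(1) g(1)] \<open>?sim i g\<close> by blast
      then obtain l where "g = i + n * l"
        using dvd_diff_obtain by blast
      then have "E.entry i g (co m i) = \<tau> l (co (e (emb i (co m i))) i)"
        unfolding E.entry_def using co_shift[OF E.h_closed[OF emb_closed[OF i(1) v]]] by simp
      then have "E.entry i g (co m i) = \<zero>\<^bsub>V\<^esub>"
        using diag[OF i(1) v] twist_zero by simp
      with nz show False ..
    qed
    ultimately show ?thesis
      using g'(1) by blast
  qed
  have "G \<noteq> {}"
    using \<open>S \<noteq> {}\<close> reps by blast
  have "asymp_on G (\<lambda>x y. ?sim x y \<and> \<not> ?sim y x)"
    by (auto intro: asymp_onI)
  moreover have "transp_on G (\<lambda>x y. ?sim x y \<and> \<not> ?sim y x)"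
    by (rule transp_onI) (blast intro: sim_trans)
  ultimately obtain g where "g \<in> G" "\<And>x. x \<in> G \<Longrightarrow> x \<noteq> g \<Longrightarrow> \<not> (?sim x g \<and> \<not> ?sim g x)"
    using Finite_Set.bex_min_element[OF \<open>finite G\<close> _ _ \<open>G \<noteq> {}\<close>] by blast
  then show False
    using pred by blast
qed

text \<open>Let \<open>e\<close> and \<open>f\<close> be the projections onto \<open>X\<close> and
  \<open>Y\<close>. The diagonal of \<open>e\<close> is an idempotent on coefficients, so it is zero
  or the identity. As \<open>e + f\<close> is the identity, one of the projections has zero
  diagonal; it fixes its image, which must therefore vanish.\<close>

lemma (in word_module) indecomposableI:
  assumes rigid: "\<And>i j. i \<in> word_index C \<Longrightarrow> j \<in> word_index C \<Longrightarrow> sim (letter_at C) (letter_at C) i j \<Longrightarrow>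
      sim (letter_at C) (letter_at C) j i \<Longrightarrow> n dvd j - i"
    and nonzero: "carrier V \<noteq> {\<zero>\<^bsub>V\<^esub>}" and i: "i \<in> word_index C"
    and idempotents: "\<And>a. twisted_linear V V \<kappa> \<kappa> \<tau> \<tau> a \<Longrightarrow> (\<And>v. v \<in> carrier V \<Longrightarrow> a (a v) = a v) \<Longrightarrow>
      (\<forall>v\<in>carrier V. a v = \<zero>\<^bsub>V\<^esub>) \<or> (\<forall>v\<in>carrier V. a v = v)"
  shows "indecomposable (bound_path_algebra Q \<rho>) M"
  unfolding indecomposable_def
proof (intro conjI allI impI)
  obtain v where v: "v \<in> carrier V" "v \<noteq> \<zero>\<^bsub>V\<^esub>"
    using nonzero V.zero_closed by blast
  then have "emb i v \<noteq> \<zero>\<^bsub>M\<^esub>"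
    using co_emb_same[OF i v(1)] co_zero[of i] by metis
  then show "carrier M \<noteq> {\<zero>\<^bsub>M\<^esub>}"
    using emb_closed[OF i v(1)] by blast
next
  fix X Y
  assume "submodule X (bound_path_algebra Q \<rho>) M \<and> submodule Y (bound_path_algebra Q \<rho>) M \<and>
    X \<inter> Y = {\<zero>\<^bsub>M\<^esub>} \<and> X <+>\<^bsub>M\<^esub> Y = carrier M"
  then have X: "submodule X (bound_path_algebra Q \<rho>) M" and Y: "submodule Y (bound_path_algebra Q \<rho>) M"
    and XY: "X \<inter> Y = {\<zero>\<^bsub>M\<^esub>}" "X <+>\<^bsub>M\<^esub> Y = carrier M"
    by blast+
  have sub: "x \<in> X \<Longrightarrow> x \<in> carrier M" "y \<in> Y \<Longrightarrow> y \<in> carrier M" for x y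
    using subgroup.mem_carrier[OF submodule.axioms(1)[OF X]] subgroup.mem_carrier[OF submodule.axioms(1)[OF Y]]
    by simp_all
  have zero: "\<zero>\<^bsub>M\<^esub> \<in> X" "\<zero>\<^bsub>M\<^esub> \<in> Y"
    using XY(1) by blast+
  have "Y <+>\<^bsub>M\<^esub> X = carrier M"
    unfolding XY(2)[symmetric] set_add_def' using sub M.a_comm by (auto; metis)
  then obtain f where f: "f \<in> linear_maps (bound_path_algebra Q \<rho>) M M"
    "\<And>x y. y \<in> Y \<Longrightarrow> x \<in> X \<Longrightarrow> f (y \<oplus>\<^bsub>M\<^esub> x) = y"
    using M.complement_projection[OF Y X] XY(1) by (metis inf_commute)
  obtain e where e: "e \<in> linear_maps (bound_path_algebra Q \<rho>) M M"
    "\<And>x y. x \<in> X \<Longrightarrow> y \<in> Y \<Longrightarrow> e (x \<oplus>\<^bsub>M\<^esub> y) = x"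
    using M.complement_projection[OF X Y XY] by metis
  have decompose: "\<exists>x\<in>X. \<exists>y\<in>Y. m = x \<oplus>\<^bsub>M\<^esub> y" if "m \<in> carrier M" for m
    using that unfolding XY(2)[symmetric] set_add_def' by auto
  have eX: "e x = x" if "x \<in> X" for x
    using e(2)[OF that zero(2)] sub(1)[OF that] by simp
  have fY: "f y = y" if "y \<in> Y" for y
    using f(2)[OF that zero(1)] sub(2)[OF that] by simp
  have ee: "e (e m) = e m" and ef: "e m \<oplus>\<^bsub>M\<^esub> f m = m" if "m \<in> carrier M" for m
  proof -
    obtain x y where m: "x \<in> X" "y \<in> Y" "m = x \<oplus>\<^bsub>M\<^esub> y"
      using decompose[OF \<open>m \<in> carrier M\<close>] by blast
    then show "e (e m) = e m"
      using e(2) eX by simp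
    have "f m = y"
      using f(2)[OF m(2,1)] m(3) M.a_comm[OF sub(1)[OF m(1)] sub(2)[OF m(2)]] by simp
    then show "e m \<oplus>\<^bsub>M\<^esub> f m = m"
      using e(2)[OF m(1,2)] m(3) by simp
  qed
  interpret E: word_module_rigid_pair Q \<rho> C M M V V n \<kappa> \<kappa> \<tau> \<tau> emb emb co co e e
    by unfold_locales (use e rigid in auto)
  interpret F: word_module_same Q \<rho> C M M V V n \<kappa> \<kappa> \<tau> \<tau> emb emb co co f
    by unfold_locales (rule f)
  have "E.H.entry i i (E.H.entry i i v) = E.H.entry i i v" if v: "v \<in> carrier V" for v
    using E.diagonal_composition[OF i v] ee[OF emb_closed[OF i v]] by (simp add: E.H.entry_def)
  then consider "\<forall>v\<in>carrier V. E.H.entry i i v = \<zero>\<^bsub>V\<^esub>" | "\<forall>v\<in>carrier V. E.H.entry i i v = v"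
    using idempotents[OF E.S.twisted_linear_entry[OF i]] by blast
  then show "X = {\<zero>\<^bsub>M\<^esub>} \<or> Y = {\<zero>\<^bsub>M\<^esub>}"
  proof cases
    case 1
    \<comment> \<open>With offset 0 the entry at the one position \<open>i\<close> determines all
      diagonal entries.\<close>
    have diag: "co (e (emb j v)) j = \<zero>\<^bsub>V\<^esub>" if j: "j \<in> word_index C" and v: "v \<in> carrier V" for j v
      using E.S.entry_diagonal[of 0 j i v] i j v 1 by (simp add: E.H.entry_def)
    have "x = \<zero>\<^bsub>M\<^esub>" if x: "x \<in> X" for x
      using fixed_point_zero[OF rigid e(1) diag sub(1)[OF x] eX[OF x]] .
    then show ?thesis
      using zero by blast
  next
    case 2
    have diag_i: "F.entry i i v = \<zero>\<^bsub>V\<^esub>" if v: "v \<in> carrier V" for v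
    proof -
      note iv = emb_closed[OF i v]
      have "co (e (emb i v)) i \<oplus>\<^bsub>V\<^esub> co (f (emb i v)) i = v"
        using arg_cong[OF ef[OF iv], of "\<lambda>m. co m i"] co_emb_same[OF i v] co_add[OF E.H.h_closed[OF iv] F.h_closed[OF iv]]
        by simp
      then have "v \<oplus>\<^bsub>V\<^esub> F.entry i i v = v"
        using 2 v by (simp add: E.H.entry_def F.entry_def)
      then show ?thesis
        using F.entry_closed[OF i v] v by (metis V.add.l_cancel_one')
    qed
    have diag: "co (f (emb j v)) j = \<zero>\<^bsub>V\<^esub>" if j: "j \<in> word_index C" and v: "v \<in> carrier V" for j v
      using F.entry_diagonal[of 0 j i v] i j v diag_i[OF v] by (simp add: F.entry_def)
    have "y = \<zero>\<^bsub>M\<^esub>" if y: "y \<in> Y" for y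
      using fixed_point_zero[OF rigid f(1) diag sub(2)[OF y] fY[OF y]] .
    then show ?thesis
      using zero by blast
  qed
qed

text \<open>
  An alignment \<open>i \<mapsto> s + \<epsilon> i\<close> of the words \<open>C\<close> and \<open>D\<close> together with an isomorphism \<open>\<theta>\<close> of the
  coefficients; \<open>\<epsilon> = -1\<close> reverses the word and replaces \<open>T\<close> by its inverse.
\<close>

locale word_module_transport =
  A: word_module Q \<rho> C M V n \<kappa> \<tau> emb co + B: word_module Q \<rho> D N W n \<kappa>' \<tau>' emb' co'
  for Q :: "('v, 'e) pre_digraph" and \<rho> and C D
    and M :: "((('v, 'e) path \<Rightarrow>\<^sub>0 'k::field) set, 'm) module"
    and N :: "((('v, 'e) path \<Rightarrow>\<^sub>0 'k::field) set, 'm') module"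
    and V :: "('w, 'z) ring_scheme" and W :: "('w', 'z') ring_scheme"
    and n \<kappa> \<kappa>' \<tau> \<tau>' emb emb' co co' +
  fixes s \<epsilon> :: int and \<theta> :: "'w \<Rightarrow> 'w'"
  assumes sign: "\<epsilon> * \<epsilon> = 1"
    and step_iff: "step (letter_at C) x i i' \<longleftrightarrow> step (letter_at D) x (s + \<epsilon> * i) (s + \<epsilon> * i')"
    and index_iff: "i \<in> word_index C \<longleftrightarrow> s + \<epsilon> * i \<in> word_index D"
    and vertex_eq: "i \<in> word_index C \<Longrightarrow> word_vertex Q D (s + \<epsilon> * i) = word_vertex Q C i"
    and theta_bij: "bij_betw \<theta> (carrier V) (carrier W)"
    and theta_add: "v \<in> carrier V \<Longrightarrow> w \<in> carrier V \<Longrightarrow> \<theta> (v \<oplus>\<^bsub>V\<^esub> w) = \<theta> v \<oplus>\<^bsub>W\<^esub> \<theta> w"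
    and theta_scalar: "v \<in> carrier V \<Longrightarrow> \<theta> (\<kappa> c v) = \<kappa>' c (\<theta> v)"
    and theta_twist: "v \<in> carrier V \<Longrightarrow> \<theta> (\<tau> k v) = \<tau>' (\<epsilon> * k) (\<theta> v)"
begin

definition pos :: "int \<Rightarrow> int" where
  "pos i = s + \<epsilon> * i"

lemma pos_surj: "\<exists>i. j = pos i"
proof -
  have "j = pos (\<epsilon> * (j - s))"
    unfolding pos_def mult.assoc[symmetric] sign by simp
  then show ?thesis ..
qed

lemma theta_closed: "v \<in> carrier V \<Longrightarrow> \<theta> v \<in> carrier W"
  using theta_bij by (auto simp: bij_betw_def)

lemma theta_zero: "\<theta> \<zero>\<^bsub>V\<^esub> = \<zero>\<^bsub>W\<^esub>"
  using theta_add[of "\<zero>\<^bsub>V\<^esub>" "\<zero>\<^bsub>V\<^esub>"] by (intro B.double_zero) (auto intro: theta_closed)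

lemma theta_inject: "v \<in> carrier V \<Longrightarrow> w \<in> carrier V \<Longrightarrow> \<theta> v = \<theta> w \<Longrightarrow> v = w"
  using theta_bij by (auto simp: bij_betw_def inj_on_def)

lemma dvd_pos: "n dvd pos i - pos j \<longleftrightarrow> n dvd i - j"
proof -
  have 1: "pos i - pos j = \<epsilon> * (i - j)" and 2: "i - j = \<epsilon> * (pos i - pos j)"
    unfolding pos_def by (simp_all add: algebra_simps) (simp add: mult.assoc[symmetric] sign)
  show ?thesis
    using dvd_mult[of n "i - j" \<epsilon>] dvd_mult[of n "pos i - pos j" \<epsilon>] unfolding 1[symmetric] 2[symmetric] by blast
qed

lemma co_emb_pos:
  assumes j: "j \<in> word_index C" and v: "v \<in> carrier V"
  shows "co' (emb' (pos j) (\<theta> v)) (pos i) = \<theta> (co (emb j v) i)"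
proof -
  have j': "pos j \<in> word_index D"
    using j index_iff unfolding pos_def by blast
  show ?thesis
  proof (cases "n dvd i - j")
    case True
    then obtain k where k: "i = j + n * k"
      using dvd_diff_obtain by blast
    then have "pos i = pos j + n * (\<epsilon> * k)"
      unfolding pos_def by (simp add: algebra_simps)
    then show ?thesis
      unfolding k using B.co_emb_shift[OF j' theta_closed[OF v]] A.co_emb_shift[OF j v] theta_twist[OF v] k by simp
  next
    case False
    then show ?thesis
      using B.co_emb_other[OF j' theta_closed[OF v]] A.co_emb_other[OF j v] dvd_pos theta_zero by simp
  qed
qed

text \<open>The isomorphism is introduced as a relation between coordinates, since the locale gives
  no expansion of an element as a function. Totality comes from the expansion induction, and
  functionality from the fact that coordinates determine an element.\<close>

definition related :: "'m \<Rightarrow> 'm' \<Rightarrow> bool" where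
  "related m m' \<longleftrightarrow> m \<in> carrier M \<and> m' \<in> carrier N \<and> (\<forall>i. co' m' (pos i) = \<theta> (co m i))"

lemma related_zero: "related \<zero>\<^bsub>M\<^esub> \<zero>\<^bsub>N\<^esub>"
  unfolding related_def by (simp add: theta_zero)

lemma related_add: "related m m' \<Longrightarrow> related x x' \<Longrightarrow> related (m \<oplus>\<^bsub>M\<^esub> x) (m' \<oplus>\<^bsub>N\<^esub> x')"
  unfolding related_def by (simp add: A.co_add B.co_add theta_add A.co_closed)

lemma related_emb:
  assumes "j \<in> word_index C" "v \<in> carrier V"
  shows "related (emb j v) (emb' (pos j) (\<theta> v))"
  using assms co_emb_pos index_iff A.emb_closed B.emb_closed theta_closed unfolding related_def pos_def by simp

lemma related_right_unique: "related m m' \<Longrightarrow> related m m'' \<Longrightarrow> m' = m''"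
  unfolding related_def by (intro B.co_inject) (auto, metis pos_surj)

lemma related_left_unique: "related m m' \<Longrightarrow> related x m' \<Longrightarrow> m = x"
  unfolding related_def by (intro A.co_inject) (auto, metis theta_inject A.co_closed)

lemma related_total: "m \<in> carrier M \<Longrightarrow> \<exists>m'. related m m'"
  by (rule A.expand_induct[where m = m]) (blast intro: related_zero related_add related_emb)+

lemma related_onto:
  assumes "m' \<in> carrier N"
  shows "\<exists>m. related m m'"
  using assms
proof (rule B.expand_induct)
  fix m' j w assume "\<exists>m. related m m'" "j \<in> word_index D" "w \<in> carrier W"
  moreover obtain i where i: "j = pos i"
    using pos_surj by blast
  moreover have "w \<in> \<theta> ` carrier V"
    using \<open>w \<in> carrier W\<close> theta_bij by (simp add: bij_betw_def)
  moreover have "i \<in> word_index C"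
    using \<open>j \<in> word_index D\<close> index_iff unfolding i pos_def by blast
  ultimately show "\<exists>m. related m (m' \<oplus>\<^bsub>N\<^esub> emb' j w)"
    using related_add related_emb by blast
qed (use related_zero in blast)

lemma related_smult:
  assumes "L \<in> carrier (bound_path_algebra Q \<rho>)"
  shows "\<forall>m m'. related m m' \<longrightarrow> related (L \<odot>\<^bsub>M\<^esub> m) (L \<odot>\<^bsub>N\<^esub> m')"
  using assms
proof (induction rule: A.bound_path_algebra_induct)
  case zero
  have z: "\<zero>\<^bsub>bound_path_algebra Q \<rho>\<^esub> \<in> carrier (bound_path_algebra Q \<rho> :: (('v, 'e) path \<Rightarrow>\<^sub>0 'k) set ring)"
    unfolding A.zero_bound_path_algebra by (rule A.bound_class_closed) simp
  have zz: "\<zero>\<^bsub>bound_path_algebra Q \<rho>\<^esub> \<oplus>\<^bsub>bound_path_algebra Q \<rho>\<^esub> \<zero>\<^bsub>bound_path_algebra Q \<rho>\<^esub> =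
      (\<zero>\<^bsub>bound_path_algebra Q \<rho>\<^esub> :: (('v, 'e) path \<Rightarrow>\<^sub>0 'k) set)"
    unfolding A.zero_bound_path_algebra by (subst A.add_bound_class) simp_all
  have "\<zero>\<^bsub>bound_path_algebra Q \<rho>\<^esub> \<odot>\<^bsub>M\<^esub> m = \<zero>\<^bsub>M\<^esub>" if "m \<in> carrier M" for m
    using A.M.smult_l_distr[OF z z that] A.M.smult_closed[OF z that] unfolding zz
    by (metis A.M.add.l_cancel_one')
  moreover have "\<zero>\<^bsub>bound_path_algebra Q \<rho>\<^esub> \<odot>\<^bsub>N\<^esub> m = \<zero>\<^bsub>N\<^esub>" if "m \<in> carrier N" for m
    using B.M.smult_l_distr[OF z z that] B.M.smult_closed[OF z that] unfolding zz
    by (metis B.M.add.l_cancel_one')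
  ultimately show ?case
    using related_zero unfolding related_def by simp
next
  case (vertex u c)
  show ?case
  proof (intro allI impI)
    fix m m' assume rel: "related m m'"
    then have m: "m \<in> carrier M" "m' \<in> carrier N" "\<And>i. co' m' (pos i) = \<theta> (co m i)"
      unfolding related_def by blast+
    have closed: "vertex_class Q \<rho> u c \<odot>\<^bsub>M\<^esub> m \<in> carrier M" "vertex_class Q \<rho> u c \<odot>\<^bsub>N\<^esub> m' \<in> carrier N"
      using m by (simp_all add: A.M.smult_closed B.M.smult_closed A.vertex_class_closed vertex)
    have "co' (vertex_class Q \<rho> u c \<odot>\<^bsub>N\<^esub> m') (pos i) = \<theta> (co (vertex_class Q \<rho> u c \<odot>\<^bsub>M\<^esub> m) i)" for i
    proof (cases "i \<in> word_index C")
      case True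
      moreover from this have "pos i \<in> word_index D" "word_vertex Q D (pos i) = word_vertex Q C i"
        using index_iff vertex_eq unfolding pos_def by blast+
      ultimately show ?thesis
        using A.co_vertex[OF vertex _ m(1)] B.co_vertex[OF vertex _ m(2)] m(3)
        by (simp add: theta_zero theta_scalar A.co_closed[OF m(1)])
    next
      case False
      moreover from this have "pos i \<notin> word_index D"
        using index_iff unfolding pos_def by blast
      ultimately show ?thesis
        using A.co_outside[OF closed(1)] B.co_outside[OF closed(2)] by (simp add: theta_zero)
    qed
    with closed show "related (vertex_class Q \<rho> u c \<odot>\<^bsub>M\<^esub> m) (vertex_class Q \<rho> u c \<odot>\<^bsub>N\<^esub> m')"
      unfolding related_def by blast
  qed
next
  case (arrow x)
  show ?case
  proof (intro allI impI)
    fix m m' assume rel: "related m m'"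
    then have m: "m \<in> carrier M" "m' \<in> carrier N" "\<And>i. co' m' (pos i) = \<theta> (co m i)"
      unfolding related_def by blast+
    have closed: "arrow_class Q \<rho> x \<odot>\<^bsub>M\<^esub> m \<in> carrier M" "arrow_class Q \<rho> x \<odot>\<^bsub>N\<^esub> m' \<in> carrier N"
      using m by (simp_all add: A.M.smult_closed B.M.smult_closed A.arrow_class_closed arrow)
    have "co' (arrow_class Q \<rho> x \<odot>\<^bsub>N\<^esub> m') (pos i) = \<theta> (co (arrow_class Q \<rho> x \<odot>\<^bsub>M\<^esub> m) i)" for i
    proof (cases "\<exists>j. step (letter_at C) x j i")
      case True
      then obtain j where j: "step (letter_at C) x j i"
        by blast
      then have "step (letter_at D) x (pos j) (pos i)"
        using step_iff unfolding pos_def by blast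
      then show ?thesis
        using A.co_arrow[OF j m(1)] B.co_arrow[OF _ m(2)] m(3) by simp
    next
      case False
      then have "\<nexists>k. step (letter_at D) x k (pos i)"
        using step_iff pos_surj unfolding pos_def by metis
      then show ?thesis
        using A.co_arrow_zero[OF arrow False m(1)] B.co_arrow_zero[OF arrow _ m(2)] by (simp add: theta_zero)
    qed
    with closed show "related (arrow_class Q \<rho> x \<odot>\<^bsub>M\<^esub> m) (arrow_class Q \<rho> x \<odot>\<^bsub>N\<^esub> m')"
      unfolding related_def by blast
  qed
next
  case (add L L')
  show ?case
  proof (intro allI impI)
    fix m m' assume rel: "related m m'"
    then have m: "m \<in> carrier M" "m' \<in> carrier N"
      unfolding related_def by blast+
    show "related ((L \<oplus>\<^bsub>bound_path_algebra Q \<rho>\<^esub> L') \<odot>\<^bsub>M\<^esub> m) ((L \<oplus>\<^bsub>bound_path_algebra Q \<rho>\<^esub> L') \<odot>\<^bsub>N\<^esub> m')"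
      unfolding A.M.smult_l_distr[OF add(1,2) m(1)] B.M.smult_l_distr[OF add(1,2) m(2)]
      using add rel by (intro related_add) blast+
  qed
next
  case (mult L L')
  show ?case
  proof (intro allI impI)
    fix m m' assume rel: "related m m'"
    then have m: "m \<in> carrier M" "m' \<in> carrier N"
      unfolding related_def by blast+
    show "related ((L \<otimes>\<^bsub>bound_path_algebra Q \<rho>\<^esub> L') \<odot>\<^bsub>M\<^esub> m) ((L \<otimes>\<^bsub>bound_path_algebra Q \<rho>\<^esub> L') \<odot>\<^bsub>N\<^esub> m')"
      unfolding A.M.smult_assoc[OF mult(1,2) m(1)] B.M.smult_assoc[OF mult(1,2) m(2)]
      using mult rel by blast
  qed
qed

lemma isomorphic: "module_isomorphic (bound_path_algebra Q \<rho>) M N"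
proof -
  define h where "h m = (THE m'. related m m')" for m
  have h: "related m (h m)" if "m \<in> carrier M" for m
    unfolding h_def using related_total[OF that] related_right_unique by (blast intro: theI2)
  have h_eq: "h m = m'" if "related m m'" for m m'
    using h[of m] that related_right_unique unfolding related_def by blast
  have "h \<in> linear_maps (bound_path_algebra Q \<rho>) M N"
  proof (rule linear_mapsI)
    fix m assume "m \<in> carrier M"
    then show "h m \<in> carrier N"
      using h unfolding related_def by blast
  next
    fix m x assume "m \<in> carrier M" "x \<in> carrier M"
    then show "h (m \<oplus>\<^bsub>M\<^esub> x) = h m \<oplus>\<^bsub>N\<^esub> h x"
      by (intro h_eq related_add h)
  next
    fix L :: "(('v, 'e) path \<Rightarrow>\<^sub>0 'k) set" and m assume "L \<in> carrier (bound_path_algebra Q \<rho>)" "m \<in> carrier M"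
    then show "h (L \<odot>\<^bsub>M\<^esub> m) = L \<odot>\<^bsub>N\<^esub> h m"
      using related_smult h by (intro h_eq) blast
  qed
  moreover have "bij_betw h (carrier M) (carrier N)"
    unfolding bij_betw_def
  proof
    show "inj_on h (carrier M)"
      using h related_left_unique by (intro inj_onI) metis
    have "m' \<in> h ` carrier M" if m': "m' \<in> carrier N" for m'
    proof -
      obtain m where "related m m'"
        using related_onto[OF m'] by blast
      then show ?thesis
        using h_eq unfolding related_def by (intro image_eqI[of _ _ m]) auto
    qed
    then show "h ` carrier M = carrier N"
      using h unfolding related_def by blast
  qed
  ultimately show ?thesis
    unfolding module_isomorphic_def by blast
qed

end

section \<open>String modules as modules with word coordinates\<close>

text \<open>The coefficients of a string module: the field as a record, so that both kinds of
  modules have coefficients in an abelian group.\<close>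

definition scalar_group :: "'k::field ring" where
  "scalar_group = \<lparr>carrier = UNIV, monoid.mult = (*), one = 1, ring.zero = 0, ring.add = (+)\<rparr>"

lemma scalar_group_simps [simp]:
  "carrier scalar_group = UNIV" "\<zero>\<^bsub>scalar_group\<^esub> = (0 :: 'k::field)" "ring.add scalar_group = ((+) :: 'k \<Rightarrow> _)"
  by (simp_all add: scalar_group_def)

lemma abelian_group_scalar: "abelian_group (scalar_group :: 'k::field ring)"
proof (rule abelian_groupI)
  fix x :: 'k assume "x \<in> carrier scalar_group"
  show "\<exists>y\<in>carrier scalar_group. y \<oplus>\<^bsub>scalar_group\<^esub> x = \<zero>\<^bsub>scalar_group\<^esub>"
    by (intro bexI[of _ "- x"]) simp_all
qed (simp_all add: algebra_simps)

lemma (in string_algebra_word) word_module_string: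
  "word_module Q \<rho> C (string_module Q C) (scalar_group :: 'k::field ring) 0 (*) (\<lambda>k v. v)
    Poly_Mapping.single Poly_Mapping.lookup"
proof (intro word_module.intro word_module_axioms.intro string_algebra_word_axioms
    left_module_string_module abelian_group_scalar)
  fix m :: "int \<Rightarrow>\<^sub>0 'k" and P :: "(int \<Rightarrow>\<^sub>0 'k) \<Rightarrow> bool"
  assume "m \<in> carrier (string_module Q C)" and P: "P \<zero>\<^bsub>string_module Q C\<^esub>"
    and step: "\<And>m j v. m \<in> carrier (string_module Q C) \<Longrightarrow> P m \<Longrightarrow> j \<in> word_index C \<Longrightarrow>
      v \<in> carrier scalar_group \<Longrightarrow> Poly_Mapping.lookup m j = \<zero>\<^bsub>scalar_group\<^esub> \<Longrightarrow>
      P (m \<oplus>\<^bsub>string_module Q C\<^esub> Poly_Mapping.single j v)"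
  then have "Poly_Mapping.keys m \<subseteq> word_index C"
    by simp
  then show "P m"
  proof (induction rule: poly_mapping_add_single_induct)
    case zero
    show ?case
      using P by simp
  next
    case (add f i c)
    then show ?case
      using step[of f i c] by (simp add: in_keys_iff)
  qed
next
  fix m m' :: "int \<Rightarrow>\<^sub>0 'k" and i :: int
  show "Poly_Mapping.lookup (m \<oplus>\<^bsub>string_module Q C\<^esub> m') i =
      Poly_Mapping.lookup m i \<oplus>\<^bsub>scalar_group\<^esub> Poly_Mapping.lookup m' i"
    by (simp add: lookup_add)
next
  fix x i i' and v :: 'k assume st: "step (letter_at C) x i i'"
  note e = step_endpoints[OF st]
  show "arrow_class Q \<rho> x \<odot>\<^bsub>string_module Q C\<^esub> Poly_Mapping.single i v = Poly_Mapping.single i' v"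
    using e by (subst arrow_class_smult) (simp_all add: arrow_act_step[OF st])
next
  fix x i and v :: 'k
  assume "x \<in> arcs Q" "i \<in> word_index C" and none: "\<nexists>i'. step (letter_at C) x i i'"
  then show "arrow_class Q \<rho> x \<odot>\<^bsub>string_module Q C\<^esub> Poly_Mapping.single i v = \<zero>\<^bsub>string_module Q C\<^esub>"
    by (subst arrow_class_smult) (simp_all add: arrow_act_no_step[OF none])
next
  fix x j' j and m :: "int \<Rightarrow>\<^sub>0 'k"
  assume st: "step (letter_at C) x j' j" and "m \<in> carrier (string_module Q C)"
  then show "Poly_Mapping.lookup (arrow_class Q \<rho> x \<odot>\<^bsub>string_module Q C\<^esub> m) j = Poly_Mapping.lookup m j'"
    using step_endpoints(1)[OF st] by (subst arrow_class_smult) (simp_all add: lookup_arrow[OF st])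
next
  fix x j and m :: "int \<Rightarrow>\<^sub>0 'k"
  assume "x \<in> arcs Q" and none: "\<nexists>j'. step (letter_at C) x j' j" and "m \<in> carrier (string_module Q C)"
  then show "Poly_Mapping.lookup (arrow_class Q \<rho> x \<odot>\<^bsub>string_module Q C\<^esub> m) j = \<zero>\<^bsub>scalar_group\<^esub>"
    by (subst arrow_class_smult) (simp_all add: lookup_arrow_zero[OF none])
next
  fix i and v c :: 'k assume "i \<in> word_index C"
  then show "vertex_class Q \<rho> (word_vertex Q C i) c \<odot>\<^bsub>string_module Q C\<^esub> Poly_Mapping.single i v =
      Poly_Mapping.single i (c * v)"
    using word_vertex_in_verts[of i] by (subst vertex_class_smult) (simp_all add: vertex_act_def)
next
  fix u j and c :: 'k and m :: "int \<Rightarrow>\<^sub>0 'k"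
  assume "u \<in> verts Q" "m \<in> carrier (string_module Q C)"
  then show "Poly_Mapping.lookup (vertex_class Q \<rho> u c \<odot>\<^bsub>string_module Q C\<^esub> m) j =
      (if word_vertex Q C j = u then c * Poly_Mapping.lookup m j else \<zero>\<^bsub>scalar_group\<^esub>)"
    by (subst vertex_class_smult) (simp_all add: lookup_vertex)
qed (auto simp: in_keys_iff single_add lookup_single when_def subset_iff)

section \<open>Laurent polynomials\<close>

lemma laurent_ring_simps [simp]:
  "carrier laurent_ring = UNIV" "\<zero>\<^bsub>laurent_ring\<^esub> = (0 :: int \<Rightarrow>\<^sub>0 'k::field)"
  "\<one>\<^bsub>laurent_ring\<^esub> = (1 :: int \<Rightarrow>\<^sub>0 'k)" "ring.add laurent_ring = ((+) :: (int \<Rightarrow>\<^sub>0 'k) \<Rightarrow> _)"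
  "monoid.mult laurent_ring = ((*) :: (int \<Rightarrow>\<^sub>0 'k) \<Rightarrow> _)"
  by (simp_all add: laurent_ring_def)

lemma lookup_mult_int:
  fixes f g :: "int \<Rightarrow>\<^sub>0 'k::field"
  shows "Poly_Mapping.lookup (f * g) k =
    (\<Sum>l\<in>Poly_Mapping.keys f. Poly_Mapping.lookup f l * Poly_Mapping.lookup g (k - l))"
proof -
  have "(\<Sum>q. Poly_Mapping.lookup g q when k = l + q) = Poly_Mapping.lookup g (k - l)" for l
  proof -
    have eq: "(\<lambda>q. Poly_Mapping.lookup g q when k = l + q) = (\<lambda>q. Poly_Mapping.lookup g q when q = k - l)"
      by (auto simp: when_def fun_eq_iff)
    show ?thesis
      unfolding eq by (rule Sum_any_when_equal)
  qed
  then have "Poly_Mapping.lookup (f * g) k = (\<Sum>l. Poly_Mapping.lookup f l * Poly_Mapping.lookup g (k - l))"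
    by (simp add: lookup_mult)
  also have "\<dots> = (\<Sum>l\<in>Poly_Mapping.keys f. Poly_Mapping.lookup f l * Poly_Mapping.lookup g (k - l))"
    by (rule Sum_any.expand_superset) (auto simp: in_keys_iff)
  finally show ?thesis .
qed

lemma lookup_single_mult:
  fixes g :: "int \<Rightarrow>\<^sub>0 'k::field"
  shows "Poly_Mapping.lookup (Poly_Mapping.single l c * g) k = c * Poly_Mapping.lookup g (k - l)"
  by (cases "c = 0") (simp_all add: lookup_mult_int)

lemma translation_multiple:
  fixes c :: "int \<Rightarrow> 'a"
  assumes "\<And>t. c (t + d) = c t"
  shows "c (t + d * k) = c t"
proof -
  have nat: "c (t + d * int n) = c t" for t n
  proof (induction n)
    case (Suc n)
    have "t + d * int (Suc n) = t + d * int n + d"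
      by (simp add: algebra_simps)
    then show ?case
      using assms[of "t + d * int n"] Suc.IH by (simp only:)
  qed simp
  show ?thesis
  proof (cases "k \<ge> 0")
    case True
    then show ?thesis
      using nat[of t "nat k"] by simp
  next
    case False
    then show ?thesis
      using nat[of "t + d * k" "nat (- k)"] by simp
  qed
qed

section \<open>Band modules as modules with word coordinates\<close>

text \<open>Multiplicative notation is forced by the tensor group being a monoid record. The initial
  segments are kept accessible because they are the intermediate elements of the expansion
  induction.\<close>

primrec partial_product :: "('a, 'b) monoid_scheme \<Rightarrow> (nat \<Rightarrow> 'a) \<Rightarrow> nat \<Rightarrow> 'a" where
  "partial_product G f 0 = \<one>\<^bsub>G\<^esub>"
| "partial_product G f (Suc k) = partial_product G f k \<otimes>\<^bsub>G\<^esub> f k"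

lemma (in comm_group) partial_product_closed:
  "(\<And>i. i < k \<Longrightarrow> f i \<in> carrier G) \<Longrightarrow> partial_product G f k \<in> carrier G"
  by (induction k) simp_all

lemma (in comm_group) partial_product_mult:
  assumes "\<And>i. i < k \<Longrightarrow> f i \<in> carrier G" "\<And>i. i < k \<Longrightarrow> g i \<in> carrier G"
  shows "partial_product G (\<lambda>i. f i \<otimes> g i) k = partial_product G f k \<otimes> partial_product G g k"
  using assms
proof (induction k)
  case (Suc k)
  then show ?case
    using partial_product_closed[of k f] partial_product_closed[of k g] by (simp add: m_ac)
qed simp

lemma (in comm_group) partial_product_one:
  "(\<And>i. i < k \<Longrightarrow> f i = \<one>) \<Longrightarrow> partial_product G f k = \<one>"
  by (induction k) simp_all

lemma (in comm_group) partial_product_single: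
  assumes "r < k" "f r \<in> carrier G" "\<And>i. i < k \<Longrightarrow> i \<noteq> r \<Longrightarrow> f i = \<one>"
  shows "partial_product G f k = f r"
  using assms
proof (induction k)
  case (Suc k)
  show ?case
  proof (cases "r = k")
    case True
    then show ?thesis
      using Suc.prems partial_product_one[of k f] by simp
  next
    case False
    then show ?thesis
      using Suc by simp
  qed
qed simp

locale periodic_word_module = string_algebra_word Q \<rho> C + V: Module.module laurent_ring V
  for Q :: "('v, 'e) pre_digraph" and \<rho> and C and V :: "(int \<Rightarrow>\<^sub>0 'k::field, 'x) module" +
  assumes periodic: "periodic C"
begin

abbreviation per :: int where
  "per \<equiv> int (period C)"

lemma index_UNIV [simp]: "word_index C = UNIV"
  using periodic unfolding periodic_def by blast

lemma period_properties: "0 < period C" "C = word_shift C per"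
proof -
  have "\<exists>k. 0 < k \<and> C = word_shift C (int k)"
  proof -
    obtain k where "k > 0" "C = word_shift C k"
      using periodic unfolding periodic_def by blast
    then show ?thesis
      by (intro exI[of _ "nat k"]) simp
  qed
  then have "0 < period C \<and> C = word_shift C (int (period C))"
    unfolding period_def by (rule LeastI_ex)
  then show "0 < period C" "C = word_shift C per"
    by blast+
qed

section \<open>Invariance under the period\<close>

lemma letter_add_per: "letter_at C (i + per) = letter_at C i"
proof (cases C)
  case (Letters c)
  have "Letters c = (Letters (\<lambda>i. c (i + per)) :: ('v, 'e) word)"
    using period_properties(2) index_UNIV unfolding Letters by simp
  then show ?thesis
    unfolding Letters by (metis letter_at.simps(2) word.inject(2))
qed simp

lemma letter_add_per_mult: "letter_at C (i + per * k) = letter_at C i"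
  by (rule translation_multiple) (rule letter_add_per)

lemma letter_add_per_mult1: "letter_at C (i + per * k + 1) = letter_at C (i + 1)"
proof -
  have "i + per * k + 1 = (i + 1) + per * k"
    by simp
  then show ?thesis
    using letter_add_per_mult[of "i + 1" k] by (simp only:)
qed

lemma step_add_per: "step (letter_at C) x i i' \<Longrightarrow> step (letter_at C) x (i + per * k) (i' + per * k)"
  unfolding step_def letter_add_per_mult letter_add_per_mult1 by auto

lemma vertex_add_per: "word_vertex Q C (i + per * k) = word_vertex Q C i"
proof (cases C)
  case (Letters c)
  have vertex: "word_vertex Q C p =
      (case letter_at C p of Some l \<Rightarrow> letter_tail Q l | None \<Rightarrow> letter_head Q (the (letter_at C (p + 1))))" for p
    unfolding Letters by (simp split: option.split)
  show ?thesis
    by (simp only: vertex[of "i + per * k"] vertex[of i] letter_add_per_mult letter_add_per_mult1)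
qed simp

section \<open>The bimodule structure on M(C)\<close>

abbreviation laurent_module :: "(int \<Rightarrow>\<^sub>0 'k, int \<Rightarrow>\<^sub>0 'k) module" where
  "laurent_module \<equiv> periodic_laurent_module C"

lemma laurent_module_simps [simp]:
  "carrier laurent_module = UNIV" "\<zero>\<^bsub>laurent_module\<^esub> = 0" "ring.add laurent_module = (+)"
  by (simp_all add: periodic_laurent_module_def)

lemma lookup_translate:
  fixes m :: "int \<Rightarrow>\<^sub>0 'k"
  shows "Poly_Mapping.lookup (klinear_extend (\<lambda>i. Poly_Mapping.single (i - s) 1) m) j = Poly_Mapping.lookup m (j + s)"
proof -
  have "Poly_Mapping.lookup (klinear_extend (\<lambda>i. Poly_Mapping.single (i - s) 1) m) j =
      (\<Sum>i\<in>Poly_Mapping.keys m. if i = j + s then Poly_Mapping.lookup m i else 0)"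
    unfolding lookup_klinear_extend by (rule sum.cong) (auto simp: lookup_single when_def)
  then show ?thesis
    by (simp add: in_keys_iff)
qed

lemma lookup_laurent_smult:
  "Poly_Mapping.lookup (f \<odot>\<^bsub>laurent_module\<^esub> m) i =
    (\<Sum>j\<in>Poly_Mapping.keys f. Poly_Mapping.lookup f j * Poly_Mapping.lookup m (i + per * j))"
  by (simp add: periodic_laurent_module_def lookup_klinear_extend[of _ f] lookup_translate mult.commute)

text \<open>Translation by the period preserves steps and vertices, so it commutes with trivial
  paths and arrows and hence with the algebra they generate.\<close>

lemma laurent_smult_commute:
  assumes "L \<in> carrier (bound_path_algebra Q \<rho>)"
  shows "\<forall>m. f \<odot>\<^bsub>laurent_module\<^esub> (L \<odot>\<^bsub>string_module Q C\<^esub> m) = L \<odot>\<^bsub>string_module Q C\<^esub> (f \<odot>\<^bsub>laurent_module\<^esub> m)"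
  using assms
proof (induction rule: bound_path_algebra_induct)
  case zero
  have "bound_class Q \<rho> (0 :: ('v, 'e) path \<Rightarrow>\<^sub>0 'k) \<odot>\<^bsub>string_module Q C\<^esub> m = 0" for m
    by (subst smult_bound_class) simp_all
  moreover have "f \<odot>\<^bsub>laurent_module\<^esub> 0 = 0"
    by (rule poly_mapping_eqI) (simp add: lookup_laurent_smult)
  ultimately show ?case
    by (simp add: zero_bound_path_algebra)
next
  case (vertex v c)
  show ?case
  proof
    fix m
    show "f \<odot>\<^bsub>laurent_module\<^esub> (vertex_class Q \<rho> v c \<odot>\<^bsub>string_module Q C\<^esub> m) =
        vertex_class Q \<rho> v c \<odot>\<^bsub>string_module Q C\<^esub> (f \<odot>\<^bsub>laurent_module\<^esub> m)"
      by (rule poly_mapping_eqI)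
        (simp add: vertex_class_smult[OF vertex] lookup_laurent_smult lookup_vertex vertex_add_per
          sum_distrib_left mult.left_commute)
  qed
next
  case (arrow x)
  show ?case
  proof
    fix m
    show "f \<odot>\<^bsub>laurent_module\<^esub> (arrow_class Q \<rho> x \<odot>\<^bsub>string_module Q C\<^esub> m) =
        arrow_class Q \<rho> x \<odot>\<^bsub>string_module Q C\<^esub> (f \<odot>\<^bsub>laurent_module\<^esub> m)"
    proof (rule poly_mapping_eqI)
      fix i
      show "Poly_Mapping.lookup (f \<odot>\<^bsub>laurent_module\<^esub> (arrow_class Q \<rho> x \<odot>\<^bsub>string_module Q C\<^esub> m)) i =
          Poly_Mapping.lookup (arrow_class Q \<rho> x \<odot>\<^bsub>string_module Q C\<^esub> (f \<odot>\<^bsub>laurent_module\<^esub> m)) i"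
      proof (cases "\<exists>j. step (letter_at C) x j i")
        case True
        then obtain j where j: "step (letter_at C) x j i"
          by blast
        show ?thesis
          by (simp add: arrow_class_smult[OF arrow] lookup_laurent_smult lookup_arrow[OF j]
              lookup_arrow[OF step_add_per[OF j]])
      next
        case False
        have "\<nexists>j. step (letter_at C) x j (i + per * k)" for k
        proof
          assume "\<exists>j. step (letter_at C) x j (i + per * k)"
          then obtain j where "step (letter_at C) x j (i + per * k)"
            by blast
          then have "step (letter_at C) x (j + per * - k) (i + per * k + per * - k)"
            by (rule step_add_per)
          with False show False
            by simp
        qed
        then show ?thesis
          using False by (simp add: arrow_class_smult[OF arrow] lookup_laurent_smult lookup_arrow_zero)
      qed
    qed
  qed
next
  case (add L L')
  interpret S: left_module "bound_path_algebra Q \<rho>" "string_module Q C :: (_, int \<Rightarrow>\<^sub>0 'k) module"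
    by (rule left_module_string_module)
  have "f \<odot>\<^bsub>laurent_module\<^esub> (y + z) = f \<odot>\<^bsub>laurent_module\<^esub> y + f \<odot>\<^bsub>laurent_module\<^esub> z" for y z
    by (rule poly_mapping_eqI) (simp add: lookup_laurent_smult lookup_add distrib_left sum.distrib)
  then show ?case
    using add S.smult_l_distr[OF add(1,2)] by simp
next
  case (mult L L')
  interpret S: left_module "bound_path_algebra Q \<rho>" "string_module Q C :: (_, int \<Rightarrow>\<^sub>0 'k) module"
    by (rule left_module_string_module)
  show ?case
    using mult S.smult_assoc[OF mult(1,2)] by simp
qed

sublocale B: tensor_left_module laurent_ring laurent_module V "bound_path_algebra Q \<rho>" "string_module Q C"
proof (intro tensor_left_module.intro tensor_product.intro tensor_product_axioms.intro
    tensor_left_module_axioms.intro left_module_string_module V.abelian_group_axioms)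
  show "abelian_group laurent_module"
    by (rule abelian_group_poly_mapping[where S = UNIV]) simp_all
  fix a b :: "(('v, 'e) path \<Rightarrow>\<^sub>0 'k) set"
  assume ab: "a \<in> carrier (bound_path_algebra Q \<rho>)" "b \<in> carrier (bound_path_algebra Q \<rho>)"
  then obtain f g where f: "a = bound_class Q \<rho> f" "Poly_Mapping.keys f \<subseteq> paths Q"
    and g: "b = bound_class Q \<rho> g" "Poly_Mapping.keys g \<subseteq> paths Q"
    by (auto simp: carrier_bound_path_algebra)
  have "Poly_Mapping.keys (f + g) \<subseteq> paths Q"
    using f g keys_add[of f g] by blast
  then show "a \<oplus>\<^bsub>bound_path_algebra Q \<rho>\<^esub> b \<in> carrier (bound_path_algebra Q \<rho>)"
    using f g by (simp add: add_bound_class bound_class_closed)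
  have "f \<otimes>\<^bsub>path_algebra Q\<^esub> g \<in> carrier (path_algebra Q)"
    using f g by (intro path_algebra_mult_closed) simp_all
  then have "Poly_Mapping.keys (f \<otimes>\<^bsub>path_algebra Q\<^esub> g) \<subseteq> paths Q"
    by (simp only: path_algebra_simps(1) mem_Collect_eq)
  then show "a \<otimes>\<^bsub>bound_path_algebra Q \<rho>\<^esub> b \<in> carrier (bound_path_algebra Q \<rho>)"
    unfolding f(1) g(1) mult_bound_class[OF f(2) g(2)] by (rule bound_class_closed)
qed (use laurent_smult_commute V.smult_closed in \<open>auto simp: string_module_simps\<close>)

text \<open>\<open>M(C)\<close> is free over the Laurent polynomials on any \<open>period C\<close>
  consecutive basis vectors, and \<open>T^k b_j\<close> is the basis vector at
  \<open>j - per * k\<close>. This is the coefficient of \<open>m\<close> at \<open>b_j\<close>, for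
  every integer \<open>j\<close> and not only for chosen representatives.\<close>

definition coeff :: "int \<Rightarrow> (int \<Rightarrow>\<^sub>0 'k) \<Rightarrow> (int \<Rightarrow>\<^sub>0 'k)" where
  "coeff j m = Poly_Mapping.map_key (\<lambda>k. j - per * k) m"

lemma lookup_coeff: "Poly_Mapping.lookup (coeff j m) k = Poly_Mapping.lookup m (j - per * k)"
proof -
  have "inj (\<lambda>k. j - per * k)"
    using period_properties(1) by (auto intro: injI)
  then show ?thesis
    unfolding coeff_def by (simp add: map_key.rep_eq)
qed

lemma coeff_add: "coeff j (m + m') = coeff j m + coeff j m'"
  by (rule poly_mapping_eqI) (simp add: lookup_coeff lookup_add)

lemma coeff_smult: "coeff j (f \<odot>\<^bsub>laurent_module\<^esub> m) = f * coeff j m"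
  by (rule poly_mapping_eqI) (simp add: lookup_coeff lookup_laurent_smult lookup_mult_int algebra_simps)

text \<open>The homomorphism that the universal property assigns to the balanced map
  \<open>(m, v) \<mapsto> coeff j m v\<close>. The choice is harmless: pure tensors generate, so its
  values on the carrier are determined.\<close>

definition coord :: "((int \<Rightarrow>\<^sub>0 'k) \<times> 'x \<Rightarrow>\<^sub>0 int) set \<Rightarrow> int \<Rightarrow> 'x" where
  "coord Z j = (SOME \<phi>. \<phi> \<in> hom (tensor_group laurent_ring laurent_module V) (add_monoid V) \<and>
     (\<forall>m. \<forall>v\<in>carrier V. \<phi> (B.pure m v) = coeff j m \<odot>\<^bsub>V\<^esub> v)) Z"

lemma coord:
  "(\<lambda>Z. coord Z j) \<in> hom (tensor_group laurent_ring laurent_module V) (add_monoid V)"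
  "v \<in> carrier V \<Longrightarrow> coord (B.pure m v) j = coeff j m \<odot>\<^bsub>V\<^esub> v"
proof -
  have "\<exists>\<phi>. \<phi> \<in> hom (tensor_group laurent_ring laurent_module V) (add_monoid V) \<and>
     (\<forall>m. \<forall>v\<in>carrier V. \<phi> (B.pure m v) = coeff j m \<odot>\<^bsub>V\<^esub> v)"
  proof (rule B.tensor_universal[of "add_monoid V" "\<lambda>m v. coeff j m \<odot>\<^bsub>V\<^esub> v"])
    show "comm_group (add_monoid V)"
      by (rule V.a_comm_group)
  qed (use V.smult_closed V.smult_l_distr V.smult_r_distr V.smult_assoc1[symmetric] in
      \<open>auto simp: coeff_add coeff_smult mult.commute\<close>)
  from someI_ex[OF this] show
    "(\<lambda>Z. coord Z j) \<in> hom (tensor_group laurent_ring laurent_module V) (add_monoid V)"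
    "v \<in> carrier V \<Longrightarrow> coord (B.pure m v) j = coeff j m \<odot>\<^bsub>V\<^esub> v"
    unfolding coord_def by auto
qed

section \<open>Coordinates on the tensor product\<close>

lemma band_module_eq: "band_module Q C V = B.tensor"
  by (simp add: band_module_def)

lemma coord_closed: "Z \<in> carrier B.tensor \<Longrightarrow> coord Z j \<in> carrier V"
  using hom_in_carrier[OF coord(1), of Z j] by (simp add: B.tensor_simps)

lemma coord_add:
  "Y \<in> carrier B.tensor \<Longrightarrow> Z \<in> carrier B.tensor \<Longrightarrow> coord (Y \<oplus>\<^bsub>B.tensor\<^esub> Z) j = coord Y j \<oplus>\<^bsub>V\<^esub> coord Z j"
  using hom_mult[OF coord(1)[of j], of Y Z] by (simp add: B.tensor_simps)

lemma coord_zero: "coord \<zero>\<^bsub>B.tensor\<^esub> j = \<zero>\<^bsub>V\<^esub>"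
proof -
  interpret group_hom "tensor_group laurent_ring laurent_module V" "add_monoid V" "\<lambda>Z. coord Z j"
    using coord(1) V.a_group by (intro group_hom.intro group_hom_axioms.intro) (auto intro: B.T.is_group)
  show ?thesis
    using hom_one by (simp add: B.tensor_simps)
qed

lemma pure_in_tensor: "v \<in> carrier V \<Longrightarrow> B.pure m v \<in> carrier B.tensor"
  by (simp add: B.tensor_simps B.pure_closed)

lemma band_induct [consumes 1, case_names zero pure add]:
  assumes "Z \<in> carrier B.tensor" "P \<zero>\<^bsub>B.tensor\<^esub>" "\<And>m v. v \<in> carrier V \<Longrightarrow> P (B.pure m v)"
    and "\<And>Y Z. Y \<in> carrier B.tensor \<Longrightarrow> Z \<in> carrier B.tensor \<Longrightarrow> P Y \<Longrightarrow> P Z \<Longrightarrow> P (Y \<oplus>\<^bsub>B.tensor\<^esub> Z)"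
  shows "P Z"
  using assms unfolding B.tensor_simps by (intro B.tensor_induct[of Z P]) simp_all

lemma laurent_smult_single: "Poly_Mapping.single 0 c \<odot>\<^bsub>laurent_module\<^esub> m = kscale c m"
  by (rule poly_mapping_eqI) (simp add: lookup_laurent_smult)

lemma laurent_smult_basis:
  "Poly_Mapping.single (- q) c \<odot>\<^bsub>laurent_module\<^esub> Poly_Mapping.single r 1 = Poly_Mapping.single (r + per * q) c"
  by (rule poly_mapping_eqI) (auto simp: lookup_laurent_smult lookup_single when_def)

definition basis :: "int \<Rightarrow> 'x \<Rightarrow> ((int \<Rightarrow>\<^sub>0 'k) \<times> 'x \<Rightarrow>\<^sub>0 int) set" where
  "basis i v = B.pure (Poly_Mapping.single i 1) v"

lemma basis_closed: "v \<in> carrier V \<Longrightarrow> basis i v \<in> carrier B.tensor"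
  unfolding basis_def by (rule pure_in_tensor)

text \<open>Division with remainder writes a basis vector as a power of \<open>T\<close> times one
  whose index is at least 0 and below the period; the power then moves across the tensor sign into
  the coefficient.\<close>

lemma band_expansion:
  assumes "Z \<in> carrier B.tensor"
  shows "\<exists>f. (\<forall>i. f i \<in> carrier V) \<and>
    Z = partial_product (tensor_group laurent_ring laurent_module V) (\<lambda>i. basis (int i) (f i)) (period C)"
    (is "\<exists>f. _ \<and> Z = ?pp f")
  using assms
proof (induction rule: band_induct)
  have basis_T: "v \<in> carrier V \<Longrightarrow> basis i v \<in> carrier (tensor_group laurent_ring laurent_module V)" for i v
    using basis_closed by (simp add: B.tensor_simps)
  have basis_zero: "basis i \<zero>\<^bsub>V\<^esub> = \<one>\<^bsub>tensor_group laurent_ring laurent_module V\<^esub>" for i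
    unfolding basis_def by (rule B.pure_zero_right) simp
  have zero_expansion: "\<exists>f. (\<forall>i. f i \<in> carrier V) \<and> \<zero>\<^bsub>B.tensor\<^esub> = ?pp f"
    by (intro exI[of _ "\<lambda>_. \<zero>\<^bsub>V\<^esub>"]) (simp add: B.T.partial_product_one basis_zero B.tensor_simps)
  have add_expansion: "\<exists>f. (\<forall>i. f i \<in> carrier V) \<and> Y \<oplus>\<^bsub>B.tensor\<^esub> Z = ?pp f"
    if Y: "\<exists>f. (\<forall>i. f i \<in> carrier V) \<and> Y = ?pp f" and Z: "\<exists>f. (\<forall>i. f i \<in> carrier V) \<and> Z = ?pp f" for Y Z
  proof -
    obtain f g where f: "\<And>i. f i \<in> carrier V" "Y = ?pp f" and g: "\<And>i. g i \<in> carrier V" "Z = ?pp g"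
      using Y Z by blast
    have "basis i (f k \<oplus>\<^bsub>V\<^esub> g k) = basis i (f k) \<otimes>\<^bsub>tensor_group laurent_ring laurent_module V\<^esub> basis i (g k)" for i k
      unfolding basis_def using f g by (intro B.pure_add_right) simp_all
    then have "Y \<oplus>\<^bsub>B.tensor\<^esub> Z = ?pp (\<lambda>i. f i \<oplus>\<^bsub>V\<^esub> g i)"
      unfolding f(2) g(2) using f(1) g(1) basis_T by (simp add: B.T.partial_product_mult B.tensor_simps)
    then show ?thesis
      using f(1) g(1) by (intro exI[of _ "\<lambda>i. f i \<oplus>\<^bsub>V\<^esub> g i"]) simp
  qed
  {
    case zero
    show ?case
      by (rule zero_expansion)
  next
    case (pure m v)
    have single: "\<exists>f. (\<forall>i. f i \<in> carrier V) \<and> B.pure (Poly_Mapping.single i c) v = ?pp f" for i c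
    proof -
      define r q where "r = nat (i mod per)" and "q = i div per"
      have r: "r < period C" "int r = i mod per"
        unfolding r_def using period_properties(1) by (simp_all add: nat_less_iff)
      define w where "w = Poly_Mapping.single (- q) c \<odot>\<^bsub>V\<^esub> v"
      have w: "w \<in> carrier V"
        unfolding w_def using pure by (intro V.smult_closed) simp_all
      have "int r + per * q = i"
        unfolding r(2) q_def by simp
      then have "B.pure (Poly_Mapping.single i c) v =
          B.pure (Poly_Mapping.single (- q) c \<odot>\<^bsub>laurent_module\<^esub> Poly_Mapping.single (int r) 1) v"
        by (simp only: laurent_smult_basis)
      also have "\<dots> = basis (int r) w"
        unfolding basis_def w_def using pure by (intro B.pure_balanced) simp_all
      also have "\<dots> = ?pp (\<lambda>i. if i = r then w else \<zero>\<^bsub>V\<^esub>)"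
        by (subst B.T.partial_product_single[OF r(1)]) (use w basis_T basis_zero in auto)
      finally show ?thesis
        using w by (intro exI[of _ "\<lambda>i. if i = r then w else \<zero>\<^bsub>V\<^esub>"]) simp
    qed
    show ?case
      using subset_UNIV[of "Poly_Mapping.keys m"]
    proof (induction rule: poly_mapping_add_single_induct)
      case zero
      have "B.pure 0 v = \<zero>\<^bsub>B.tensor\<^esub>"
        using B.pure_zero_left[OF pure] by (simp add: B.tensor_simps)
      then show ?case
        using zero_expansion by simp
    next
      case (add m i c)
      have "B.pure (m + Poly_Mapping.single i c) v = B.pure m v \<oplus>\<^bsub>B.tensor\<^esub> B.pure (Poly_Mapping.single i c) v"
        using B.pure_add_left[of m "Poly_Mapping.single i c" v] pure by (simp add: B.tensor_simps)
      then show ?case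
        using add_expansion[OF add(1) single] by simp
    qed
  next
    case (add Y Z)
    show ?case
      by (rule add_expansion[OF add(3,4)])
  }
qed

abbreviation scalar :: "'k \<Rightarrow> 'x \<Rightarrow> 'x" where
  "scalar c v \<equiv> Poly_Mapping.single 0 c \<odot>\<^bsub>V\<^esub> v"

abbreviation twist :: "int \<Rightarrow> 'x \<Rightarrow> 'x" where
  "twist k v \<equiv> Poly_Mapping.single k 1 \<odot>\<^bsub>V\<^esub> v"

lemma coord_basis_same: "v \<in> carrier V \<Longrightarrow> coord (basis i v) i = v"
proof -
  assume v: "v \<in> carrier V"
  have "coeff i (Poly_Mapping.single i 1) = 1"
    by (rule poly_mapping_eqI)
      (use period_properties(1) in \<open>auto simp: lookup_coeff lookup_single lookup_one when_def\<close>)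
  then show ?thesis
    unfolding basis_def coord(2)[OF v] using V.smult_one[OF v] by simp
qed

lemma coord_basis_other: "v \<in> carrier V \<Longrightarrow> \<not> per dvd j - i \<Longrightarrow> coord (basis i v) j = \<zero>\<^bsub>V\<^esub>"
proof -
  assume v: "v \<in> carrier V" and nd: "\<not> per dvd j - i"
  have "i \<noteq> j - per * k" for k
    using nd by auto
  then have "coeff j (Poly_Mapping.single i 1) = 0"
    by (intro poly_mapping_eqI) (simp add: lookup_coeff lookup_single when_def)
  then show ?thesis
    unfolding basis_def coord(2)[OF v] using V.smult_l_null[OF v] by simp
qed

text \<open>Since \<open>b_i\<close> is \<open>T^k\<close> applied to the basis vector at
  \<open>i + per * k\<close>, the coefficient at the latter is \<open>T^k\<close> times the
  coefficient at \<open>b_i\<close>.\<close>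

lemma coord_shift: "Z \<in> carrier B.tensor \<Longrightarrow> coord Z (i + per * k) = twist k (coord Z i)"
proof (induction rule: band_induct)
  case zero
  show ?case
    by (simp add: coord_zero)
next
  case (pure m v)
  have "coeff (i + per * k) m = Poly_Mapping.single k 1 * coeff i m"
    by (rule poly_mapping_eqI) (simp add: lookup_coeff lookup_single_mult algebra_simps)
  then show ?case
    using V.smult_assoc1[of "Poly_Mapping.single k 1" "coeff i m" v] pure by (simp add: coord(2))
next
  case (add Y Z)
  then show ?case
    using V.smult_r_distr[of "Poly_Mapping.single k 1" "coord Y i" "coord Z i"] by (simp add: coord_add coord_closed)
qed

text \<open>The two coordinate laws for arrows, with and without a step into \<open>j\<close>,
  follow by the same induction over pure tensors. \<open>F\<close> is the effect on coefficients in
  \<open>M(C)\<close>, and \<open>G\<close> is the asserted coordinate.\<close>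

lemma coord_arrow:
  assumes x: "x \<in> arcs Q" and Z: "Z \<in> carrier B.tensor"
    and "\<And>m. coeff j (klinear_extend (arrow_act C x) m) = F m" "\<And>m v. v \<in> carrier V \<Longrightarrow> F m \<odot>\<^bsub>V\<^esub> v = G (B.pure m v)"
    and "G \<zero>\<^bsub>B.tensor\<^esub> = \<zero>\<^bsub>V\<^esub>"
    and "\<And>Y Z. Y \<in> carrier B.tensor \<Longrightarrow> Z \<in> carrier B.tensor \<Longrightarrow> G (Y \<oplus>\<^bsub>B.tensor\<^esub> Z) = G Y \<oplus>\<^bsub>V\<^esub> G Z"
  shows "coord (arrow_class Q \<rho> x \<odot>\<^bsub>B.tensor\<^esub> Z) j = G Z"
proof -
  note xc = arrow_class_closed[OF x, where ?'a = 'k]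
  interpret BT: left_module "bound_path_algebra Q \<rho>" B.tensor
    by (rule B.left_module_tensor)
  show ?thesis
    using Z
  proof (induction rule: band_induct)
    case zero
    have "arrow_class Q \<rho> x \<odot>\<^bsub>B.tensor\<^esub> \<zero>\<^bsub>B.tensor\<^esub> = \<zero>\<^bsub>B.tensor\<^esub>"
      using BT.smult_r_distr[OF xc BT.zero_closed BT.zero_closed] BT.smult_closed[OF xc BT.zero_closed]
      by (metis BT.add.l_cancel_one' BT.l_zero BT.zero_closed)
    then show ?case
      using assms by (simp add: coord_zero)
  next
    case (pure m v)
    then show ?case
      using assms by (simp add: B.smult_pure[OF xc] arrow_class_smult[OF x] coord(2))
  next
    case (add Y Z)
    then show ?case
      using assms xc by (simp add: BT.smult_r_distr coord_add BT.smult_closed)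
  qed
qed

lemma coord_vertex:
  assumes u: "u \<in> verts Q" and Z: "Z \<in> carrier B.tensor"
  shows "coord (vertex_class Q \<rho> u c \<odot>\<^bsub>B.tensor\<^esub> Z) j =
    (if word_vertex Q C j = u then scalar c (coord Z j) else \<zero>\<^bsub>V\<^esub>)"
proof -
  note uc = vertex_class_closed[OF u, of c]
  interpret BT: left_module "bound_path_algebra Q \<rho>" B.tensor
    by (rule B.left_module_tensor)
  show ?thesis
    using Z
  proof (induction rule: band_induct)
    case zero
    have "vertex_class Q \<rho> u c \<odot>\<^bsub>B.tensor\<^esub> \<zero>\<^bsub>B.tensor\<^esub> = \<zero>\<^bsub>B.tensor\<^esub>"
      using BT.smult_r_distr[OF uc BT.zero_closed BT.zero_closed] BT.smult_closed[OF uc BT.zero_closed]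
      by (metis BT.add.l_cancel_one' BT.l_zero BT.zero_closed)
    then show ?case
      by (simp add: coord_zero)
  next
    case (pure m v)
    have vert: "word_vertex Q C (j - per * k) = word_vertex Q C j" for k
      using vertex_add_per[of j "- k"] by simp
    have "coeff j (kscale c (klinear_extend (vertex_act Q C u) m)) =
        (if word_vertex Q C j = u then Poly_Mapping.single 0 c * coeff j m else 0)"
      by (rule poly_mapping_eqI) (simp add: lookup_coeff lookup_vertex vert lookup_single_mult)
    then show ?case
      using pure V.smult_assoc1[of "Poly_Mapping.single 0 c" "coeff j m" v] V.smult_l_null[OF pure]
      by (simp add: B.smult_pure[OF uc] vertex_class_smult[OF u] coord(2))
  next
    case (add Y Z)
    then show ?case
      using uc V.smult_r_distr[of "Poly_Mapping.single 0 c" "coord Y j" "coord Z j"]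
      by (simp add: BT.smult_r_distr coord_add BT.smult_closed coord_closed)
  qed
qed

text \<open>The expansion is summed by increasing index. No two indices between 0 and the period are
  congruent, so the coordinate at the next index is still zero when its summand is added.\<close>

lemma band_expand_induct:
  assumes Z: "Z \<in> carrier B.tensor" and zero: "P \<zero>\<^bsub>B.tensor\<^esub>"
    and step: "\<And>Y j v. Y \<in> carrier B.tensor \<Longrightarrow> P Y \<Longrightarrow> v \<in> carrier V \<Longrightarrow> coord Y j = \<zero>\<^bsub>V\<^esub> \<Longrightarrow>
      P (Y \<oplus>\<^bsub>B.tensor\<^esub> basis j v)"
  shows "P Z"
proof -
  obtain f where f: "\<And>i. f i \<in> carrier V"
    "Z = partial_product (tensor_group laurent_ring laurent_module V) (\<lambda>i. basis (int i) (f i)) (period C)"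
    using band_expansion[OF Z] by blast
  define Y where "Y k = partial_product (tensor_group laurent_ring laurent_module V) (\<lambda>i. basis (int i) (f i)) k" for k
  have Y_Suc: "Y (Suc k) = Y k \<oplus>\<^bsub>B.tensor\<^esub> basis (int k) (f k)" and Y_0: "Y 0 = \<zero>\<^bsub>B.tensor\<^esub>" for k
    unfolding Y_def by (simp_all add: B.tensor_simps)
  have Y: "Y k \<in> carrier B.tensor" for k
    unfolding Y_def using basis_closed f(1) by (simp add: B.tensor_simps B.T.partial_product_closed)
  have outside: "coord (Y k) (int j) = \<zero>\<^bsub>V\<^esub>" if "k \<le> j" "j < period C" for k j
    using that
  proof (induction k)
    case 0
    show ?case
      by (simp add: Y_0 coord_zero)
  next
    case (Suc k)
    then have "0 < int j - int k" "int j - int k < per"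
      by simp_all
    then have "\<not> per dvd int j - int k"
      by (simp add: zdvd_not_zless)
    then show ?case
      using Suc f(1) Y basis_closed by (simp add: Y_Suc coord_add coord_basis_other)
  qed
  have "P (Y k)" if "k \<le> period C" for k
    using that
  proof (induction k)
    case 0
    show ?case
      using zero by (simp add: Y_0)
  next
    case (Suc k)
    then show ?case
      unfolding Y_Suc using Y f(1) outside by (intro step) simp_all
  qed
  then show ?thesis
    unfolding f(2) Y_def[symmetric] by simp
qed

lemma word_module_band:
  "word_module Q \<rho> C (band_module Q C V) V per scalar twist basis coord"
  unfolding band_module_eq
proof (intro word_module.intro word_module_axioms.intro string_algebra_word_axioms
    B.left_module_tensor V.abelian_group_axioms letter_add_per_mult coord_shift coord_closed coord_add
    coord_basis_same coord_basis_other basis_closed)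
  show "i \<in> word_index C \<Longrightarrow> i + per * k \<in> word_index C" for i k
    by simp
next
  fix i v w assume "v \<in> carrier V" "w \<in> carrier V"
  then show "basis i (v \<oplus>\<^bsub>V\<^esub> w) = basis i v \<oplus>\<^bsub>B.tensor\<^esub> basis i w"
    unfolding basis_def using B.pure_add_right by (simp add: B.tensor_simps)
next
  fix k l v assume "v \<in> carrier V"
  then show "twist k (twist l v) = twist (k + l) v"
    using V.smult_assoc1[of "Poly_Mapping.single k 1" "Poly_Mapping.single l 1" v] by (simp add: mult_single)
next
  fix x i i' v assume st: "step (letter_at C) x i i'" and v: "v \<in> carrier V"
  show "arrow_class Q \<rho> x \<odot>\<^bsub>B.tensor\<^esub> basis i v = basis i' v"
    unfolding basis_def
    using v B.smult_pure[OF arrow_class_closed[OF step_endpoints(1)[OF st]], of "Poly_Mapping.single i 1" v]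
    by (simp add: arrow_class_smult[OF step_endpoints(1)[OF st]] arrow_act_step[OF st])
next
  fix x i v assume x: "x \<in> arcs Q" and none: "\<nexists>i'. step (letter_at C) x i i'" and v: "v \<in> carrier V"
  show "arrow_class Q \<rho> x \<odot>\<^bsub>B.tensor\<^esub> basis i v = \<zero>\<^bsub>B.tensor\<^esub>"
    unfolding basis_def
    using v B.smult_pure[OF arrow_class_closed[OF x], of "Poly_Mapping.single i 1" v] B.pure_zero_left[OF v]
    by (simp add: arrow_class_smult[OF x] arrow_act_no_step[OF none] B.tensor_simps)
next
  fix x j' j Z assume st: "step (letter_at C) x j' j" and Z: "Z \<in> carrier B.tensor"
  have "step (letter_at C) x (j' - per * k) (j - per * k)" for k
    using step_add_per[OF st, of "- k"] by simp
  then have "coeff j (klinear_extend (arrow_act C x) m) = coeff j' m" for m :: "int \<Rightarrow>\<^sub>0 'k"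
    by (intro poly_mapping_eqI) (simp add: lookup_coeff lookup_arrow)
  then show "coord (arrow_class Q \<rho> x \<odot>\<^bsub>B.tensor\<^esub> Z) j = coord Z j'"
    by (rule coord_arrow[OF step_endpoints(1)[OF st] Z]) (simp_all add: coord(2) coord_zero coord_add)
next
  fix x j Z assume x: "x \<in> arcs Q" and none: "\<nexists>j'. step (letter_at C) x j' j" and Z: "Z \<in> carrier B.tensor"
  have "\<nexists>i. step (letter_at C) x i (j - per * k)" for k
    using none step_add_per[of x _ "j - per * k" k] by fastforce
  then have "coeff j (klinear_extend (arrow_act C x) m) = 0" for m :: "int \<Rightarrow>\<^sub>0 'k"
    by (intro poly_mapping_eqI) (simp add: lookup_coeff lookup_arrow_zero)
  then show "coord (arrow_class Q \<rho> x \<odot>\<^bsub>B.tensor\<^esub> Z) j = \<zero>\<^bsub>V\<^esub>"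
    by (rule coord_arrow[OF x Z]) (use V.smult_l_null in simp_all)
next
  fix i v c assume "i \<in> word_index C" and v: "v \<in> carrier V"
  then have u: "word_vertex Q C i \<in> verts Q"
    by (intro word_vertex_in_verts)
  have "vertex_class Q \<rho> (word_vertex Q C i) c \<odot>\<^bsub>B.tensor\<^esub> basis i v =
      B.pure (Poly_Mapping.single 0 c \<odot>\<^bsub>laurent_module\<^esub> Poly_Mapping.single i 1) v"
    unfolding basis_def laurent_smult_single
    using v B.smult_pure[OF vertex_class_closed[OF u, of c], of "Poly_Mapping.single i 1" v]
    by (simp add: vertex_class_smult[OF u] vertex_act_def)
  also have "\<dots> = basis i (scalar c v)"
    unfolding basis_def using v by (intro B.pure_balanced) simp_all
  finally show "vertex_class Q \<rho> (word_vertex Q C i) c \<odot>\<^bsub>B.tensor\<^esub> basis i v = basis i (scalar c v)" .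
next
  fix u j Z c assume "u \<in> verts Q" "Z \<in> carrier B.tensor"
  then show "coord (vertex_class Q \<rho> u c \<odot>\<^bsub>B.tensor\<^esub> Z) j =
      (if word_vertex Q C j = u then scalar c (coord Z j) else \<zero>\<^bsub>V\<^esub>)"
    by (rule coord_vertex)
next
  fix Z and P :: "((int \<Rightarrow>\<^sub>0 'k) \<times> 'x \<Rightarrow>\<^sub>0 int) set \<Rightarrow> bool"
  assume Z: "Z \<in> carrier B.tensor" and zero: "P \<zero>\<^bsub>B.tensor\<^esub>"
    and step: "\<And>Y j v. Y \<in> carrier B.tensor \<Longrightarrow> P Y \<Longrightarrow> j \<in> word_index C \<Longrightarrow> v \<in> carrier V \<Longrightarrow>
      coord Y j = \<zero>\<^bsub>V\<^esub> \<Longrightarrow> P (Y \<oplus>\<^bsub>B.tensor\<^esub> basis j v)"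
  show "P Z"
    by (rule band_expand_induct[OF Z, where P = P]) (rule zero, rule step, simp_all)
qed (simp_all add: V.smult_closed V.smult_one[simplified] V.smult_r_null)

end

section \<open>Equivalence of words\<close>

text \<open>The sets of letter positions of nontrivial words: the index set without its first
  element, if it has one.\<close>

definition standard_domains :: "int set set" where
  "standard_domains = {{1..n} | n. 1 \<le> n} \<union> {{1..}, {..0}, UNIV}"

text \<open>An end of a word sits at a fixed place: letters start at 1 or stop at 0. A normalised
  domain with an end can therefore be a translate of another only by 0.\<close>

lemma standard_domains_shift:
  assumes A: "A \<in> standard_domains" "A \<noteq> UNIV" and B: "B \<in> standard_domains"
    and shift: "\<And>t. t \<in> B \<longleftrightarrow> t + a \<in> A"
  shows "a = 0"
proof -
  have right: "(\<exists>n\<ge>1. X = {1..n}) \<or> X = {1..} \<or> X = {..0} \<or> X = UNIV" if "X \<in> standard_domains" for X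
    using that unfolding standard_domains_def by blast
  from right[OF A(1)] A(2) consider "1 \<in> A" "\<And>t. t \<in> A \<Longrightarrow> 1 \<le> t" | "A = {..0}"
    by (elim disjE exE conjE) auto
  then show ?thesis
  proof cases
    case 1
    have B1: "1 - a \<in> B"
      using shift[of "1 - a"] 1(1) by simp
    have bound: "1 \<le> t + a" if "t \<in> B" for t
      using that shift 1(2) by blast
    from right[OF B] show ?thesis
    proof (elim disjE exE conjE)
      fix n assume "1 \<le> n" "B = {1..n}"
      then show ?thesis
        using B1 bound[of 1] by simp
    next
      assume "B = {1..}"
      then show ?thesis
        using B1 bound[of 1] by simp
    next
      \<comment> \<open>The witness \<open>min 0 (- a)\<close> lies in \<open>{..0}\<close> and its
        translate is not positive, so a domain unbounded below cannot be moved into one that starts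
        at 1.\<close>
      assume "B = {..0}"
      then show ?thesis
        using bound[of "min 0 (- a)"] by simp
    next
      assume "B = UNIV"
      then show ?thesis
        using bound[of "- a"] by simp
    qed
  next
    case 2
    have B0: "- a \<in> B"
      using shift[of "- a"] 2 by simp
    have bound: "t + a \<le> 0" if "t \<in> B" for t
      using that shift 2 by simp
    have "min 0 (- a) + a \<le> 0"
      by (simp add: min_def)
    then have all0: "min 0 (- a) \<in> B"
      using shift 2 by simp
    from right[OF B] show ?thesis
    proof (elim disjE exE conjE)
      fix n assume "1 \<le> n" "B = {1..n}"
      then show ?thesis
        using all0 by simp
    next
      assume "B = {1..}"
      then show ?thesis
        using all0 by simp
    next
      assume "B = {..0}"
      then show ?thesis
        using B0 bound[of 0] by simp
    next
      assume "B = UNIV"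
      then show ?thesis
        using bound[of "1 - a"] by simp
    qed
  qed
qed

text \<open>The constant in \<open>word_inv\<close> is made for this. As \<open>card\<close> is the
  length of a finite domain and 0 for an infinite one, inversion preserves \<open>{1..n}\<close> and
  exchanges the two half-lines.\<close>

lemma standard_domains_reflect:
  assumes "A \<in> standard_domains"
  shows "{t. int (card A) + 1 - t \<in> A} \<in> standard_domains"
proof -
  have "(\<exists>n\<ge>1. A = {1..n}) \<or> A = {1..} \<or> A = {..0} \<or> A = UNIV"
    using assms unfolding standard_domains_def by blast
  then show ?thesis
  proof (elim disjE exE conjE)
    fix n :: int assume "1 \<le> n" "A = {1..n}"
    then have "{t. int (card A) + 1 - t \<in> A} = {1..n}"
      by auto
    then show ?thesis
      using \<open>1 \<le> n\<close> unfolding standard_domains_def by blast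
  next
    assume "A = {1..}"
    then have "{t. int (card A) + 1 - t \<in> A} = {..0}"
      by (auto simp: infinite_Ici)
    then show ?thesis
      unfolding standard_domains_def by blast
  next
    assume "A = {..0}"
    then have "{t. int (card A) + 1 - t \<in> A} = {1..}"
      by (auto simp: infinite_Iic)
    then show ?thesis
      unfolding standard_domains_def by blast
  qed (simp add: standard_domains_def)
qed

section \<open>Rigidity of a single word\<close>

context string_algebra_word
begin

lemma dom_standard:
  assumes "C = Letters c"
  shows "dom c \<in> standard_domains"
proof -
  obtain I where I: "I \<in> index_sets" "I \<noteq> {0}" "\<And>i. c i \<noteq> None \<longleftrightarrow> i \<in> I \<and> i - 1 \<in> I"
    by (rule dom_letters[OF assms]) blast
  have dom: "dom c = {i. i \<in> I \<and> i - 1 \<in> I}"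
    using I(3) by (auto simp: dom_def)
  from I(1) consider n where "I = {0..n}" "0 \<le> n" | "I = {0..}" | "I = {..0}" | "I = UNIV"
    unfolding index_sets_def by blast
  then show ?thesis
  proof cases
    case 1
    then have "dom c = {1..n}"
      unfolding dom by auto
    moreover have "1 \<le> n"
      using 1 I(2) by (cases "n = 0") auto
    ultimately show ?thesis
      unfolding standard_domains_def by blast
  next
    case 2
    then have "dom c = {1..}"
      unfolding dom by auto
    then show ?thesis
      unfolding standard_domains_def by blast
  next
    case 3
    then have "dom c = {..0}"
      unfolding dom by auto
    then show ?thesis
      unfolding standard_domains_def by blast
  next
    case 4
    then have "dom c = UNIV"
      unfolding dom by auto
    then show ?thesis
      unfolding standard_domains_def by blast
  qed
qed

lemma index_nonempty: "\<exists>i. i \<in> word_index C"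
  unfolding word_index_iff by blast

lemma has_letter: "C = Letters c \<Longrightarrow> \<exists>i. c i \<noteq> None"
proof -
  assume C: "C = Letters c"
  obtain i where "i \<in> word_index C"
    using index_nonempty by blast
  then show ?thesis
    unfolding C by auto
qed

lemma word_shift_self:
  assumes "\<And>t. letter_at C (t + m) = letter_at C t"
  shows "word_shift C m = C"
  using assms by (cases C) auto

text \<open>A nonzero difference would translate the letters into themselves; by convexity a single
  letter then spreads over all integers and the word is periodic. Divisibility by 0 is the form that
  \<open>rigid\<close> takes for \<open>n = 0\<close>.\<close>

lemma nonperiodic_rigid:
  assumes np: "\<not> periodic C" and ij: "i \<in> word_index C" "j \<in> word_index C"
    and sims: "sim (letter_at C) (letter_at C) i j" "sim (letter_at C) (letter_at C) j i"
  shows "0 dvd j - i"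
proof (cases "letter_at C = (\<lambda>_. None)")
  case True
  then have "i = 0" "j = 0"
    using ij unfolding word_index_iff by simp_all
  then show ?thesis
    by simp
next
  case False
  have tr: "letter_at C (t + (j - i)) = letter_at C t" for t
    by (rule self_sim_translation[OF sims reduced_letters convex_letters word_index_positions[OF ij(1)]
        word_index_positions[OF ij(2)] False])
  show ?thesis
  proof (rule ccontr)
    assume "\<not> 0 dvd j - i"
    then have ne: "j - i \<noteq> 0"
      by simp
    have multiple: "letter_at C (t + (j - i) * k) = letter_at C t" for t k
      by (rule translation_multiple) (rule tr)
    obtain p where p: "letter_at C p \<noteq> None"
      using False by (auto simp: fun_eq_iff)
    have all: "letter_at C t \<noteq> None" for t
    proof -
      \<comment> \<open>A multiple of \<open>j - i\<close>, made nonnegative by the sign, that is at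
        least the distance from \<open>p\<close> to \<open>t\<close>. Thus \<open>t\<close> lies
        between two translates of the letter at \<open>p\<close>.\<close>
      define K where "K = (j - i) * sgn (j - i) * \<bar>t - p\<bar>"
      have "K = \<bar>j - i\<bar> * \<bar>t - p\<bar>"
        unfolding K_def by (simp add: abs_sgn)
      moreover have "1 * \<bar>t - p\<bar> \<le> \<bar>j - i\<bar> * \<bar>t - p\<bar>"
        using ne by (intro mult_right_mono) auto
      ultimately have "\<bar>t - p\<bar> \<le> K"
        by simp
      then have "p - K \<le> t" "t \<le> p + K"
        by linarith+
      moreover have "letter_at C (p + K) = letter_at C p" "letter_at C (p - K) = letter_at C p"
        using multiple[of p "sgn (j - i) * \<bar>t - p\<bar>"] multiple[of p "- (sgn (j - i) * \<bar>t - p\<bar>)"]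
        unfolding K_def by (simp_all add: mult.assoc)
      ultimately show ?thesis
        using convex_letters p unfolding convex_dom_def by metis
    qed
    have "word_index C = UNIV"
      using all word_index_iff by blast
    moreover have "\<bar>j - i\<bar> > 0"
      using ne by simp
    moreover have "C = word_shift C \<bar>j - i\<bar>"
    proof (rule word_shift_self[symmetric])
      fix t
      show "letter_at C (t + \<bar>j - i\<bar>) = letter_at C t"
        using multiple[of t "sgn (j - i)"] by (simp add: abs_sgn)
    qed
    ultimately have "periodic C"
      unfolding periodic_def by blast
    with np show False ..
  qed
qed

end

text \<open>The remainder of \<open>j - i\<close> modulo the period is again a translation
  preserving the word, and minimality of the period forces it to be 0.\<close>

lemma (in periodic_word_module) period_rigid:
  assumes sims: "sim (letter_at C) (letter_at C) i j" "sim (letter_at C) (letter_at C) j i"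
  shows "per dvd j - i"
proof -
  \<comment> \<open>Any nonzero index serves: a word without letters has 0 as its only
    position.\<close>
  have "(5 :: int) \<in> word_index C"
    by simp
  then have "letter_at C \<noteq> (\<lambda>_. None)"
    unfolding word_index_iff by auto
  then have tr: "letter_at C (t + (j - i)) = letter_at C t" for t
    by (intro self_sim_translation[OF sims reduced_letters convex_letters]) (auto intro: word_index_positions)
  define r where "r = (j - i) mod per"
  have r: "0 \<le> r" "r < per"
    unfolding r_def using period_properties(1) by simp_all
  have "letter_at C (t + r) = letter_at C t" for t
  proof -
    have "t + r = (t + (j - i)) + per * - ((j - i) div per)"
      unfolding r_def by (simp add: minus_mult_div_eq_mod[symmetric])
    then show ?thesis
      using letter_add_per_mult[of "t + (j - i)" "- ((j - i) div per)"] tr by (simp only:)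
  qed
  then have shift: "C = word_shift C (int (nat r))"
    using word_shift_self[of r] r(1) by simp
  have "nat r < (LEAST k. 0 < k \<and> C = word_shift C (int k))"
    using r unfolding period_def by simp
  then have "\<not> (0 < nat r \<and> C = word_shift C (int (nat r)))"
    by (rule not_less_Least)
  then have "\<not> 0 < nat r"
    using shift by (intro notI) (erule notE, rule conjI)
  then show ?thesis
    using r(1) unfolding r_def by auto
qed

section \<open>Equivalence from mutual simulation\<close>

context string_algebra
begin

text \<open>Alignment determines the letters up to translation and direction. For words that do not
  extend over all integers the normalised ends force the translation to be 0, in accordance with the
  convention for shifts.\<close>

lemma word_equiv_of_sim:
  assumes C: "is_word Q \<rho> C" and D: "is_word Q \<rho> D" and i: "i \<in> word_index C" and j: "j \<in> word_index D"
    and sims: "sim (letter_at C) (letter_at D) i j" "sim (letter_at D) (letter_at C) j i"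
    and vert: "word_vertex Q D j = word_vertex Q C i"
  shows "word_equiv C D"
proof -
  interpret C: string_algebra_word Q \<rho> C
    by unfold_locales (rule C)
  interpret D: string_algebra_word Q \<rho> D
    by unfold_locales (rule D)
  have align: "(\<forall>t. letter_at C (i + t) = letter_at D (j + t)) \<or>
      (\<forall>t. letter_at C (i + t) = map_option letter_inv (letter_at D (j + 1 - t)))"
    by (rule sim_aligned[OF sims C.reduced_letters D.reduced_letters C.convex_letters D.convex_letters
        C.word_index_positions[OF i] D.word_index_positions[OF j]])
  have iff: "(\<exists>t. letter_at C t \<noteq> None) \<longleftrightarrow> (\<exists>t. letter_at D t \<noteq> None)"
  proof -
    have "\<exists>u. letter_at C t \<noteq> None \<longleftrightarrow> letter_at D u \<noteq> None" for t
    proof -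
      have "letter_at C (i + (t - i)) = letter_at C t"
        by simp
      then show ?thesis
        using align by (metis option.map_disc_iff)
    qed
    moreover have "\<exists>u. letter_at D t \<noteq> None \<longleftrightarrow> letter_at C u \<noteq> None" for t
    proof -
      have "letter_at D (j + (t - j)) = letter_at D t" "letter_at D (j + 1 - (j + 1 - t)) = letter_at D t"
        by simp_all
      then show ?thesis
        using align by (metis option.map_disc_iff)
    qed
    ultimately show ?thesis
      by metis
  qed
  show ?thesis
  proof (cases C)
    \<comment> \<open>Without letters a simulation carries no information. The hypothesis on
      vertices identifies the two words up to sign, and inversion changes the sign.\<close>
    case (Trivial v \<epsilon>)
    then obtain v' \<epsilon>' where D': "D = Trivial v' \<epsilon>'"
      using iff D.has_letter by (cases D) auto
    have "v' = v" "\<epsilon> = 1 \<or> \<epsilon> = -1" "\<epsilon>' = 1 \<or> \<epsilon>' = -1"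
      using vert C D unfolding Trivial D' by simp_all
    then show ?thesis
      unfolding word_equiv_def Trivial D' by auto
  next
    case (Letters c)
    then have "\<exists>t. letter_at D t \<noteq> None"
      using iff C.has_letter by simp
    then obtain d where d: "D = Letters d"
      by (cases D) auto
    note std = C.dom_standard[OF Letters] D.dom_standard[OF d]
    from align show ?thesis
    proof
      assume eq: "\<forall>t. letter_at C (i + t) = letter_at D (j + t)"
      have dt: "d t = c (t + (i - j))" for t
      proof -
        have "letter_at C (i + (t - j)) = letter_at D (j + (t - j))"
          using eq by blast
        moreover have "i + (t - j) = t + (i - j)" "j + (t - j) = t"
          by simp_all
        ultimately show ?thesis
          unfolding Letters d letter_at.simps by metis
      qed
      show ?thesis
      proof (cases "dom c = UNIV")
        case True
        then have "word_index C = UNIV"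
          unfolding Letters by auto
        then have "D = word_shift C (i - j)"
          unfolding Letters d using dt by (simp add: fun_eq_iff)
        then show ?thesis
          unfolding word_equiv_def by blast
      next
        case False
        have "t \<in> dom d \<longleftrightarrow> t + (i - j) \<in> dom c" for t
          unfolding dom_def using dt[of t] by simp
        then have "i - j = 0"
          by (rule standard_domains_shift[OF std(1) False std(2)])
        then have "D = word_shift C 0"
          unfolding Letters d using dt by (simp add: fun_eq_iff)
        then show ?thesis
          unfolding word_equiv_def by blast
      qed
    next
      assume eq: "\<forall>t. letter_at C (i + t) = map_option letter_inv (letter_at D (j + 1 - t))"
      \<comment> \<open>The constant of \<open>word_inv\<close>. Relative to the inverse word, the
        reversing alignment becomes a translation by \<open>N - i - j\<close>.\<close>
      define N where "N = int (card (dom c))"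
      define e where "e = (\<lambda>t. map_option letter_inv (c (N + 1 - t)))"
      have inv: "word_inv C = Letters e"
        unfolding Letters e_def N_def by simp
      have dt: "d t = e (t + (N - i - j))" for t
      proof -
        have "letter_at C (i + (j + 1 - t)) = map_option letter_inv (letter_at D (j + 1 - (j + 1 - t)))"
          using eq by blast
        moreover have "i + (j + 1 - t) = N + 1 - (t + (N - i - j))" "j + 1 - (j + 1 - t) = t"
          by simp_all
        ultimately have "c (N + 1 - (t + (N - i - j))) = map_option letter_inv (d t)"
          unfolding Letters d letter_at.simps by metis
        moreover have "map_option letter_inv (map_option letter_inv (d t)) = d t"
          by (simp add: option.map_comp o_def option.map_ident)
        ultimately show ?thesis
          unfolding e_def by (simp only:)
      qed
      have dom_e: "dom e = {t. N + 1 - t \<in> dom c}"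
        unfolding e_def by (auto simp: dom_def)
      have std_e: "dom e \<in> standard_domains"
        unfolding dom_e N_def by (rule standard_domains_reflect[OF std(1)])
      show ?thesis
      proof (cases "dom e = UNIV")
        case True
        then have "word_index (word_inv C) = UNIV"
          unfolding inv by auto
        then have "D = word_shift (word_inv C) (N - i - j)"
          unfolding inv d using dt by (simp add: fun_eq_iff)
        then show ?thesis
          unfolding word_equiv_def by blast
      next
        case False
        have "t \<in> dom d \<longleftrightarrow> t + (N - i - j) \<in> dom e" for t
          unfolding dom_def using dt[of t] by simp
        then have "N - i - j = 0"
          by (rule standard_domains_shift[OF std_e False std(2)])
        then have "D = word_shift (word_inv C) 0"
          unfolding inv d using dt by (simp add: fun_eq_iff)
        then show ?thesis
          unfolding word_equiv_def by blast
      qed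
    qed
  qed
qed

end

text \<open>The part of a transport between modules that concerns the words alone, independent of
  coefficients.\<close>

definition aligned ::
  "('v, 'e) pre_digraph \<Rightarrow> ('v, 'e) word \<Rightarrow> ('v, 'e) word \<Rightarrow> int \<Rightarrow> int \<Rightarrow> bool" where
  "aligned Q C D s \<epsilon> \<longleftrightarrow> \<epsilon> * \<epsilon> = 1 \<and>
     (\<forall>x i i'. step (letter_at C) x i i' \<longleftrightarrow> step (letter_at D) x (s + \<epsilon> * i) (s + \<epsilon> * i')) \<and>
     (\<forall>i. i \<in> word_index C \<longleftrightarrow> s + \<epsilon> * i \<in> word_index D) \<and>
     (\<forall>i\<in>word_index C. word_vertex Q D (s + \<epsilon> * i) = word_vertex Q C i)"

section \<open>Alignments between equivalent words\<close>

lemma aligned_translation: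
  assumes "\<And>t. d (s + t) = c t"
  shows "aligned Q (Letters c) (Letters d) s 1"
proof -
  have next_eq: "d (s + t + 1) = c (t + 1)" for t
    using assms[of "t + 1"] by (simp only: add.assoc)
  show ?thesis
    unfolding aligned_def step_def by (auto simp: assms next_eq split: option.split)
qed

text \<open>Position \<open>t\<close> goes to \<open>s - t\<close>, so the letter joining
  \<open>t - 1\<close> and \<open>t\<close> gets index \<open>s + 1 - t\<close>. The vertex of a
  position is then read from the letter on its other side, which is where compatibility of adjacent
  letters enters.\<close>

lemma aligned_reflection:
  assumes word: "is_word Q \<rho> (Letters c)" and refl: "\<And>t. d (s + 1 - t) = map_option letter_inv (c t)"
  shows "aligned Q (Letters c) (Letters d) s (- 1)"
proof -
  have at: "d (s - t) = map_option letter_inv (c (t + 1))" and next_eq: "d (s - t + 1) = map_option letter_inv (c t)" for t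
  proof -
    have "s + 1 - (t + 1) = s - t" "s + 1 - t = s - t + 1"
      by simp_all
    then show "d (s - t) = map_option letter_inv (c (t + 1))" "d (s - t + 1) = map_option letter_inv (c t)"
      using refl[of "t + 1"] refl[of t] by (simp_all only:)
  qed
  have inv: "letter_inv l = Direct x \<longleftrightarrow> l = Inverse x" "letter_inv l = Inverse x \<longleftrightarrow> l = Direct x"
    "letter_tail Q (letter_inv l) = letter_head Q l" "letter_head Q (letter_inv l) = letter_tail Q l" for l x
    by (cases l; simp)+
  have adjacent: "letter_tail Q l = letter_head Q l'" if "c i = Some l" "c (i + 1) = Some l'" for i l l'
    using word that by simp
  have "step (letter_at (Letters c :: ('a, 'b) word)) x i i' \<longleftrightarrow>
      step (letter_at (Letters d :: ('a, 'b) word)) x (s - i) (s - i')" for x i i'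
    unfolding step_def letter_at.simps at next_eq by (auto simp: inv)
  moreover have "s - i \<in> word_index (Letters d :: ('a, 'b) word) \<longleftrightarrow> i \<in> word_index (Letters c :: ('a, 'b) word)" for i
    by (auto simp: at next_eq)
  moreover have "word_vertex Q (Letters d) (s - i) = word_vertex Q (Letters c) i"
    if "i \<in> word_index (Letters c :: ('a, 'b) word)" for i
    using that adjacent by (auto simp: at next_eq inv split: option.split)
  ultimately show ?thesis
    unfolding aligned_def by simp
qed

lemma aligned_shift: "\<exists>s. aligned Q C (word_shift C m) s 1"
proof (cases C)
  case (Letters c)
  show ?thesis
  proof (cases "word_index C = UNIV")
    case True
    then have "word_shift C m = Letters (\<lambda>i. c (i + m))"
      unfolding Letters by simp
    then show ?thesis
      unfolding Letters using aligned_translation[of "\<lambda>i. c (i + m)" "- m" c Q] by auto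
  next
    case False
    then have "word_shift C m = C"
      unfolding Letters by simp
    then show ?thesis
      unfolding Letters using aligned_translation[of c 0 c Q] by auto
  qed
qed (auto simp: aligned_def intro!: exI[of _ 0])

lemma aligned_inverse_shift:
  assumes "is_word Q \<rho> C"
  shows "\<exists>s. aligned Q C (word_shift (word_inv C) m) s (- 1)"
proof (cases C)
  case (Trivial v \<epsilon>)
  then show ?thesis
    by (auto simp: aligned_def step_def intro!: exI[of _ 0])
next
  case (Letters c)
  define N where "N = int (card (dom c))"
  define e where "e = (\<lambda>t. map_option letter_inv (c (N + 1 - t)))"
  have inv: "word_inv C = Letters e"
    unfolding Letters e_def N_def by simp
  show ?thesis
  proof (cases "word_index (word_inv C) = UNIV")
    case True
    then have D: "word_shift (word_inv C) m = Letters (\<lambda>t. e (t + m))"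
      unfolding inv by simp
    have "aligned Q (Letters c) (Letters (\<lambda>t. e (t + m))) (N - m) (- 1)"
      by (rule aligned_reflection) (use assms Letters in \<open>auto simp: e_def\<close>)
    then show ?thesis
      unfolding D unfolding Letters by blast
  next
    case False
    then have D: "word_shift (word_inv C) m = Letters e"
      unfolding inv by simp
    have "aligned Q (Letters c) (Letters e) N (- 1)"
      by (rule aligned_reflection) (use assms Letters in \<open>auto simp: e_def\<close>)
    then show ?thesis
      unfolding D unfolding Letters by blast
  qed
qed

section \<open>Periodicity of equivalent words\<close>

lemma word_shift_eq_iff:
  assumes "word_index C = UNIV"
  shows "C = word_shift C k \<longleftrightarrow> (\<forall>t. letter_at C (t + k) = letter_at C t)"
proof (cases C)
  case (Trivial v \<epsilon>)
  have "(1 :: int) \<in> word_index C"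
    unfolding assms by simp
  then show ?thesis
    unfolding Trivial by simp
next
  case (Letters c)
  then show ?thesis
    using assms unfolding Letters by (auto simp: fun_eq_iff)
qed

text \<open>Periodicity and the period of a word indexed by all integers depend only on which
  translations preserve its letters.\<close>

lemma periodic_transfer:
  assumes C: "periodic C" and D: "word_index D = UNIV"
    and same: "\<And>k. (\<forall>t. letter_at D (t + k) = letter_at D t) \<longleftrightarrow> (\<forall>t. letter_at C (t + k) = letter_at C t)"
  shows "periodic D" "period D = period C"
proof -
  have CU: "word_index C = UNIV"
    using C unfolding periodic_def by blast
  have "D = word_shift D k \<longleftrightarrow> C = word_shift C k" for k
    unfolding word_shift_eq_iff[OF CU] word_shift_eq_iff[OF D] by (rule same)
  then show "periodic D" "period D = period C"
    using C D unfolding periodic_def period_def by simp_all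
qed

lemma periodic_shift:
  assumes "periodic C"
  shows "periodic (word_shift C m)" "period (word_shift C m) = period C"
proof -
  have U: "word_index C = UNIV"
    using assms unfolding periodic_def by blast
  have "(1 :: int) \<in> word_index C"
    unfolding U by simp
  then obtain c where c: "C = Letters c"
    by (cases C) auto
  have D: "word_shift C m = Letters (\<lambda>i. c (i + m))"
    using U unfolding c by simp
  have index: "word_index (word_shift C m) = UNIV"
  proof -
    have "c (i + m) \<noteq> None \<or> c (i + m + 1) \<noteq> None" for i
      using U unfolding c by (auto simp: set_eq_iff)
    then show ?thesis
      unfolding D by (auto simp: add.assoc add.commute[of m])
  qed
  have same: "(\<forall>t. letter_at (word_shift C m) (t + k) = letter_at (word_shift C m) t) \<longleftrightarrow>
      (\<forall>t. letter_at C (t + k) = letter_at C t)" for k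
  proof -
    have "(\<forall>t. c (t + k + m) = c (t + m)) \<longleftrightarrow> (\<forall>t. c (t + k) = c t)"
    proof (intro iffI allI)
      fix t assume "\<forall>t. c (t + k + m) = c (t + m)"
      then have "c (t - m + k + m) = c (t - m + m)"
        by blast
      moreover have "t - m + k + m = t + k" "t - m + m = t"
        by simp_all
      ultimately show "c (t + k) = c t"
        by metis
    next
      fix t assume "\<forall>t. c (t + k) = c t"
      then have "c (t + m + k) = c (t + m)"
        by blast
      moreover have "t + m + k = t + k + m"
        by simp
      ultimately show "c (t + k + m) = c (t + m)"
        by metis
    qed
    then show ?thesis
      unfolding D unfolding c by simp
  qed
  show "periodic (word_shift C m)" "period (word_shift C m) = period C"
    by (rule periodic_transfer[OF assms index same])+
qed

lemma periodic_inverse: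
  assumes "periodic C"
  shows "periodic (word_inv C)" "period (word_inv C) = period C"
proof -
  have U: "word_index C = UNIV"
    using assms unfolding periodic_def by blast
  have "(1 :: int) \<in> word_index C"
    unfolding U by simp
  then obtain c where c: "C = Letters c"
    by (cases C) auto
  define N where "N = int (card (dom c))"
  have D: "word_inv C = Letters (\<lambda>t. map_option letter_inv (c (N + 1 - t)))"
    unfolding c N_def by simp
  have index: "word_index (word_inv C) = UNIV"
  proof -
    have "c (N + 1 - i) \<noteq> None \<or> c (N + 1 - (i + 1)) \<noteq> None" for i
    proof -
      have "N - i \<in> word_index C"
        unfolding U by simp
      moreover have "N + 1 - (i + 1) = N - i" "N + 1 - i = N - i + 1"
        by simp_all
      ultimately show ?thesis
        unfolding c by (simp only: word_index.simps mem_Collect_eq) blast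
    qed
    then show ?thesis
      unfolding D by auto
  qed
  have same: "(\<forall>t. letter_at (word_inv C) (t + k) = letter_at (word_inv C) t) \<longleftrightarrow>
      (\<forall>t. letter_at C (t + k) = letter_at C t)" for k
  proof -
    have "(\<forall>t. c (N + 1 - (t + k)) = c (N + 1 - t)) \<longleftrightarrow> (\<forall>t. c (t + k) = c t)"
    proof (intro iffI allI)
      fix t assume "\<forall>t. c (N + 1 - (t + k)) = c (N + 1 - t)"
      then have "c (N + 1 - (N + 1 - t - k + k)) = c (N + 1 - (N + 1 - t - k))"
        by blast
      moreover have "N + 1 - (N + 1 - t - k + k) = t" "N + 1 - (N + 1 - t - k) = t + k"
        by simp_all
      ultimately show "c (t + k) = c t"
        by metis
    next
      fix t assume "\<forall>t. c (t + k) = c t"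
      then have "c (N + 1 - (t + k) + k) = c (N + 1 - (t + k))"
        by blast
      moreover have "N + 1 - (t + k) + k = N + 1 - t"
        by simp
      ultimately show "c (N + 1 - (t + k)) = c (N + 1 - t)"
        by metis
    qed
    moreover have "map_option letter_inv x = map_option letter_inv y \<longleftrightarrow> x = y" for x y :: "'b letter option"
      using inj_map_option_letter_inv by (auto dest: injD)
    ultimately show ?thesis
      unfolding D unfolding c letter_at.simps by simp
  qed
  show "periodic (word_inv C)" "period (word_inv C) = period C"
    by (rule periodic_transfer[OF assms index same])+
qed

section \<open>Isomorphisms of modules\<close>

lemma linear_inverse:
  assumes h: "h \<in> linear_maps A M N" and bij: "bij_betw h (carrier M) (carrier N)"
    and add_closed: "\<And>x y. x \<in> carrier M \<Longrightarrow> y \<in> carrier M \<Longrightarrow> x \<oplus>\<^bsub>M\<^esub> y \<in> carrier M"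
    and smult_closed: "\<And>a x. a \<in> carrier A \<Longrightarrow> x \<in> carrier M \<Longrightarrow> a \<odot>\<^bsub>M\<^esub> x \<in> carrier M"
  obtains g where "g \<in> linear_maps A N M" "bij_betw g (carrier N) (carrier M)"
    "\<And>m. m \<in> carrier M \<Longrightarrow> g (h m) = m" "\<And>m. m \<in> carrier N \<Longrightarrow> h (g m) = m"
proof
  let ?g = "inv_into (carrier M) h"
  show bij': "bij_betw ?g (carrier N) (carrier M)"
    by (rule bij_betw_inv_into[OF bij])
  show gh: "?g (h m) = m" if "m \<in> carrier M" for m
    by (rule bij_betw_inv_into_left[OF bij that])
  show hg: "h (?g m) = m" if "m \<in> carrier N" for m
    by (rule bij_betw_inv_into_right[OF bij that])
  have closed: "?g x \<in> carrier M" if "x \<in> carrier N" for x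
    by (rule bij_betw_apply[OF bij' that])
  show "?g \<in> linear_maps A N M"
  proof (rule linear_mapsI)
    fix x y assume x: "x \<in> carrier N" and y: "y \<in> carrier N"
    have "?g (h (?g x \<oplus>\<^bsub>M\<^esub> ?g y)) = ?g x \<oplus>\<^bsub>M\<^esub> ?g y"
      using x y by (intro gh add_closed closed)
    then show "?g (x \<oplus>\<^bsub>N\<^esub> y) = ?g x \<oplus>\<^bsub>M\<^esub> ?g y"
      unfolding linear_maps_add[OF h closed[OF x] closed[OF y]] hg[OF x] hg[OF y] .
  next
    fix a x assume a: "a \<in> carrier A" and x: "x \<in> carrier N"
    have "?g (h (a \<odot>\<^bsub>M\<^esub> ?g x)) = a \<odot>\<^bsub>M\<^esub> ?g x"
      using a x by (intro gh smult_closed closed)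
    then show "?g (a \<odot>\<^bsub>N\<^esub> x) = a \<odot>\<^bsub>M\<^esub> ?g x"
      unfolding linear_maps_smult[OF h a closed[OF x]] hg[OF x] .
  qed (rule closed)
qed

lemma (in left_module) isomorphism_pair:
  assumes "module_isomorphic A M N"
  obtains h g where "h \<in> linear_maps A M N" "g \<in> linear_maps A N M" "bij_betw g (carrier N) (carrier M)"
    "\<And>m. m \<in> carrier M \<Longrightarrow> g (h m) = m" "\<And>m. m \<in> carrier N \<Longrightarrow> h (g m) = m"
proof -
  obtain h where h: "h \<in> linear_maps A M N" "bij_betw h (carrier M) (carrier N)"
    using assms unfolding module_isomorphic_def by blast
  show thesis
    by (rule linear_inverse[OF h a_closed smult_closed], assumption+) (rule that[OF h(1)], assumption+)
qed

lemma (in left_module) module_isomorphic_sym: "module_isomorphic A M N \<Longrightarrow> module_isomorphic A N M"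
  by (erule isomorphism_pair) (auto simp: module_isomorphic_def)

lemma (in Module.module) module_isomorphic_sym:
  assumes "module_isomorphic R M N"
  shows "module_isomorphic R N M"
proof -
  obtain h where h: "h \<in> linear_maps R M N" "bij_betw h (carrier M) (carrier N)"
    using assms unfolding module_isomorphic_def by blast
  show ?thesis
    by (rule linear_inverse[OF h a_closed smult_closed]) (auto simp: module_isomorphic_def)
qed

lemma module_isomorphic_trans:
  assumes "module_isomorphic A M N" "module_isomorphic A N K"
  shows "module_isomorphic A M K"
proof -
  obtain h where h: "h \<in> linear_maps A M N" "bij_betw h (carrier M) (carrier N)"
    using assms unfolding module_isomorphic_def by blast
  obtain g where g: "g \<in> linear_maps A N K" "bij_betw g (carrier N) (carrier K)"
    using assms unfolding module_isomorphic_def by blast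
  have "g \<circ> h \<in> linear_maps A M K"
    by (rule linear_mapsI)
      (simp_all add: linear_maps_closed[OF h(1)] linear_maps_closed[OF g(1)] linear_maps_add[OF h(1)]
        linear_maps_add[OF g(1)] linear_maps_smult[OF h(1)] linear_maps_smult[OF g(1)])
  then show ?thesis
    unfolding module_isomorphic_def using bij_betw_trans[OF h(2) g(2)] by blast
qed

lemma module_isomorphic_refl: "module_isomorphic A M M"
  unfolding module_isomorphic_def by (intro bexI[of _ "\<lambda>x. x"] linear_mapsI) (simp_all add: bij_betw_def)

lemma aligned_isomorphic:
  assumes M: "word_module Q \<rho> C M V n \<kappa> \<tau> emb co" and N: "word_module Q \<rho> D N W n \<kappa>' \<tau>' emb' co'"
    and aligned: "aligned Q C D s \<epsilon>" and bij: "bij_betw \<theta> (carrier V) (carrier W)"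
    and add: "\<And>v w. v \<in> carrier V \<Longrightarrow> w \<in> carrier V \<Longrightarrow> \<theta> (v \<oplus>\<^bsub>V\<^esub> w) = \<theta> v \<oplus>\<^bsub>W\<^esub> \<theta> w"
    and scalar: "\<And>c v. v \<in> carrier V \<Longrightarrow> \<theta> (\<kappa> c v) = \<kappa>' c (\<theta> v)"
    and twist: "\<And>k v. v \<in> carrier V \<Longrightarrow> \<theta> (\<tau> k v) = \<tau>' (\<epsilon> * k) (\<theta> v)"
  shows "module_isomorphic (bound_path_algebra Q \<rho>) M N"
proof -
  interpret word_module_transport Q \<rho> C D M N V W n \<kappa> \<kappa>' \<tau> \<tau>' emb emb' co co' s \<epsilon> \<theta>
    using aligned unfolding aligned_def
    by (intro word_module_transport.intro word_module_transport_axioms.intro M N bij add scalar twist) blast+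
  show ?thesis
    by (rule isomorphic)
qed

text \<open>Applying \<open>g h = 1\<close> to one nonzero vector gives two positions that simulate
  each other. As this relation is symmetric, the same two positions yield the equivalence in both
  directions.\<close>

lemma word_equiv_of_isomorphic:
  assumes M: "word_module Q \<rho> C M V n \<kappa> \<tau> emb co" and N: "word_module Q \<rho> D N W n' \<kappa>' \<tau>' emb' co'"
    and iso: "module_isomorphic (bound_path_algebra Q \<rho>) M N" and nonzero: "carrier V \<noteq> {\<zero>\<^bsub>V\<^esub>}"
  shows "word_equiv C D" "word_equiv D C"
proof -
  interpret M: word_module Q \<rho> C M V n \<kappa> \<tau> emb co
    by (rule M)
  interpret N: word_module Q \<rho> D N W n' \<kappa>' \<tau>' emb' co'
    by (rule N)
  obtain h g where hg: "h \<in> linear_maps (bound_path_algebra Q \<rho>) M N" "g \<in> linear_maps (bound_path_algebra Q \<rho>) N M"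
    "\<And>m. m \<in> carrier M \<Longrightarrow> g (h m) = m"
    by (rule M.M.isomorphism_pair[OF iso]) blast
  interpret P: word_module_hom_pair Q \<rho> C D M N V W n n' \<kappa> \<kappa>' \<tau> \<tau>' emb emb' co co' h g
    by (intro word_module_hom_pair.intro word_module_hom.intro word_module_hom_axioms.intro M N hg)
  obtain i where i: "i \<in> word_index C"
    using M.index_nonempty by blast
  obtain v where v: "v \<in> carrier V" "v \<noteq> \<zero>\<^bsub>V\<^esub>"
    using nonzero M.V.zero_closed by blast
  have "co (g (h (emb i v))) i \<noteq> \<zero>\<^bsub>V\<^esub>"
    using v hg(3)[OF M.emb_closed[OF i v(1)]] M.co_emb_same[OF i v(1)] by simp
  from P.sim_of_retraction[OF i v(1) this] obtain j where j: "j \<in> word_index D" "sim (letter_at C) (letter_at D) i j"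
    "sim (letter_at D) (letter_at C) j i" "word_vertex Q D j = word_vertex Q C i" .
  note words = M.word N.word
  show "word_equiv C D"
    by (rule M.word_equiv_of_sim[OF words i j])
  show "word_equiv D C"
    by (rule M.word_equiv_of_sim[OF words(2,1) j(1) i j(3,2) j(4)[symmetric]])
qed

lemma periodic_word_equiv:
  assumes "periodic C" "word_equiv C D"
  shows "periodic D" "period D = period C"
  using assms periodic_shift[OF assms(1)] periodic_shift[OF periodic_inverse(1)[OF assms(1)]]
    periodic_inverse(2)[OF assms(1)] unfolding word_equiv_def by auto

lemma word_equiv_aligned:
  assumes "is_word Q \<rho> C" "word_equiv C D"
  shows "\<exists>s \<epsilon>. aligned Q C D s \<epsilon>"
  using assms(2) aligned_shift[of Q C] aligned_inverse_shift[OF assms(1)] unfolding word_equiv_def by blast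

section \<open>Indecomposability and isomorphisms of string modules\<close>

lemma scalar_group_nonzero: "carrier (scalar_group :: 'k::field ring) \<noteq> {\<zero>\<^bsub>scalar_group\<^esub>}"
proof
  assume "carrier (scalar_group :: 'k ring) = {\<zero>\<^bsub>scalar_group\<^esub>}"
  moreover have "(1 :: 'k) \<in> carrier scalar_group"
    by simp
  ultimately have "(1 :: 'k) \<in> {\<zero>\<^bsub>scalar_group\<^esub>}"
    by (simp only:)
  then show False
    by simp
qed

lemma (in string_algebra_word) indecomposable_string_module:
  assumes "\<not> periodic C"
  shows "indecomposable (bound_path_algebra Q \<rho>) (string_module Q C :: (_, int \<Rightarrow>\<^sub>0 'k::field) module)"
proof -
  obtain i where i: "i \<in> word_index C"
    using index_nonempty by blast
  show ?thesis
  proof (rule word_module.indecomposableI[OF word_module_string nonperiodic_rigid[OF assms] _ i])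
    show "carrier (scalar_group :: 'k ring) \<noteq> {\<zero>\<^bsub>scalar_group\<^esub>}"
      by (rule scalar_group_nonzero)
  next
    fix a :: "'k \<Rightarrow> 'k"
    assume lin: "twisted_linear scalar_group scalar_group (*) (*) (\<lambda>k v. v) (\<lambda>k v. v) a"
      and idem: "\<And>v. v \<in> carrier scalar_group \<Longrightarrow> a (a v) = a v"
    have mult: "a (c * v) = c * a v" for c v
      using lin unfolding twisted_linear_def by simp
    have a: "a v = v * a 1" for v
      using mult[of v 1] by simp
    \<comment> \<open>A linear map of \<open>k\<close> is multiplication by its value at 1, and an
      idempotent element of a field is 0 or 1.\<close>
    have "a 1 * a 1 = a 1"
      using idem[of 1] a[of "a 1"] by simp
    then have "a 1 = 0 \<or> a 1 = 1"
      by simp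
    then show "(\<forall>v\<in>carrier scalar_group. a v = \<zero>\<^bsub>scalar_group\<^esub>) \<or> (\<forall>v\<in>carrier scalar_group. a v = v)"
    proof
      assume "a 1 = 0"
      then have "a v = 0" for v
        using a[of v] by simp
      then show ?thesis
        by simp
    next
      assume "a 1 = 1"
      then have "a v = v" for v
        using a[of v] by simp
      then show ?thesis
        by simp
    qed
  qed
qed

context string_algebra
begin

lemma word_locale: "is_word Q \<rho> C \<Longrightarrow> string_algebra_word Q \<rho> C"
  by (intro string_algebra_word.intro string_algebra_word_axioms.intro string_algebra_axioms)

lemmas string_word_module = string_algebra_word.word_module_string[OF word_locale]

lemma string_module_isomorphic:
  assumes "is_word Q \<rho> C" "is_word Q \<rho> D"
  shows "module_isomorphic (bound_path_algebra Q \<rho>) (string_module Q C :: (_, int \<Rightarrow>\<^sub>0 'k::field) module) (string_module Q D)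
    \<longleftrightarrow> word_equiv C D"
proof
  assume "module_isomorphic (bound_path_algebra Q \<rho>) (string_module Q C :: (_, int \<Rightarrow>\<^sub>0 'k) module) (string_module Q D)"
  then show "word_equiv C D"
    by (rule word_equiv_of_isomorphic(1)[OF string_word_module[OF assms(1)] string_word_module[OF assms(2)] _
          scalar_group_nonzero])
next
  assume "word_equiv C D"
  then obtain s \<epsilon> where "aligned Q C D s \<epsilon>"
    using word_equiv_aligned[OF assms(1)] by blast
  then show "module_isomorphic (bound_path_algebra Q \<rho>) (string_module Q C :: (_, int \<Rightarrow>\<^sub>0 'k) module) (string_module Q D)"
    by (rule aligned_isomorphic[OF string_word_module[OF assms(1)] string_word_module[OF assms(2)], where \<theta> = "\<lambda>v. v"])
      (simp_all add: bij_betw_def)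
qed

end

section \<open>Indecomposability and isomorphisms of band modules\<close>

text \<open>A monomial is a scalar times a power of \<open>T\<close>, and additivity extends
  linearity from monomials to all Laurent polynomials.\<close>

lemma laurent_linearI:
  assumes V: "Module.module laurent_ring V" and W: "Module.module laurent_ring W"
    and lin: "twisted_linear V W (\<lambda>c v. Poly_Mapping.single 0 c \<odot>\<^bsub>V\<^esub> v) (\<lambda>c v. Poly_Mapping.single 0 c \<odot>\<^bsub>W\<^esub> v)
      (\<lambda>k v. Poly_Mapping.single k 1 \<odot>\<^bsub>V\<^esub> v) (\<lambda>k v. Poly_Mapping.single k (1 :: 'k::field) \<odot>\<^bsub>W\<^esub> v) a"
  shows "a \<in> linear_maps laurent_ring V W"
proof -
  interpret V: Module.module laurent_ring V
    by (rule V)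
  interpret W: Module.module laurent_ring W
    by (rule W)
  have closed: "v \<in> carrier V \<Longrightarrow> a v \<in> carrier W"
    and a_add: "v \<in> carrier V \<Longrightarrow> w \<in> carrier V \<Longrightarrow> a (v \<oplus>\<^bsub>V\<^esub> w) = a v \<oplus>\<^bsub>W\<^esub> a w"
    and scalar: "v \<in> carrier V \<Longrightarrow> a (Poly_Mapping.single 0 c \<odot>\<^bsub>V\<^esub> v) = Poly_Mapping.single 0 c \<odot>\<^bsub>W\<^esub> a v"
    and twist: "v \<in> carrier V \<Longrightarrow> a (Poly_Mapping.single k 1 \<odot>\<^bsub>V\<^esub> v) = Poly_Mapping.single k 1 \<odot>\<^bsub>W\<^esub> a v"
    for v w c k
    using lin unfolding twisted_linear_def by blast+
  have "a \<zero>\<^bsub>V\<^esub> \<oplus>\<^bsub>W\<^esub> a \<zero>\<^bsub>V\<^esub> = a \<zero>\<^bsub>V\<^esub>"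
    using a_add[of "\<zero>\<^bsub>V\<^esub>" "\<zero>\<^bsub>V\<^esub>"] by simp
  then have a_zero: "a \<zero>\<^bsub>V\<^esub> = \<zero>\<^bsub>W\<^esub>"
    using closed[OF V.zero_closed] by (metis W.add.l_cancel_one')
  have smult: "a (f \<odot>\<^bsub>V\<^esub> v) = f \<odot>\<^bsub>W\<^esub> a v" if v: "v \<in> carrier V" for f v
    using subset_UNIV[of "Poly_Mapping.keys f"]
  proof (induction rule: poly_mapping_add_single_induct)
    case zero
    show ?case
      using V.smult_l_null[OF v] W.smult_l_null[OF closed[OF v]] a_zero by simp
  next
    case (add f k c)
    have single: "Poly_Mapping.single k c = Poly_Mapping.single 0 c * Poly_Mapping.single k (1 :: 'k)"
      by (simp add: mult_single)
    have kv: "Poly_Mapping.single k 1 \<odot>\<^bsub>V\<^esub> v \<in> carrier V"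
      using v by (intro V.smult_closed) simp_all
    have "a (Poly_Mapping.single k c \<odot>\<^bsub>V\<^esub> v) = a (Poly_Mapping.single 0 c \<odot>\<^bsub>V\<^esub> (Poly_Mapping.single k 1 \<odot>\<^bsub>V\<^esub> v))"
      unfolding single using V.smult_assoc1[of "Poly_Mapping.single 0 c" "Poly_Mapping.single k 1" v] v by simp
    also have "\<dots> = Poly_Mapping.single 0 c \<odot>\<^bsub>W\<^esub> (Poly_Mapping.single k 1 \<odot>\<^bsub>W\<^esub> a v)"
      unfolding scalar[OF kv] twist[OF v] ..
    also have "\<dots> = Poly_Mapping.single k c \<odot>\<^bsub>W\<^esub> a v"
      unfolding single using W.smult_assoc1[of "Poly_Mapping.single 0 c" "Poly_Mapping.single k 1" "a v"] closed[OF v] by simp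
    finally have single_smult: "a (Poly_Mapping.single k c \<odot>\<^bsub>V\<^esub> v) = Poly_Mapping.single k c \<odot>\<^bsub>W\<^esub> a v" .
    have "(f + Poly_Mapping.single k c) \<odot>\<^bsub>V\<^esub> v = f \<odot>\<^bsub>V\<^esub> v \<oplus>\<^bsub>V\<^esub> Poly_Mapping.single k c \<odot>\<^bsub>V\<^esub> v"
      "(f + Poly_Mapping.single k c) \<odot>\<^bsub>W\<^esub> a v = f \<odot>\<^bsub>W\<^esub> a v \<oplus>\<^bsub>W\<^esub> Poly_Mapping.single k c \<odot>\<^bsub>W\<^esub> a v"
      using V.smult_l_distr[of f "Poly_Mapping.single k c" v] W.smult_l_distr[of f "Poly_Mapping.single k c" "a v"]
        v closed[OF v] by simp_all
    moreover have "f \<odot>\<^bsub>V\<^esub> v \<in> carrier V" "Poly_Mapping.single k c \<odot>\<^bsub>V\<^esub> v \<in> carrier V"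
      using v by (intro V.smult_closed; simp)+
    ultimately show ?case
      using a_add single_smult add.IH
      by simp
  qed
  show ?thesis
    by (rule linear_mapsI) (use closed a_add smult in auto)
qed

text \<open>The fixed vectors and the kernel of \<open>a\<close> are complementary by
  \<open>v = a v + (v - a v)\<close>, so one of these submodules is zero.\<close>

lemma indecomposable_idempotent:
  assumes "Module.module R M" and ind: "indecomposable R M" and a: "a \<in> linear_maps R M M"
    and idem: "\<And>v. v \<in> carrier M \<Longrightarrow> a (a v) = a v"
  shows "(\<forall>v\<in>carrier M. a v = \<zero>\<^bsub>M\<^esub>) \<or> (\<forall>v\<in>carrier M. a v = v)"
proof -
  interpret M: Module.module R M
    by fact
  note closed = linear_maps_closed[OF a] and add = linear_maps_add[OF a] and smult = linear_maps_smult[OF a]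
    and zero = linear_maps_zero[OF M.abelian_group_axioms M.abelian_group_axioms a]
  have minus: "a (\<ominus>\<^bsub>M\<^esub> v) = \<ominus>\<^bsub>M\<^esub> a v" if "v \<in> carrier M" for v
    using add[of "\<ominus>\<^bsub>M\<^esub> v" v] that zero closed by (intro M.minus_equality[symmetric]) (simp_all add: M.l_neg)
  define X where "X = {v \<in> carrier M. a v = v}"
  define Y where "Y = {v \<in> carrier M. a v = \<zero>\<^bsub>M\<^esub>}"
  have X: "submodule X R M"
    unfolding X_def by (rule M.submoduleI) (auto simp: zero minus add smult)
  have Y: "submodule Y R M"
    unfolding Y_def by (rule M.submoduleI) (auto simp: zero minus add smult)
  have "X \<inter> Y = {\<zero>\<^bsub>M\<^esub>}"
    unfolding X_def Y_def using zero by auto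
  moreover have "X <+>\<^bsub>M\<^esub> Y = carrier M"
  proof
    show "X <+>\<^bsub>M\<^esub> Y \<subseteq> carrier M"
      unfolding set_add_def' X_def Y_def by auto
    show "carrier M \<subseteq> X <+>\<^bsub>M\<^esub> Y"
    proof
      fix v assume v: "v \<in> carrier M"
      have "a v \<in> X"
        unfolding X_def using closed idem v by simp
      moreover have "\<ominus>\<^bsub>M\<^esub> a v \<oplus>\<^bsub>M\<^esub> v \<in> Y"
        unfolding Y_def using v closed idem by (simp add: add minus M.l_neg)
      moreover have "v = a v \<oplus>\<^bsub>M\<^esub> (\<ominus>\<^bsub>M\<^esub> a v \<oplus>\<^bsub>M\<^esub> v)"
        using v closed[OF v] by (simp add: M.r_neg M.a_assoc[symmetric])
      ultimately show "v \<in> X <+>\<^bsub>M\<^esub> Y"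
        unfolding set_add_def' by blast
    qed
  qed
  ultimately have "X = {\<zero>\<^bsub>M\<^esub>} \<or> Y = {\<zero>\<^bsub>M\<^esub>}"
    using ind X Y unfolding indecomposable_def by blast
  then show ?thesis
  proof
    assume "X = {\<zero>\<^bsub>M\<^esub>}"
    then have "a v = \<zero>\<^bsub>M\<^esub>" if "v \<in> carrier M" for v
      using closed[OF that] idem[OF that] unfolding X_def by blast
    then show ?thesis
      by blast
  next
    assume eq: "Y = {\<zero>\<^bsub>M\<^esub>}"
    have "a v = v" if v: "v \<in> carrier M" for v
    proof -
      have "\<ominus>\<^bsub>M\<^esub> a v \<oplus>\<^bsub>M\<^esub> v \<in> Y"
        unfolding Y_def using v closed idem by (simp add: add minus M.l_neg)
      then have "\<ominus>\<^bsub>M\<^esub> a v \<oplus>\<^bsub>M\<^esub> v = \<zero>\<^bsub>M\<^esub>"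
        unfolding eq by simp
      then have "\<ominus>\<^bsub>M\<^esub> (\<ominus>\<^bsub>M\<^esub> a v) = v"
        using v closed[OF v] by (metis M.minus_equality M.a_comm M.a_inv_closed)
      then show ?thesis
        using closed[OF v] by simp
    qed
    then show ?thesis
      by blast
  qed
qed

section \<open>Injective envelopes of simple modules\<close>

lemma (in Module.module) submodule_preimage:
  assumes "Module.module R N" and j: "j \<in> linear_maps R M N" and X: "submodule X R N"
  shows "submodule {s \<in> carrier M. j s \<in> X} R M"
proof -
  interpret N: Module.module R N
    by fact
  interpret X: submodule X R N
    by (rule X)
  note closed = linear_maps_closed[OF j] and add = linear_maps_add[OF j] and smult = linear_maps_smult[OF j]
    and zero = linear_maps_zero[OF abelian_group_axioms N.abelian_group_axioms j]
  have minus: "j (\<ominus>\<^bsub>M\<^esub> v) = \<ominus>\<^bsub>N\<^esub> j v" if "v \<in> carrier M" for v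
    using add[of "\<ominus>\<^bsub>M\<^esub> v" v] that zero closed by (intro N.minus_equality[symmetric]) (simp_all add: M.l_neg)
  have "\<zero>\<^bsub>N\<^esub> \<in> X" "\<And>x. x \<in> X \<Longrightarrow> \<ominus>\<^bsub>N\<^esub> x \<in> X" "\<And>x y. x \<in> X \<Longrightarrow> y \<in> X \<Longrightarrow> x \<oplus>\<^bsub>N\<^esub> y \<in> X"
    using X.one_closed X.m_inv_closed X.m_closed by (simp_all add: a_inv_def)
  then show ?thesis
    by (intro submoduleI) (auto simp: zero minus add smult)
qed

lemma indecomposable_injective_envelope:
  assumes S: "simple_module R S" and env: "injective_envelope R S E"
  shows "indecomposable R E"
proof -
  interpret S: Module.module R S
    using S unfolding simple_module_def by blast
  interpret E: Module.module R E
    using env unfolding injective_envelope_def injective_module_def by blast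
  obtain j where j: "j \<in> linear_maps R S E" "inj_on j (carrier S)" "essential_submodule R E (j ` carrier S)"
    using env unfolding injective_envelope_def by blast
  have j0: "j \<zero>\<^bsub>S\<^esub> = \<zero>\<^bsub>E\<^esub>"
    by (rule linear_maps_zero[OF S.abelian_group_axioms E.abelian_group_axioms j(1)])
  obtain s where s: "s \<in> carrier S" "s \<noteq> \<zero>\<^bsub>S\<^esub>"
    using S S.zero_closed unfolding simple_module_def by blast
  then have js: "j s \<in> carrier E" "j s \<noteq> \<zero>\<^bsub>E\<^esub>"
    using linear_maps_closed[OF j(1)] inj_onD[OF j(2), of s "\<zero>\<^bsub>S\<^esub>"] j0 by auto
  \<comment> \<open>Essentiality gives a nonzero vector of the embedded simple module in
    \<open>X\<close>, so the preimage of \<open>X\<close> in \<open>S\<close> is a nonzero submodule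
    and hence all of \<open>S\<close>. One fixed nonzero vector thus lies in every nonzero
    submodule, and two of these cannot meet in zero.\<close>
  have absorb: "j s \<in> X" if X: "submodule X R E" "X \<noteq> {\<zero>\<^bsub>E\<^esub>}" for X
  proof -
    have zeroX: "\<zero>\<^bsub>E\<^esub> \<in> X"
      using subgroup.one_closed[OF submodule.axioms(1)[OF X(1)]] by simp
    have "j ` carrier S \<inter> X \<noteq> {\<zero>\<^bsub>E\<^esub>}"
      using j(3) X unfolding essential_submodule_def by blast
    moreover have "\<zero>\<^bsub>E\<^esub> \<in> j ` carrier S"
      using j0 S.zero_closed by (metis imageI)
    ultimately obtain t where t: "t \<in> carrier S" "j t \<in> X" "j t \<noteq> \<zero>\<^bsub>E\<^esub>"
      using zeroX by blast
    have "{s \<in> carrier S. j s \<in> X} \<noteq> {\<zero>\<^bsub>S\<^esub>}"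
    proof
      assume "{s \<in> carrier S. j s \<in> X} = {\<zero>\<^bsub>S\<^esub>}"
      then have "t = \<zero>\<^bsub>S\<^esub>"
        using t by blast
      then show False
        using t(3) j0 by simp
    qed
    then have "{s \<in> carrier S. j s \<in> X} = carrier S"
      using S S.submodule_preimage[OF E.module_axioms j(1) X(1)] unfolding simple_module_def by blast
    then show ?thesis
      using s(1) by blast
  qed
  show ?thesis
    unfolding indecomposable_def
  proof (intro conjI allI impI)
    show "carrier E \<noteq> {\<zero>\<^bsub>E\<^esub>}"
      using js by blast
  next
    fix X Y
    assume "submodule X R E \<and> submodule Y R E \<and> X \<inter> Y = {\<zero>\<^bsub>E\<^esub>} \<and> X <+>\<^bsub>E\<^esub> Y = carrier E"
    then show "X = {\<zero>\<^bsub>E\<^esub>} \<or> Y = {\<zero>\<^bsub>E\<^esub>}"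
      using absorb[of X] absorb[of Y] js(2) by blast
  qed
qed

section \<open>The involution exchanging T and its inverse\<close>

lemma lookup_laurent_iota: "Poly_Mapping.lookup (laurent_iota f) k = Poly_Mapping.lookup f (- k)"
  unfolding laurent_iota_def by (simp add: map_key.rep_eq)

lemma laurent_iota_iota [simp]: "laurent_iota (laurent_iota f) = f"
  and laurent_iota_add: "laurent_iota (f + g) = laurent_iota f + laurent_iota g"
  by (rule poly_mapping_eqI; simp add: lookup_laurent_iota lookup_add)+

lemma laurent_iota_single [simp]: "laurent_iota (Poly_Mapping.single k c) = Poly_Mapping.single (- k) c"
  by (rule poly_mapping_eqI) (auto simp: lookup_laurent_iota lookup_single when_def)

lemma laurent_iota_one [simp]: "laurent_iota (1 :: int \<Rightarrow>\<^sub>0 'k::field) = 1"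
  using laurent_iota_single[of 0 "1 :: 'k"] by simp

lemma laurent_iota_mult: "laurent_iota (f * g) = laurent_iota f * laurent_iota g"
proof (rule poly_mapping_eqI)
  fix k :: int
  have keys: "Poly_Mapping.keys (laurent_iota f) = uminus ` Poly_Mapping.keys f"
    by (auto simp: in_keys_iff lookup_laurent_iota) (metis in_keys_iff image_eqI minus_minus)
  show "Poly_Mapping.lookup (laurent_iota (f * g)) k = Poly_Mapping.lookup (laurent_iota f * laurent_iota g) k"
    unfolding lookup_laurent_iota lookup_mult_int keys
    by (subst sum.reindex) (simp_all add: minus_diff_commute)
qed

lemma res_iota_simps [simp]:
  "carrier (res_iota V) = carrier V" "\<zero>\<^bsub>res_iota V\<^esub> = \<zero>\<^bsub>V\<^esub>" "ring.add (res_iota V) = ring.add V"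
  "f \<odot>\<^bsub>res_iota V\<^esub> v = laurent_iota f \<odot>\<^bsub>V\<^esub> v"
  by (simp_all add: res_iota_def)

lemma res_iota_res_iota: "res_iota (res_iota V) = V"
  by (simp add: res_iota_def)

lemma module_res_iota:
  assumes "Module.module laurent_ring V"
  shows "Module.module laurent_ring (res_iota V)"
proof -
  interpret V: Module.module laurent_ring V
    by fact
  have "abelian_group (res_iota V)"
    using V.abelian_group_axioms unfolding abelian_group_def abelian_monoid_def abelian_group_axioms_def by simp
  then show ?thesis
    using V.R.cring_axioms V.smult_closed V.smult_l_distr V.smult_r_distr V.smult_assoc1 V.smult_one
    by (intro moduleI) (simp_all add: laurent_iota_add laurent_iota_mult)
qed

text \<open>The involution is its own inverse, so a semilinear map can be read with the twist on
  either side.\<close>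

lemma linear_maps_res_iota:
  assumes "h \<in> linear_maps laurent_ring (res_iota V) W"
  shows "h \<in> linear_maps laurent_ring V (res_iota W)"
proof (rule linear_mapsI)
  fix f v assume "v \<in> carrier V"
  then show "h (f \<odot>\<^bsub>V\<^esub> v) = f \<odot>\<^bsub>res_iota W\<^esub> h v"
    using linear_maps_smult[OF assms, of "laurent_iota f" v] by simp
qed (use linear_maps_closed[OF assms] linear_maps_add[OF assms] in simp_all)

context string_algebra
begin

lemma periodic_locale:
  "is_word Q \<rho> C \<Longrightarrow> periodic C \<Longrightarrow> Module.module laurent_ring V \<Longrightarrow> periodic_word_module Q \<rho> C V"
  by (intro periodic_word_module.intro periodic_word_module_axioms.intro word_locale)

lemmas band_word_module = periodic_word_module.word_module_band[OF periodic_locale]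

lemma left_module_band:
  "is_word Q \<rho> C \<Longrightarrow> periodic C \<Longrightarrow> Module.module laurent_ring V \<Longrightarrow>
    left_module (bound_path_algebra Q \<rho>) (band_module Q C V)"
  by (rule word_module.axioms(2)[OF band_word_module])

lemma indecomposable_band_module:
  assumes C: "is_word Q \<rho> C" "periodic C" and V: "Module.module laurent_ring V" and ind: "indecomposable laurent_ring V"
  shows "indecomposable (bound_path_algebra Q \<rho>) (band_module Q C V)"
proof -
  interpret periodic_word_module Q \<rho> C V
    by (rule periodic_locale[OF C V])
  show ?thesis
  proof (rule word_module.indecomposableI[OF word_module_band])
    show "carrier V \<noteq> {\<zero>\<^bsub>V\<^esub>}"
      using ind unfolding indecomposable_def by blast
    show "0 \<in> word_index C"
      by simp
    show "per dvd j - i" if "sim (letter_at C) (letter_at C) i j" "sim (letter_at C) (letter_at C) j i" for i j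
      by (rule period_rigid[OF that])
  next
    fix a assume "twisted_linear V V scalar scalar twist twist a" "\<And>v. v \<in> carrier V \<Longrightarrow> a (a v) = a v"
    then show "(\<forall>v\<in>carrier V. a v = \<zero>\<^bsub>V\<^esub>) \<or> (\<forall>v\<in>carrier V. a v = v)"
      by (intro indecomposable_idempotent[OF V ind] laurent_linearI[OF V V])
  qed
qed

text \<open>The diagonal entry at position 0 is bijective, and its compatibility with scalars and
  twists makes it linear over the Laurent polynomials.\<close>

lemma coefficients_isomorphic:
  assumes C: "is_word Q \<rho> C" "periodic C" and V: "Module.module laurent_ring V" and W: "Module.module laurent_ring W"
    and iso: "module_isomorphic (bound_path_algebra Q \<rho>) (band_module Q C V) (band_module Q C W)"
  shows "module_isomorphic laurent_ring V W"
proof -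
  interpret V: periodic_word_module Q \<rho> C V
    by (rule periodic_locale[OF C V])
  interpret W: periodic_word_module Q \<rho> C W
    by (rule periodic_locale[OF C W])
  obtain h g where hg: "h \<in> linear_maps (bound_path_algebra Q \<rho>) (band_module Q C V) (band_module Q C W)"
    "g \<in> linear_maps (bound_path_algebra Q \<rho>) (band_module Q C W) (band_module Q C V)"
    and inverse: "\<And>m. m \<in> carrier (band_module Q C V) \<Longrightarrow> g (h m) = m"
    "\<And>m. m \<in> carrier (band_module Q C W) \<Longrightarrow> h (g m) = m"
    by (rule left_module.isomorphism_pair[OF left_module_band[OF C V] iso]) blast
  interpret P: word_module_rigid_pair Q \<rho> C "band_module Q C V" "band_module Q C W" V W V.per
    V.scalar W.scalar V.twist W.twist V.basis W.basis V.coord W.coord h g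
    by (intro word_module_rigid_pair.intro word_module_rigid_pair_axioms.intro word_module_hom_pair.intro
        word_module_hom.intro word_module_hom_axioms.intro V.word_module_band W.word_module_band hg V.period_rigid)
  obtain a where a: "twisted_linear V W V.scalar W.scalar V.twist W.twist a" "bij_betw a (carrier V) (carrier W)"
    using P.coefficient_iso[OF inverse, of 0] by auto
  then show ?thesis
    unfolding module_isomorphic_def using laurent_linearI[OF V W a(1)] by blast
qed

lemma band_module_shift:
  assumes C: "is_word Q \<rho> C" "periodic C" and D: "is_word Q \<rho> D" "D = word_shift C m"
    and V: "Module.module laurent_ring V" and W: "Module.module laurent_ring W"
    and iso: "module_isomorphic laurent_ring V W"
  shows "module_isomorphic (bound_path_algebra Q \<rho>) (band_module Q C V) (band_module Q D W)"
proof -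
  obtain s where s: "aligned Q C D s 1"
    unfolding D(2) using aligned_shift by blast
  obtain \<theta> where \<theta>: "\<theta> \<in> linear_maps laurent_ring V W" "bij_betw \<theta> (carrier V) (carrier W)"
    using iso unfolding module_isomorphic_def by blast
  have per: "periodic D" "period D = period C"
    unfolding D(2) by (rule periodic_shift[OF C(2)])+
  show ?thesis
    by (rule aligned_isomorphic[OF band_word_module[OF C V] band_word_module[OF D(1) per(1) W, unfolded per(2)] s \<theta>(2)])
      (simp_all add: linear_maps_add[OF \<theta>(1)] linear_maps_smult[OF \<theta>(1)])
qed

text \<open>Reversing a word turns a translation by the period into the opposite one, so the
  isomorphism of coefficients has to exchange \<open>T\<close> and its inverse. This is the origin
  of \<open>res_iota\<close>.\<close>

lemma band_module_inverse:
  assumes C: "is_word Q \<rho> C" "periodic C" and D: "is_word Q \<rho> D" "D = word_shift (word_inv C) m"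
    and V: "Module.module laurent_ring V" and W: "Module.module laurent_ring W"
    and iso: "module_isomorphic laurent_ring (res_iota V) W"
  shows "module_isomorphic (bound_path_algebra Q \<rho>) (band_module Q C V) (band_module Q D W)"
proof -
  obtain s where s: "aligned Q C D s (- 1)"
    unfolding D(2) using aligned_inverse_shift[OF C(1)] by blast
  obtain \<theta> where \<theta>: "\<theta> \<in> linear_maps laurent_ring (res_iota V) W" "bij_betw \<theta> (carrier V) (carrier W)"
    using iso unfolding module_isomorphic_def by auto
  have "word_equiv C D"
    unfolding word_equiv_def using D(2) by blast
  note per = periodic_word_equiv[OF C(2) this]
  have smult: "\<theta> (f \<odot>\<^bsub>V\<^esub> v) = laurent_iota f \<odot>\<^bsub>W\<^esub> \<theta> v" if "v \<in> carrier V" for f v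
    using linear_maps_smult[OF \<theta>(1), of "laurent_iota f" v] that by simp
  show ?thesis
    by (rule aligned_isomorphic[OF band_word_module[OF C V] band_word_module[OF D(1) per(1) W, unfolded per(2)] s \<theta>(2)])
      (use linear_maps_add[OF \<theta>(1)] smult in simp_all)
qed

text \<open>An isomorphism makes the words equivalent, and \<open>M(D,W)\<close> can then be
  rewritten as a module on the word \<open>C\<close> with coefficients \<open>W\<close> or
  \<open>res_iota W\<close>. The comparison takes place on one word, where an isomorphism is visible
  on coefficients.\<close>

lemma band_module_isomorphic:
  assumes C: "is_word Q \<rho> C" "periodic C" and D: "is_word Q \<rho> D" "periodic D"
    and V: "Module.module laurent_ring V" "carrier V \<noteq> {\<zero>\<^bsub>V\<^esub>}" and W: "Module.module laurent_ring W"
  shows "module_isomorphic (bound_path_algebra Q \<rho>) (band_module Q C V) (band_module Q D W) \<longleftrightarrow>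
    (\<exists>m. (D = word_shift C m \<and> module_isomorphic laurent_ring W V) \<or>
      (D = word_shift (word_inv C) m \<and> module_isomorphic laurent_ring W (res_iota V)))"
    (is "?iso \<longleftrightarrow> ?words")
proof
  note sym = module.module_isomorphic_sym
  assume ?words
  then show ?iso
    using band_module_shift[OF C D(1) _ V(1) W sym[OF W]] band_module_inverse[OF C D(1) _ V(1) W sym[OF W]] by blast
next
  note sym = module.module_isomorphic_sym
  assume iso: ?iso
  show ?words
  proof (cases "\<exists>m. D = word_shift C m")
    case True
    then obtain m where m: "D = word_shift C m"
      by blast
    have "module_isomorphic (bound_path_algebra Q \<rho>) (band_module Q D W) (band_module Q C W)"
      by (rule left_module.module_isomorphic_sym[OF left_module_band[OF C W]
            band_module_shift[OF C D(1) m W W module_isomorphic_refl]])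
    then have "module_isomorphic laurent_ring V W"
      by (rule coefficients_isomorphic[OF C V(1) W module_isomorphic_trans[OF iso]])
    then show ?thesis
      using m sym[OF V(1)] by blast
  next
    case False
    have "word_equiv C D"
      by (rule word_equiv_of_isomorphic(1)[OF band_word_module[OF C V(1)] band_word_module[OF D W] iso V(2)])
    with False obtain m where m: "D = word_shift (word_inv C) m"
      unfolding word_equiv_def by blast
    note W' = module_res_iota[OF W]
    have "module_isomorphic laurent_ring (res_iota (res_iota W)) W"
      unfolding res_iota_res_iota by (rule module_isomorphic_refl)
    then have "module_isomorphic (bound_path_algebra Q \<rho>) (band_module Q D W) (band_module Q C (res_iota W))"
      by (rule left_module.module_isomorphic_sym[OF left_module_band[OF C W'] band_module_inverse[OF C D(1) m W' W]])
    then have "module_isomorphic laurent_ring V (res_iota W)"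
      by (rule coefficients_isomorphic[OF C V(1) W' module_isomorphic_trans[OF iso]])
    from sym[OF V(1) this] have "module_isomorphic laurent_ring W (res_iota V)"
      unfolding module_isomorphic_def using linear_maps_res_iota by auto
    with m show ?thesis
      by blast
  qed
qed

text \<open>The nonzero coefficient is taken on the string side, so \<open>V\<close> may be the zero
  module. An equivalence from the periodic word would make the other word periodic.\<close>

lemma string_not_isomorphic_band:
  assumes C: "is_word Q \<rho> C" "periodic C" and D: "is_word Q \<rho> D" "\<not> periodic D" and V: "Module.module laurent_ring V"
  shows "\<not> module_isomorphic (bound_path_algebra Q \<rho>) (string_module Q D) (band_module Q C V)"
proof
  assume "module_isomorphic (bound_path_algebra Q \<rho>) (string_module Q D) (band_module Q C V)"
  then have "word_equiv C D"
    by (rule word_equiv_of_isomorphic(2)[OF string_word_module[OF D(1)] band_word_module[OF C V] _ scalar_group_nonzero])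
  then show False
    using periodic_word_equiv(1)[OF C(2)] D(2) by blast
qed

end

theorem theorem1p1:
  fixes Q :: "('v, 'e) pre_digraph"
    and \<rho> :: "('v, 'e) path set"
    and \<Lambda> :: "(('v, 'e) path \<Rightarrow>\<^sub>0 'k::field) set ring"
  assumes "string_algebra Q \<rho>"
    and "\<Lambda> = bound_path_algebra Q \<rho>"
  shows
    "(\<forall>C. is_word Q \<rho> C \<and> \<not> periodic C \<longrightarrow>
        left_module \<Lambda> (string_module Q C) \<and> indecomposable \<Lambda> (string_module Q C)) \<and>
     (\<forall>C (V :: (int \<Rightarrow>\<^sub>0 'k, 'x) module).
        is_word Q \<rho> C \<and> periodic C \<and> Module.module laurent_ring V \<and> indecomposable laurent_ring V \<and>
        finite_dimensional Q \<rho> (band_module Q C V) \<longrightarrow>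
        left_module \<Lambda> (band_module Q C V) \<and> indecomposable \<Lambda> (band_module Q C V)) \<and>
     (\<forall>C (V :: (int \<Rightarrow>\<^sub>0 'k, 'x) module) (S :: (int \<Rightarrow>\<^sub>0 'k, 's) module).
        is_word Q \<rho> C \<and> periodic C \<and> (direct_word C \<or> inverse_word C) \<and>
        Module.module laurent_ring V \<and> simple_module laurent_ring S \<and>
        injective_envelope laurent_ring S V \<longrightarrow>
        left_module \<Lambda> (band_module Q C V) \<and> indecomposable \<Lambda> (band_module Q C V)) \<and>
     (\<forall>C D (V :: (int \<Rightarrow>\<^sub>0 'k, 'x) module).
        is_word Q \<rho> C \<and> periodic C \<and> Module.module laurent_ring V \<and> is_word Q \<rho> D \<and> \<not> periodic D \<longrightarrow>
        \<not> module_isomorphic \<Lambda> (string_module Q D) (band_module Q C V)) \<and>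
     (\<forall>C D. is_word Q \<rho> C \<and> \<not> periodic C \<and> is_word Q \<rho> D \<and> \<not> periodic D \<longrightarrow>
        (module_isomorphic \<Lambda> (string_module Q C) (string_module Q D) \<longleftrightarrow> word_equiv C D)) \<and>
     (\<forall>C D (V :: (int \<Rightarrow>\<^sub>0 'k, 'x) module) (W :: (int \<Rightarrow>\<^sub>0 'k, 'y) module).
        is_word Q \<rho> C \<and> periodic C \<and> is_word Q \<rho> D \<and> periodic D \<and>
        Module.module laurent_ring V \<and> carrier V \<noteq> {\<zero>\<^bsub>V\<^esub>} \<and>
        Module.module laurent_ring W \<and> carrier W \<noteq> {\<zero>\<^bsub>W\<^esub>} \<longrightarrow>
        (module_isomorphic \<Lambda> (band_module Q C V) (band_module Q D W) \<longleftrightarrow>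
          (\<exists>m. (D = word_shift C m \<and> module_isomorphic laurent_ring W V) \<or>
               (D = word_shift (word_inv C) m \<and>
                module_isomorphic laurent_ring W (res_iota V)))))"
proof -
  interpret string_algebra Q \<rho>
    by (rule assms(1))
  show ?thesis
    unfolding assms(2)
    by (intro conjI allI impI; elim conjE)
      (assumption | rule string_algebra_word.left_module_string_module[OF word_locale]
        string_algebra_word.indecomposable_string_module[OF word_locale] left_module_band
        indecomposable_band_module indecomposable_injective_envelope string_not_isomorphic_band
        string_module_isomorphic band_module_isomorphic)+
qed

end
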